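(* $\mathsf{RCA}_0 \vdash \mathsf{EM} \rightarrow \mathsf{DNR}[\emptyset']$. That is, over $\mathsf{RCA}_0$, the Erdős–Moser theorem implies that for every set $X$ there is a function which is diagonally non-computable relative to $X'$.
   Context: $\mathsf{RCA}_0$ is the usual base system of reverse mathematics (second-order arithmetic with $\Delta^0_1$-comprehension and $\Sigma^0_1$-induction). A tournament $T$ on a domain $D\subseteq\mathbb{N}$ is an irreflexive binary relation on $D$ such that for all $x\ne y$ in $D$ exactly one of $T(x,y)$, $T(y,x)$ holds. It is transitive if the relation $T$ is transitive. $\mathsf{EM}$ is the statement "every infinite tournament $T$ has an infinite transitive subtournament" (i.e. there is an infinite subset of the domain on which $T$ is transitive). A function $f:\mathbb{N}\to\mathbb{N}$ is diagonally non-computable (d.n.c.) relative to $Y$ if $f(e)\neq\Phi^Y_e(e)$ for every $e$ (where this holds vacuously when $\Phi^Y_e(e)$ diverges). $\mathsf{DNR}[\emptyset']$ is the statement "for every set $X$ there is a function d.n.c. relative to $X'$", where $X'$ is the Turing jump of $X$ (in $\mathsf{RCA}_0$, where $X'$ need not exist as a set, computations relative to $X'$ are expressed by formulas in the usual way). *)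

theory Defs
  imports Main
begin

section \<open>The language of second-order arithmetic and its logic\<close>

text \<open>
  Two-sorted first-order syntax with de Bruijn indices. The number sort and the set sort have
  separate index spaces: \<open>ForallN\<close> binds number index 0 and \<open>ForallS\<close> binds set index 0.
  There is no primitive equality between sets.
\<close>

datatype tm = Var nat | Zero | One | Plus tm tm | Times tm tm

datatype fm =
    Eq tm tm | Lt tm tm | Mem tm nat
  | Falsum | Imp fm fm
  | ForallN fm | ForallS fm

definition Neg :: "fm \<Rightarrow> fm" where
  "Neg p = Imp p Falsum"

definition Conj :: "fm \<Rightarrow> fm \<Rightarrow> fm" where
  "Conj p q = Neg (Imp p (Neg q))"

definition Disj :: "fm \<Rightarrow> fm \<Rightarrow> fm" where
  "Disj p q = Imp (Neg p) q"

definition Iff :: "fm \<Rightarrow> fm \<Rightarrow> fm" where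
  "Iff p q = Conj (Imp p q) (Imp q p)"

definition ExistsN :: "fm \<Rightarrow> fm" where
  "ExistsN p = Neg (ForallN (Neg p))"

definition ExistsS :: "fm \<Rightarrow> fm" where
  "ExistsS p = Neg (ForallS (Neg p))"

primrec subst_tm :: "(nat \<Rightarrow> tm) \<Rightarrow> tm \<Rightarrow> tm" where
  "subst_tm s (Var i) = s i"
| "subst_tm s Zero = Zero"
| "subst_tm s One = One"
| "subst_tm s (Plus t u) = Plus (subst_tm s t) (subst_tm s u)"
| "subst_tm s (Times t u) = Times (subst_tm s t) (subst_tm s u)"

definition lift_tm :: "tm \<Rightarrow> tm" where
  "lift_tm = subst_tm (\<lambda>i. Var (Suc i))"

text \<open>
  Simultaneous capture-avoiding substitution: the terms \<open>s i\<close> for the number variables and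
  the set variables \<open>r i\<close> for the set variables.
\<close>

primrec subst_fm :: "(nat \<Rightarrow> tm) \<Rightarrow> (nat \<Rightarrow> nat) \<Rightarrow> fm \<Rightarrow> fm" where
  "subst_fm s r (Eq t u) = Eq (subst_tm s t) (subst_tm s u)"
| "subst_fm s r (Lt t u) = Lt (subst_tm s t) (subst_tm s u)"
| "subst_fm s r (Mem t X) = Mem (subst_tm s t) (r X)"
| "subst_fm s r Falsum = Falsum"
| "subst_fm s r (Imp p q) = Imp (subst_fm s r p) (subst_fm s r q)"
| "subst_fm s r (ForallN p) =
     ForallN (subst_fm (case_nat (Var 0) (\<lambda>i. lift_tm (s i))) r p)"
| "subst_fm s r (ForallS p) =
     ForallS (subst_fm s (case_nat 0 (\<lambda>i. Suc (r i))) p)"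

definition liftN :: "fm \<Rightarrow> fm" where
  "liftN = subst_fm (\<lambda>i. Var (Suc i)) id"

definition liftS :: "fm \<Rightarrow> fm" where
  "liftS = subst_fm Var Suc"

definition instN :: "tm \<Rightarrow> fm \<Rightarrow> fm" where
  "instN t = subst_fm (case_nat t Var) id"

definition instS :: "nat \<Rightarrow> fm \<Rightarrow> fm" where
  "instS X = subst_fm Var (case_nat X id)"

text \<open>Classical natural deduction with equality for the number sort.\<close>

inductive derives :: "fm set \<Rightarrow> fm \<Rightarrow> bool" (infix "\<turnstile>" 50) where
  Assm: "p \<in> G \<Longrightarrow> G \<turnstile> p"
| ImpI: "insert p G \<turnstile> q \<Longrightarrow> G \<turnstile> Imp p q"
| ImpE: "G \<turnstile> Imp p q \<Longrightarrow> G \<turnstile> p \<Longrightarrow> G \<turnstile> q"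
| Contr: "insert (Neg p) G \<turnstile> Falsum \<Longrightarrow> G \<turnstile> p"
| ForallNI: "liftN ` G \<turnstile> p \<Longrightarrow> G \<turnstile> ForallN p"
| ForallNE: "G \<turnstile> ForallN p \<Longrightarrow> G \<turnstile> instN t p"
| ForallSI: "liftS ` G \<turnstile> p \<Longrightarrow> G \<turnstile> ForallS p"
| ForallSE: "G \<turnstile> ForallS p \<Longrightarrow> G \<turnstile> instS X p"
| EqRefl: "G \<turnstile> Eq t t"
| EqSubst: "G \<turnstile> Eq t u \<Longrightarrow> G \<turnstile> instN t p \<Longrightarrow> G \<turnstile> instN u p"


section \<open>Formulas in higher-order abstract syntax\<close>

text \<open>
  Concrete formulas are written with Isabelle binders. A scoped object takes the number of
  enclosing number quantifiers and the number of enclosing set quantifiers, and returns its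
  de Bruijn representation at that place (scoped terms depend on the first number only, scoped
  set variables on the second only). A variable bound at depth \<open>d\<close> has index
  \<open>d' - Suc d\<close> at any depth \<open>d' > d\<close>. A closed formula \<open>A\<close> is turned into a sentence by
  \<open>A 0 0\<close>.
\<close>

type_synonym stm = "nat \<Rightarrow> tm"
type_synonym svar = "nat \<Rightarrow> nat"
type_synonym sfm = "nat \<Rightarrow> nat \<Rightarrow> fm"

definition s_num :: "nat \<Rightarrow> stm" where
  "s_num n = (\<lambda>d. ((\<lambda>t. Plus t One) ^^ n) Zero)"

definition s_plus :: "stm \<Rightarrow> stm \<Rightarrow> stm" (infixl "\<^bold>+" 65) where
  "t \<^bold>+ u = (\<lambda>d. Plus (t d) (u d))"

definition s_times :: "stm \<Rightarrow> stm \<Rightarrow> stm" (infixl "\<^bold>*" 70) where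
  "t \<^bold>* u = (\<lambda>d. Times (t d) (u d))"

definition s_zero :: stm ("\<^bold>0") where
  "\<^bold>0 = (\<lambda>d. Zero)"

definition s_one :: stm ("\<^bold>1") where
  "\<^bold>1 = (\<lambda>d. One)"

definition s_eq :: "stm \<Rightarrow> stm \<Rightarrow> sfm" (infix "\<^bold>=" 50) where
  "(t \<^bold>= u) = (\<lambda>d k. Eq (t d) (u d))"

definition s_lt :: "stm \<Rightarrow> stm \<Rightarrow> sfm" (infix "\<^bold><" 50) where
  "(t \<^bold>< u) = (\<lambda>d k. Lt (t d) (u d))"

definition s_mem :: "stm \<Rightarrow> svar \<Rightarrow> sfm" (infix "\<^bold>\<in>" 50) where
  "(t \<^bold>\<in> X) = (\<lambda>d k. Mem (t d) (X k))"

definition s_neg :: "sfm \<Rightarrow> sfm" ("\<^bold>\<not> _" [40] 40) where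
  "(\<^bold>\<not> A) = (\<lambda>d k. Neg (A d k))"

definition s_conj :: "sfm \<Rightarrow> sfm \<Rightarrow> sfm" (infixr "\<^bold>\<and>" 35) where
  "(A \<^bold>\<and> B) = (\<lambda>d k. Conj (A d k) (B d k))"

definition s_disj :: "sfm \<Rightarrow> sfm \<Rightarrow> sfm" (infixr "\<^bold>\<or>" 30) where
  "(A \<^bold>\<or> B) = (\<lambda>d k. Disj (A d k) (B d k))"

definition s_imp :: "sfm \<Rightarrow> sfm \<Rightarrow> sfm" (infixr "\<^bold>\<longrightarrow>" 25) where
  "(A \<^bold>\<longrightarrow> B) = (\<lambda>d k. Imp (A d k) (B d k))"

definition s_iff :: "sfm \<Rightarrow> sfm \<Rightarrow> sfm" (infixr "\<^bold>\<longleftrightarrow>" 25) where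
  "(A \<^bold>\<longleftrightarrow> B) = (\<lambda>d k. Iff (A d k) (B d k))"

definition bound_num :: "nat \<Rightarrow> stm" where
  "bound_num d = (\<lambda>d'. Var (d' - Suc d))"

definition bound_set :: "nat \<Rightarrow> svar" where
  "bound_set k = (\<lambda>k'. k' - Suc k)"

definition s_all :: "(stm \<Rightarrow> sfm) \<Rightarrow> sfm" (binder "\<^bold>\<forall>" 10) where
  "s_all A = (\<lambda>d k. ForallN (A (bound_num d) (Suc d) k))"

definition s_ex :: "(stm \<Rightarrow> sfm) \<Rightarrow> sfm" (binder "\<^bold>\<exists>" 10) where
  "s_ex A = (\<lambda>d k. ExistsN (A (bound_num d) (Suc d) k))"

definition s_allS :: "(svar \<Rightarrow> sfm) \<Rightarrow> sfm" (binder "\<^bold>\<forall>\<^sub>S" 10) where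
  "s_allS A = (\<lambda>d k. ForallS (A (bound_set k) d (Suc k)))"

definition s_exS :: "(svar \<Rightarrow> sfm) \<Rightarrow> sfm" (binder "\<^bold>\<exists>\<^sub>S" 10) where
  "s_exS A = (\<lambda>d k. ExistsS (A (bound_set k) d (Suc k)))"

definition BForall :: "tm \<Rightarrow> fm \<Rightarrow> fm" where
  "BForall t p = ForallN (Imp (Lt (Var 0) (lift_tm t)) p)"

definition s_ball :: "stm \<Rightarrow> (stm \<Rightarrow> sfm) \<Rightarrow> sfm" where
  "s_ball t A = (\<lambda>d k. BForall (t d) (A (bound_num d) (Suc d) k))"

definition s_bex :: "stm \<Rightarrow> (stm \<Rightarrow> sfm) \<Rightarrow> sfm" where
  "s_bex t A = (\<^bold>\<not> s_ball t (\<lambda>x. \<^bold>\<not> A x))"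

syntax
  "_s_ball" :: "idt \<Rightarrow> stm \<Rightarrow> sfm \<Rightarrow> sfm" ("(3\<^bold>\<forall>_\<^bold><_./ _)" [0, 0, 10] 10)
  "_s_bex" :: "idt \<Rightarrow> stm \<Rightarrow> sfm \<Rightarrow> sfm" ("(3\<^bold>\<exists>_\<^bold><_./ _)" [0, 0, 10] 10)
  "_s_ball_le" :: "idt \<Rightarrow> stm \<Rightarrow> sfm \<Rightarrow> sfm" ("(3\<^bold>\<forall>_\<^bold>\<le>_./ _)" [0, 0, 10] 10)
  "_s_bex_le" :: "idt \<Rightarrow> stm \<Rightarrow> sfm \<Rightarrow> sfm" ("(3\<^bold>\<exists>_\<^bold>\<le>_./ _)" [0, 0, 10] 10)
translations
  "\<^bold>\<forall>x\<^bold><t. A" \<rightleftharpoons> "CONST s_ball t (\<lambda>x. A)"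
  "\<^bold>\<exists>x\<^bold><t. A" \<rightleftharpoons> "CONST s_bex t (\<lambda>x. A)"
  "\<^bold>\<forall>x\<^bold>\<le>t. A" \<rightharpoonup> "CONST s_ball (CONST s_plus t (CONST s_one)) (\<lambda>x. A)"
  "\<^bold>\<exists>x\<^bold>\<le>t. A" \<rightharpoonup> "CONST s_bex (CONST s_plus t (CONST s_one)) (\<lambda>x. A)"


section \<open>The axioms of \<open>RCA\<^sub>0\<close>\<close>

definition basic_axioms :: "fm set" where
  "basic_axioms = (\<lambda>A. A 0 0) `
    {\<^bold>\<forall>n. \<^bold>\<not> (n \<^bold>+ \<^bold>1 \<^bold>= \<^bold>0),
     \<^bold>\<forall>m. \<^bold>\<forall>n. m \<^bold>+ \<^bold>1 \<^bold>= n \<^bold>+ \<^bold>1 \<^bold>\<longrightarrow> m \<^bold>= n,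
     \<^bold>\<forall>m. m \<^bold>+ \<^bold>0 \<^bold>= m,
     \<^bold>\<forall>m. \<^bold>\<forall>n. m \<^bold>+ (n \<^bold>+ \<^bold>1) \<^bold>= (m \<^bold>+ n) \<^bold>+ \<^bold>1,
     \<^bold>\<forall>m. m \<^bold>* \<^bold>0 \<^bold>= \<^bold>0,
     \<^bold>\<forall>m. \<^bold>\<forall>n. m \<^bold>* (n \<^bold>+ \<^bold>1) \<^bold>= (m \<^bold>* n) \<^bold>+ m,
     \<^bold>\<forall>m. \<^bold>\<not> (m \<^bold>< \<^bold>0),
     \<^bold>\<forall>m. \<^bold>\<forall>n. m \<^bold>< n \<^bold>+ \<^bold>1 \<^bold>\<longleftrightarrow> (m \<^bold>< n \<^bold>\<or> m \<^bold>= n)}"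

inductive bounded_fm :: "fm \<Rightarrow> bool" where
  "bounded_fm (Eq t u)"
| "bounded_fm (Lt t u)"
| "bounded_fm (Mem t X)"
| "bounded_fm Falsum"
| "bounded_fm p \<Longrightarrow> bounded_fm q \<Longrightarrow> bounded_fm (Imp p q)"
| "bounded_fm p \<Longrightarrow> bounded_fm (BForall t p)"

definition Sigma01 :: "fm set" where
  "Sigma01 = {ExistsN p | p. bounded_fm p}"

definition Pi01 :: "fm set" where
  "Pi01 = {ForallN p | p. bounded_fm p}"

text \<open>In both schemes number index 0 of \<open>p\<close> (and \<open>q\<close>) is the distinguished variable.\<close>

definition induction_fm :: "fm \<Rightarrow> fm" where
  "induction_fm p =
     Imp (Conj (instN Zero p)
               (ForallN (Imp p (subst_fm (case_nat (Plus (Var 0) One) (\<lambda>i. Var (Suc i))) id p))))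
         (ForallN p)"

definition comprehension_fm :: "fm \<Rightarrow> fm \<Rightarrow> fm" where
  "comprehension_fm p q =
     Imp (ForallN (Iff p q)) (ExistsS (ForallN (Iff (Mem (Var 0) 0) (liftS p))))"

primrec scoped_tm :: "nat \<Rightarrow> tm \<Rightarrow> bool" where
  "scoped_tm n (Var i) \<longleftrightarrow> i < n"
| "scoped_tm n Zero \<longleftrightarrow> True"
| "scoped_tm n One \<longleftrightarrow> True"
| "scoped_tm n (Plus t u) \<longleftrightarrow> scoped_tm n t \<and> scoped_tm n u"
| "scoped_tm n (Times t u) \<longleftrightarrow> scoped_tm n t \<and> scoped_tm n u"

primrec scoped_fm :: "nat \<Rightarrow> nat \<Rightarrow> fm \<Rightarrow> bool" where
  "scoped_fm n k (Eq t u) \<longleftrightarrow> scoped_tm n t \<and> scoped_tm n u"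
| "scoped_fm n k (Lt t u) \<longleftrightarrow> scoped_tm n t \<and> scoped_tm n u"
| "scoped_fm n k (Mem t X) \<longleftrightarrow> scoped_tm n t \<and> X < k"
| "scoped_fm n k Falsum \<longleftrightarrow> True"
| "scoped_fm n k (Imp p q) \<longleftrightarrow> scoped_fm n k p \<and> scoped_fm n k q"
| "scoped_fm n k (ForallN p) \<longleftrightarrow> scoped_fm (Suc n) k p"
| "scoped_fm n k (ForallS p) \<longleftrightarrow> scoped_fm n (Suc k) p"

definition universal_closures :: "fm set \<Rightarrow> fm set" where
  "universal_closures A =
     {(ForallS ^^ k) ((ForallN ^^ n) p) | p n k. p \<in> A \<and> scoped_fm n k p}"

definition RCA0 :: "fm set" where
  "RCA0 = basic_axioms
     \<union> universal_closures {induction_fm p | p. p \<in> Sigma01}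
     \<union> universal_closures {comprehension_fm p q | p q. p \<in> Sigma01 \<and> q \<in> Pi01}"


section \<open>The Erdos-Moser theorem\<close>

text \<open>The pairing function \<open>\<langle>x, y\<rangle> = (x + y)\<^sup>2 + x\<close> is injective but not surjective.\<close>

definition s_pair :: "stm \<Rightarrow> stm \<Rightarrow> stm" ("\<^bold>\<langle>_,/ _\<^bold>\<rangle>") where
  "\<^bold>\<langle>t, u\<^bold>\<rangle> = (t \<^bold>+ u) \<^bold>* (t \<^bold>+ u) \<^bold>+ t"

definition s_infinite :: "svar \<Rightarrow> sfm" where
  "s_infinite D = (\<^bold>\<forall>n. \<^bold>\<exists>m. n \<^bold>< m \<^bold>\<and> m \<^bold>\<in> D)"

definition s_tournament :: "svar \<Rightarrow> svar \<Rightarrow> sfm" where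
  "s_tournament T D =
     ((\<^bold>\<forall>z. z \<^bold>\<in> T \<^bold>\<longrightarrow> (\<^bold>\<exists>x. \<^bold>\<exists>y. x \<^bold>\<in> D \<^bold>\<and> y \<^bold>\<in> D \<^bold>\<and> z \<^bold>= \<^bold>\<langle>x, y\<^bold>\<rangle>)) \<^bold>\<and>
      (\<^bold>\<forall>x. \<^bold>\<not> (\<^bold>\<langle>x, x\<^bold>\<rangle> \<^bold>\<in> T)) \<^bold>\<and>
      (\<^bold>\<forall>x. \<^bold>\<forall>y. x \<^bold>\<in> D \<^bold>\<and> y \<^bold>\<in> D \<^bold>\<and> \<^bold>\<not> (x \<^bold>= y) \<^bold>\<longrightarrow>
         (\<^bold>\<langle>x, y\<^bold>\<rangle> \<^bold>\<in> T \<^bold>\<and> \<^bold>\<not> (\<^bold>\<langle>y, x\<^bold>\<rangle> \<^bold>\<in> T)) \<^bold>\<or> (\<^bold>\<not> (\<^bold>\<langle>x, y\<^bold>\<rangle> \<^bold>\<in> T) \<^bold>\<and> \<^bold>\<langle>y, x\<^bold>\<rangle> \<^bold>\<in> T)))"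

definition s_subset :: "svar \<Rightarrow> svar \<Rightarrow> sfm" where
  "s_subset H D = (\<^bold>\<forall>x. x \<^bold>\<in> H \<^bold>\<longrightarrow> x \<^bold>\<in> D)"

definition s_transitive_on :: "svar \<Rightarrow> svar \<Rightarrow> sfm" where
  "s_transitive_on T H =
     (\<^bold>\<forall>x. \<^bold>\<forall>y. \<^bold>\<forall>z. x \<^bold>\<in> H \<^bold>\<and> y \<^bold>\<in> H \<^bold>\<and> z \<^bold>\<in> H \<^bold>\<and> \<^bold>\<langle>x, y\<^bold>\<rangle> \<^bold>\<in> T \<^bold>\<and> \<^bold>\<langle>y, z\<^bold>\<rangle> \<^bold>\<in> T
        \<^bold>\<longrightarrow> \<^bold>\<langle>x, z\<^bold>\<rangle> \<^bold>\<in> T)"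

definition EM :: fm where
  "EM = (\<^bold>\<forall>\<^sub>S D. \<^bold>\<forall>\<^sub>S T. s_infinite D \<^bold>\<and> s_tournament T D \<^bold>\<longrightarrow>
           (\<^bold>\<exists>\<^sub>S H. s_subset H D \<^bold>\<and> s_infinite H \<^bold>\<and> s_transitive_on T H)) 0 0"


section \<open>Relative computability and diagonal non-computability\<close>

text \<open>
  A number \<open>c = \<langle>a, b\<rangle>\<close> codes sequences via Goedel's \<open>\<beta>\<close>-function: its \<open>i\<close>-th entry is
  \<open>a mod (1 + (i + 1) * b)\<close>.
\<close>

definition s_entry :: "stm \<Rightarrow> stm \<Rightarrow> stm \<Rightarrow> sfm" where
  "s_entry c i v = (\<^bold>\<exists>a\<^bold>\<le>c. \<^bold>\<exists>b\<^bold>\<le>c. \<^bold>\<exists>q\<^bold>\<le>a.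
     c \<^bold>= \<^bold>\<langle>a, b\<^bold>\<rangle> \<^bold>\<and>
     v \<^bold>< \<^bold>1 \<^bold>+ (i \<^bold>+ \<^bold>1) \<^bold>* b \<^bold>\<and>
     a \<^bold>= q \<^bold>* (\<^bold>1 \<^bold>+ (i \<^bold>+ \<^bold>1) \<^bold>* b) \<^bold>+ v)"

text \<open>
  The partial functions computable relative to an oracle \<open>Q\<close> are presented by Kleene's schemes
  for partial recursive functions, with pairing in place of tuples of arguments. The index
  \<open>e\<close> of a function encodes its definition:
  \<^item> \<open>\<langle>0, 0\<rangle>\<close>: zero; \<open>\<langle>1, 0\<rangle>\<close>: successor; \<open>\<langle>2, 0\<rangle>\<close>: identity;
    \<open>\<langle>3, 0\<rangle>\<close> and \<open>\<langle>4, 0\<rangle>\<close>: the projections of a pair;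
    \<open>\<langle>5, 0\<rangle>\<close>: the characteristic function of \<open>Q\<close>;
  \<^item> \<open>\<langle>6, \<langle>a, b\<rangle>\<rangle>\<close>: the composition \<open>x \<mapsto> a(b(x))\<close>;
  \<^item> \<open>\<langle>7, \<langle>a, b\<rangle>\<rangle>\<close>: the pairing \<open>x \<mapsto> \<langle>a(x), b(x)\<rangle>\<close>;
  \<^item> \<open>\<langle>8, \<langle>a, b\<rangle>\<rangle>\<close>: primitive recursion, \<open>f(\<langle>u, 0\<rangle>) = a(u)\<close> and
    \<open>f(\<langle>u, n + 1\<rangle>) = b(\<langle>\<langle>u, n\<rangle>, f(\<langle>u, n\<rangle>)\<rangle>)\<close>;
  \<^item> \<open>\<langle>9, a\<rangle>\<close>: minimization, \<open>x \<mapsto>\<close> the least \<open>y\<close> with \<open>a(\<langle>x, y\<rangle>) = 0\<close>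
    such that \<open>a(\<langle>x, z\<rangle>)\<close> is defined for all \<open>z < y\<close>.

  Any other index stands for the nowhere defined function. A computation is a sequence \<open>c\<close> of
  entries \<open>\<langle>e, \<langle>x, y\<rangle>\<rangle>\<close>, each asserting that the function with index \<open>e\<close> has value
  \<open>y\<close> at \<open>x\<close> and each justified by earlier entries. As every number occurring in \<open>c\<close> is
  at most \<open>c\<close>, the quantifiers below may be bounded by \<open>c\<close>. The oracle is given by a formula,
  so that it need not be a set.
\<close>

definition s_earlier :: "stm \<Rightarrow> stm \<Rightarrow> stm \<Rightarrow> stm \<Rightarrow> stm \<Rightarrow> sfm" where
  "s_earlier c i e x y = (\<^bold>\<exists>j\<^bold><i. s_entry c j \<^bold>\<langle>e, \<^bold>\<langle>x, y\<^bold>\<rangle>\<^bold>\<rangle>)"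

definition s_justified ::
    "(stm \<Rightarrow> sfm) \<Rightarrow> stm \<Rightarrow> stm \<Rightarrow> stm \<Rightarrow> stm \<Rightarrow> stm \<Rightarrow> sfm" where
  "s_justified Q c i e x y =
     ((e \<^bold>= \<^bold>\<langle>s_num 0, \<^bold>0\<^bold>\<rangle> \<^bold>\<and> y \<^bold>= \<^bold>0) \<^bold>\<or>
      (e \<^bold>= \<^bold>\<langle>s_num 1, \<^bold>0\<^bold>\<rangle> \<^bold>\<and> y \<^bold>= x \<^bold>+ \<^bold>1) \<^bold>\<or>
      (e \<^bold>= \<^bold>\<langle>s_num 2, \<^bold>0\<^bold>\<rangle> \<^bold>\<and> y \<^bold>= x) \<^bold>\<or>
      (e \<^bold>= \<^bold>\<langle>s_num 3, \<^bold>0\<^bold>\<rangle> \<^bold>\<and> (\<^bold>\<exists>z\<^bold>\<le>c. x \<^bold>= \<^bold>\<langle>y, z\<^bold>\<rangle>)) \<^bold>\<or>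
      (e \<^bold>= \<^bold>\<langle>s_num 4, \<^bold>0\<^bold>\<rangle> \<^bold>\<and> (\<^bold>\<exists>z\<^bold>\<le>c. x \<^bold>= \<^bold>\<langle>z, y\<^bold>\<rangle>)) \<^bold>\<or>
      (e \<^bold>= \<^bold>\<langle>s_num 5, \<^bold>0\<^bold>\<rangle> \<^bold>\<and> ((Q x \<^bold>\<and> y \<^bold>= \<^bold>1) \<^bold>\<or> (\<^bold>\<not> Q x \<^bold>\<and> y \<^bold>= \<^bold>0))) \<^bold>\<or>
      (\<^bold>\<exists>a\<^bold>\<le>c. \<^bold>\<exists>b\<^bold>\<le>c. e \<^bold>= \<^bold>\<langle>s_num 6, \<^bold>\<langle>a, b\<^bold>\<rangle>\<^bold>\<rangle> \<^bold>\<and>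
         (\<^bold>\<exists>z\<^bold>\<le>c. s_earlier c i b x z \<^bold>\<and> s_earlier c i a z y)) \<^bold>\<or>
      (\<^bold>\<exists>a\<^bold>\<le>c. \<^bold>\<exists>b\<^bold>\<le>c. e \<^bold>= \<^bold>\<langle>s_num 7, \<^bold>\<langle>a, b\<^bold>\<rangle>\<^bold>\<rangle> \<^bold>\<and>
         (\<^bold>\<exists>v\<^bold>\<le>c. \<^bold>\<exists>w\<^bold>\<le>c. s_earlier c i a x v \<^bold>\<and> s_earlier c i b x w \<^bold>\<and> y \<^bold>= \<^bold>\<langle>v, w\<^bold>\<rangle>)) \<^bold>\<or>
      (\<^bold>\<exists>a\<^bold>\<le>c. \<^bold>\<exists>b\<^bold>\<le>c. e \<^bold>= \<^bold>\<langle>s_num 8, \<^bold>\<langle>a, b\<^bold>\<rangle>\<^bold>\<rangle> \<^bold>\<and>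
         (\<^bold>\<exists>u\<^bold>\<le>c.
            (x \<^bold>= \<^bold>\<langle>u, \<^bold>0\<^bold>\<rangle> \<^bold>\<and> s_earlier c i a u y) \<^bold>\<or>
            (\<^bold>\<exists>n\<^bold>\<le>c. \<^bold>\<exists>w\<^bold>\<le>c. x \<^bold>= \<^bold>\<langle>u, n \<^bold>+ \<^bold>1\<^bold>\<rangle> \<^bold>\<and>
               s_earlier c i e \<^bold>\<langle>u, n\<^bold>\<rangle> w \<^bold>\<and> s_earlier c i b \<^bold>\<langle>\<^bold>\<langle>u, n\<^bold>\<rangle>, w\<^bold>\<rangle> y))) \<^bold>\<or>
      (\<^bold>\<exists>a\<^bold>\<le>c. e \<^bold>= \<^bold>\<langle>s_num 9, a\<^bold>\<rangle> \<^bold>\<and> s_earlier c i a \<^bold>\<langle>x, y\<^bold>\<rangle> \<^bold>0 \<^bold>\<and>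
         (\<^bold>\<forall>z\<^bold><y. \<^bold>\<exists>w\<^bold>\<le>c. s_earlier c i a \<^bold>\<langle>x, z\<^bold>\<rangle> (w \<^bold>+ \<^bold>1))))"

definition s_computation :: "(stm \<Rightarrow> sfm) \<Rightarrow> stm \<Rightarrow> stm \<Rightarrow> sfm" where
  "s_computation Q c n =
     (\<^bold>\<forall>i\<^bold>\<le>n. \<^bold>\<exists>e\<^bold>\<le>c. \<^bold>\<exists>x\<^bold>\<le>c. \<^bold>\<exists>y\<^bold>\<le>c.
        s_entry c i \<^bold>\<langle>e, \<^bold>\<langle>x, y\<^bold>\<rangle>\<^bold>\<rangle> \<^bold>\<and> s_justified Q c i e x y)"

text \<open>\<open>\<Phi>\<^sub>e\<^sup>Q(x) = y\<close>\<close>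

definition s_Phi :: "(stm \<Rightarrow> sfm) \<Rightarrow> stm \<Rightarrow> stm \<Rightarrow> stm \<Rightarrow> sfm" where
  "s_Phi Q e x y =
     (\<^bold>\<exists>c. \<^bold>\<exists>n. s_computation Q c n \<^bold>\<and> s_entry c n \<^bold>\<langle>e, \<^bold>\<langle>x, y\<^bold>\<rangle>\<^bold>\<rangle>)"

text \<open>\<open>n \<in> X'\<close>\<close>

definition s_jump :: "svar \<Rightarrow> stm \<Rightarrow> sfm" where
  "s_jump X n = (\<^bold>\<exists>y. s_Phi (\<lambda>m. m \<^bold>\<in> X) n n y)"

definition s_function :: "svar \<Rightarrow> sfm" where
  "s_function F =
     ((\<^bold>\<forall>z. z \<^bold>\<in> F \<^bold>\<longrightarrow> (\<^bold>\<exists>x. \<^bold>\<exists>y. z \<^bold>= \<^bold>\<langle>x, y\<^bold>\<rangle>)) \<^bold>\<and>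
      (\<^bold>\<forall>x. \<^bold>\<exists>y. \<^bold>\<langle>x, y\<^bold>\<rangle> \<^bold>\<in> F) \<^bold>\<and>
      (\<^bold>\<forall>x. \<^bold>\<forall>y. \<^bold>\<forall>z. \<^bold>\<langle>x, y\<^bold>\<rangle> \<^bold>\<in> F \<^bold>\<and> \<^bold>\<langle>x, z\<^bold>\<rangle> \<^bold>\<in> F \<^bold>\<longrightarrow> y \<^bold>= z))"

definition s_dnc :: "(stm \<Rightarrow> sfm) \<Rightarrow> svar \<Rightarrow> sfm" where
  "s_dnc Q F =
     (s_function F \<^bold>\<and> (\<^bold>\<forall>e. \<^bold>\<forall>y. s_Phi Q e e y \<^bold>\<longrightarrow> \<^bold>\<not> (\<^bold>\<langle>e, y\<^bold>\<rangle> \<^bold>\<in> F)))"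

definition DNR_jump :: fm where
  "DNR_jump = (\<^bold>\<forall>\<^sub>S X. \<^bold>\<exists>\<^sub>S F. s_dnc (s_jump X) F) 0 0"

end

theory Submission
  imports Complex_Main Defs "HOL-Library.Countable_Set"
begin

text \<open>
  By the completeness theorem it suffices to show that a model of \<open>RCA\<^sub>0\<close> and the Erdos-Moser
  theorem satisfies \<open>DNR[0']\<close>. In the model, the possible value \<open>d\<close> of \<open>\<Phi>\<^sub>e(e)\<close> relative to \<open>X'\<close>
  is approximated by guesses at the stages \<open>s\<close>, and \<open>d\<close> is read as a code of \<open>2e + 1\<close> disjoint
  pairs \<open>(x, y)\<close>. A tournament is built in which each vertex \<open>s\<close> spoils, for every \<open>e < s\<close>, one
  pair of the guess for \<open>e\<close> at stage \<open>s\<close> by edges from \<open>y\<close> to \<open>s\<close> and from \<open>s\<close> to \<open>x\<close>; the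
  pairs chosen for smaller indices meet at most \<open>2e\<close> of these pairs, so one is free. If \<open>H\<close> is
  an infinite transitive subtournament and \<open>f(e)\<close> codes \<open>2e + 1\<close> edges \<open>(x, y)\<close> of \<open>H\<close> without
  common vertices, then \<open>f(e)\<close> is not the value of \<open>\<Phi>\<^sub>e(e)\<close>, since otherwise a large \<open>s\<close> in
  \<open>H\<close> would form a cycle with one of these edges.
\<close>

text \<open>The obstacle is that a model of \<open>RCA0\<close> offers induction only for Sigma^0_1
  formulas, and that neither the jump nor the map from \<open>e\<close> to the limit of its guesses
  need exist in it. Hence everything that the tournament depends on is made bounded: stage
  \<open>s\<close> sees only computations below \<open>s\<close>, the pairs selected at stage
  \<open>s\<close> form one coded finite set, and the least such code is taken, so that the edges
  become Delta^0_1. Limits are considered for one index at a time, never for all of them together.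
  Pairs selected for different indices at one stage have to be disjoint because a number that is
  first in one pair and second in another would need edges in both directions to \<open>s\<close>.
  As \<open>e\<close> may be nonstandard, finding a free pair is not external counting: it needs
  finite sets coded by numbers and a pigeonhole principle proved inside the model. Which vertices
  will belong to \<open>H\<close> is unknown when the edges are drawn. Therefore a guess is spoiled
  whatever the edges inside its pairs are; that these edges exist and point the right way matters
  only for the value of \<open>f\<close>, which is computed from \<open>H\<close>.\<close>

instance tm :: countable by countable_datatype
instance fm :: countable by countable_datatype

section \<open>Substitution\<close>

abbreviation up :: "(nat \<Rightarrow> tm) \<Rightarrow> nat \<Rightarrow> tm" where
  "up s \<equiv> case_nat (Var 0) (\<lambda>i. lift_tm (s i))"

lemma subst_tm_comp: "subst_tm s (subst_tm s' t) = subst_tm (\<lambda>i. subst_tm s (s' i)) t"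
  by (induction t) auto

lemma subst_tm_Var [simp]: "subst_tm Var t = t"
  by (induction t) auto

lemma inst_lift_tm [simp]: "subst_tm (case_nat t Var) (lift_tm u) = u"
  by (simp add: lift_tm_def subst_tm_comp)

lemma up_comp: "subst_tm (up s) (up s' i) = up (\<lambda>i. subst_tm s (s' i)) i"
  by (cases i) (simp_all add: lift_tm_def subst_tm_comp)

lemma subst_fm_comp:
  "subst_fm s r (subst_fm s' r' p) = subst_fm (\<lambda>i. subst_tm s (s' i)) (\<lambda>i. r (r' i)) p"
proof (induction p arbitrary: s r s' r')
  case (ForallN p)
  have "(\<lambda>i. subst_tm (up s) (up s' i)) = up (\<lambda>i. subst_tm s (s' i))"
    using up_comp by blast
  then show ?case by (simp add: ForallN)
next
  case (ForallS p)
  have "(\<lambda>i. case_nat 0 (\<lambda>i. Suc (r i)) (case_nat 0 (\<lambda>i. Suc (r' i)) i)) =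
      case_nat 0 (\<lambda>i. Suc (r (r' i)))"
    by (rule ext) (simp split: nat.split)
  then show ?case by (simp add: ForallS)
qed (simp_all add: subst_tm_comp)

lemma up_Var: "up Var = Var"
  by (rule ext) (simp add: lift_tm_def split: nat.split)

lemma case_nat_0_Suc: "case_nat 0 Suc = id"
  by (rule ext) (simp split: nat.split)

lemma subst_fm_id [simp]: "subst_fm Var id p = p"
proof (induction p)
  case (ForallN p)
  then show ?case using up_Var by simp
next
  case (ForallS p)
  then show ?case using case_nat_0_Suc by (simp add: id_def)
qed simp_all

lemma subst_fm_id' [simp]: "subst_fm Var (\<lambda>i. i) p = p"
  using subst_fm_id unfolding id_def .

lemma subst_tm_scoped:
  "scoped_tm n t \<Longrightarrow> (\<And>i. i < n \<Longrightarrow> s i = s' i) \<Longrightarrow> subst_tm s t = subst_tm s' t"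
  by (induction t) auto

lemma subst_fm_scoped:
  "scoped_fm n k p \<Longrightarrow> \<forall>i<n. s i = s' i \<Longrightarrow> \<forall>i<k. r i = r' i \<Longrightarrow> subst_fm s r p = subst_fm s' r' p"
proof (induction p arbitrary: n k s s' r r')
  case (ForallN p)
  have *: "\<forall>i<Suc n. up s i = up s' i"
    using ForallN.prems(2) by (simp split: nat.split)
  have "scoped_fm (Suc n) k p" using ForallN.prems(1) by simp
  then have "subst_fm (up s) r p = subst_fm (up s') r' p"
    by (rule ForallN.IH[OF _ * ForallN.prems(3)])
  then show ?case by (simp only: subst_fm.simps)
next
  case (ForallS p)
  have *: "\<forall>i<Suc k. case_nat 0 (\<lambda>i. Suc (r i)) i = case_nat 0 (\<lambda>i. Suc (r' i)) i"
    using ForallS.prems(3) by (simp split: nat.split)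
  have "scoped_fm n (Suc k) p" using ForallS.prems(1) by simp
  then have "subst_fm s (case_nat 0 (\<lambda>i. Suc (r i))) p = subst_fm s' (case_nat 0 (\<lambda>i. Suc (r' i))) p"
    by (rule ForallS.IH[OF _ ForallS.prems(2) *])
  then show ?case by (simp only: subst_fm.simps)
next
  case (Imp p q)
  from Imp.prems have "subst_fm s r p = subst_fm s' r' p" "subst_fm s r q = subst_fm s' r' q"
    by (auto intro!: Imp.IH)
  then show ?case by simp
qed (auto intro!: subst_tm_scoped)

lemma scoped_tm_mono: "scoped_tm n t \<Longrightarrow> n \<le> n' \<Longrightarrow> scoped_tm n' t"
  by (induction t) auto

lemma scoped_fm_mono: "scoped_fm n k p \<Longrightarrow> n \<le> n' \<Longrightarrow> k \<le> k' \<Longrightarrow> scoped_fm n' k' p"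
proof (induction p arbitrary: n k n' k')
  case (ForallN p)
  then show ?case by (metis Suc_le_mono scoped_fm.simps(6))
next
  case (ForallS p)
  then show ?case by (metis Suc_le_mono scoped_fm.simps(7))
qed (auto dest: scoped_tm_mono)

lemma scoped_tm_exists: "\<exists>n. scoped_tm n t"
proof (induction t)
  case (Plus t u)
  then obtain m n where "scoped_tm m t" "scoped_tm n u" by blast
  then have "scoped_tm (max m n) (Plus t u)" by (auto intro: scoped_tm_mono)
  then show ?case ..
next
  case (Times t u)
  then obtain m n where "scoped_tm m t" "scoped_tm n u" by blast
  then have "scoped_tm (max m n) (Times t u)" by (auto intro: scoped_tm_mono)
  then show ?case ..
qed auto

lemma scoped_fm_exists: "\<exists>n. scoped_fm n n p"
proof (induction p)
  case (Eq t u)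
  obtain m n where "scoped_tm m t" "scoped_tm n u" using scoped_tm_exists by blast
  then have "scoped_fm (max m n) (max m n) (Eq t u)" by (auto intro: scoped_tm_mono)
  then show ?case ..
next
  case (Lt t u)
  obtain m n where "scoped_tm m t" "scoped_tm n u" using scoped_tm_exists by blast
  then have "scoped_fm (max m n) (max m n) (Lt t u)" by (auto intro: scoped_tm_mono)
  then show ?case ..
next
  case (Mem t X)
  obtain m where "scoped_tm m t" using scoped_tm_exists by blast
  then have "scoped_fm (max m (Suc X)) (max m (Suc X)) (Mem t X)" by (auto intro: scoped_tm_mono)
  then show ?case ..
next
  case (Imp p q)
  then obtain m n where "scoped_fm m m p" "scoped_fm n n q" by blast
  then have "scoped_fm (max m n) (max m n) (Imp p q)" by (auto intro: scoped_fm_mono)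
  then show ?case ..
next
  case (ForallN p)
  then obtain n where "scoped_fm n n p" ..
  then have "scoped_fm n n (ForallN p)" by (auto intro: scoped_fm_mono)
  then show ?case ..
next
  case (ForallS p)
  then obtain n where "scoped_fm n n p" ..
  then have "scoped_fm n n (ForallS p)" by (auto intro: scoped_fm_mono)
  then show ?case ..
qed auto

section \<open>Admissible rules\<close>

lemma subst_Neg [simp]: "subst_fm s r (Neg p) = Neg (subst_fm s r p)"
  by (simp add: Neg_def)

lemma subst_liftN: "subst_fm (up s) r (liftN p) = liftN (subst_fm s r p)"
  by (simp add: liftN_def subst_fm_comp lift_tm_def)

lemma subst_liftS:
  "subst_fm s (case_nat 0 (\<lambda>i. Suc (r i))) (liftS p) = liftS (subst_fm s r p)"
  by (simp add: liftS_def subst_fm_comp)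

lemma subst_instN: "subst_fm s r (instN t p) = instN (subst_tm s t) (subst_fm (up s) r p)"
proof -
  have "(\<lambda>i. subst_tm s (case_nat t Var i)) =
      (\<lambda>i. subst_tm (case_nat (subst_tm s t) Var) (up s i))"
    by (rule ext) (simp add: lift_tm_def subst_tm_comp split: nat.split)
  then show ?thesis by (simp add: instN_def subst_fm_comp)
qed

lemma subst_instS:
  "subst_fm s r (instS X p) = instS (r X) (subst_fm s (case_nat 0 (\<lambda>i. Suc (r i))) p)"
proof -
  have "(\<lambda>i. r (case_nat X id i)) = (\<lambda>i. case_nat (r X) id (case_nat 0 (\<lambda>i. Suc (r i)) i))"
    by (rule ext) (simp split: nat.split)
  then show ?thesis by (simp add: instS_def subst_fm_comp)
qed

lemma derives_subst: "G \<turnstile> p \<Longrightarrow> subst_fm s r ` G \<turnstile> subst_fm s r p"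
proof (induction arbitrary: s r rule: derives.induct)
  case (ImpI p G q)
  then show ?case by (simp add: derives.ImpI)
next
  case (ImpE G p q)
  then show ?case by (metis derives.ImpE subst_fm.simps(5))
next
  case (Contr p G)
  have "insert (Neg (subst_fm s r p)) (subst_fm s r ` G) \<turnstile> Falsum"
    using Contr.IH[of s r] by simp
  then show ?case by (rule derives.Contr)
next
  case (ForallNI G p)
  have "liftN ` subst_fm s r ` G \<turnstile> subst_fm (up s) r p"
    using ForallNI.IH[of "up s" r] by (simp add: image_image subst_liftN)
  then show ?case by (simp add: derives.ForallNI)
next
  case (ForallNE G p t)
  then show ?case by (simp add: subst_instN derives.ForallNE)
next
  case (ForallSI G p)
  have "liftS ` subst_fm s r ` G \<turnstile> subst_fm s (case_nat 0 (\<lambda>i. Suc (r i))) p"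
    using ForallSI.IH[of s "case_nat 0 (\<lambda>i. Suc (r i))"] by (simp add: image_image subst_liftS)
  then show ?case by (simp add: derives.ForallSI)
next
  case (ForallSE G p X)
  then show ?case by (simp add: subst_instS derives.ForallSE)
next
  case (EqSubst G t u p)
  then show ?case by (metis derives.EqSubst subst_fm.simps(1) subst_instN)
qed (auto intro: derives.intros)

lemma derives_weaken: "G \<turnstile> p \<Longrightarrow> G \<subseteq> G' \<Longrightarrow> G' \<turnstile> p"
proof (induction arbitrary: G' rule: derives.induct)
  case (ImpI p G q)
  then show ?case by (meson derives.ImpI insert_mono)
next
  case (Contr p G)
  then show ?case by (meson derives.Contr insert_mono)
next
  case (ForallNI G p)
  then show ?case by (meson derives.ForallNI image_mono)
next
  case (ForallSI G p)
  then show ?case by (meson derives.ForallSI image_mono)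
qed (blast intro: derives.intros)+

lemma derives_finite: "G \<turnstile> p \<Longrightarrow> \<exists>F. finite F \<and> F \<subseteq> G \<and> F \<turnstile> p"
proof (induction rule: derives.induct)
  case (Assm p G)
  then show ?case by (intro exI[of _ "{p}"]) (auto intro: derives.Assm)
next
  case (ImpI p G q)
  then obtain F where F: "finite F" "F \<subseteq> insert p G" "F \<turnstile> q" by blast
  then have "insert p (F - {p}) \<turnstile> q" by (auto intro: derives_weaken)
  then show ?case using F by (intro exI[of _ "F - {p}"]) (auto intro: derives.ImpI)
next
  case (ImpE G p q)
  then obtain F F' where F: "finite F" "F \<subseteq> G" "F \<turnstile> Imp p q" "finite F'" "F' \<subseteq> G" "F' \<turnstile> p"
    by blast
  then have "F \<union> F' \<turnstile> q"
    by (meson derives.ImpE derives_weaken sup_ge1 sup_ge2)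
  then show ?case using F by (intro exI[of _ "F \<union> F'"]) simp
next
  case (Contr p G)
  then obtain F where F: "finite F" "F \<subseteq> insert (Neg p) G" "F \<turnstile> Falsum" by blast
  then have "insert (Neg p) (F - {Neg p}) \<turnstile> Falsum" by (auto intro: derives_weaken)
  then show ?case using F by (intro exI[of _ "F - {Neg p}"]) (auto intro: derives.Contr)
next
  case (ForallNI G p)
  then obtain F where F: "finite F" "F \<subseteq> liftN ` G" "F \<turnstile> p" by blast
  then obtain F' where "F' \<subseteq> G" "finite F'" "F = liftN ` F'" by (meson finite_subset_image)
  then show ?case using F by (intro exI[of _ F']) (auto intro: derives.ForallNI)
next
  case (ForallNE G p t)
  then show ?case by (meson derives.ForallNE)
next
  case (ForallSI G p)
  then obtain F where F: "finite F" "F \<subseteq> liftS ` G" "F \<turnstile> p" by blast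
  then obtain F' where "F' \<subseteq> G" "finite F'" "F = liftS ` F'" by (meson finite_subset_image)
  then show ?case using F by (intro exI[of _ F']) (auto intro: derives.ForallSI)
next
  case (ForallSE G p X)
  then show ?case by (meson derives.ForallSE)
next
  case (EqRefl G t)
  then show ?case by (intro exI[of _ "{}"]) (auto intro: derives.EqRefl)
next
  case (EqSubst G t u p)
  then obtain F F' where F: "finite F" "F \<subseteq> G" "F \<turnstile> Eq t u" "finite F'" "F' \<subseteq> G" "F' \<turnstile> instN t p"
    by blast
  then have "F \<union> F' \<turnstile> instN u p"
    by (meson derives.EqSubst derives_weaken sup_ge1 sup_ge2)
  then show ?case using F by (intro exI[of _ "F \<union> F'"]) simp
qed

lemma derives_Falsum: "G \<turnstile> Falsum \<Longrightarrow> G \<turnstile> p"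
  by (rule derives.Contr) (auto intro: derives_weaken)

lemma derives_cut: "G \<turnstile> p \<Longrightarrow> insert p G \<turnstile> q \<Longrightarrow> G \<turnstile> q"
  by (blast intro: derives.ImpI derives.ImpE)

lemma derives_NegE: "G \<turnstile> Neg p \<Longrightarrow> G \<turnstile> p \<Longrightarrow> G \<turnstile> q"
  by (metis Neg_def derives.ImpE derives_Falsum)

section \<open>Henkin extensions\<close>

text \<open>Fresh number and set variables play the part of the Henkin constants.\<close>

definition fresh :: "nat \<Rightarrow> fm \<Rightarrow> bool" where
  "fresh k p \<longleftrightarrow> (\<forall>s s' r r'. (\<forall>i. i \<noteq> k \<longrightarrow> s i = s' i) \<longrightarrow> (\<forall>i. i \<noteq> k \<longrightarrow> r i = r' i) \<longrightarrow>
     subst_fm s r p = subst_fm s' r' p)"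

lemma freshD:
  "fresh k p \<Longrightarrow> (\<And>i. i \<noteq> k \<Longrightarrow> s i = s' i) \<Longrightarrow> (\<And>i. i \<noteq> k \<Longrightarrow> r i = r' i) \<Longrightarrow>
   subst_fm s r p = subst_fm s' r' p"
  unfolding fresh_def by blast

lemma scoped_imp_fresh: "scoped_fm n n p \<Longrightarrow> n \<le> k \<Longrightarrow> fresh k p"
  unfolding fresh_def by (intro allI impI subst_fm_scoped) auto

text \<open>The substitution that sends index \<open>k\<close> to 0 and raises all others acts on
  \<open>G\<close> like \<open>liftN\<close>, since \<open>k\<close> does not occur there, and it
  undoes the instantiation of \<open>q\<close>. This turns a fresh variable into the eigenvariable
  of \<open>ForallNI\<close>.\<close>

lemma derives_fresh_ForallN:
  assumes G: "\<And>p. p \<in> G \<Longrightarrow> fresh k p" and q: "scoped_fm n n q" "n \<le> k"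
    and d: "G \<turnstile> instN (Var k) q"
  shows "G \<turnstile> ForallN q"
proof -
  let ?s = "\<lambda>i. if i = k then Var 0 else Var (Suc i)"
  have "subst_fm ?s id p = liftN p" if "p \<in> G" for p
    unfolding liftN_def by (rule freshD[OF G[OF that]]) auto
  then have "subst_fm ?s id ` G = liftN ` G" by (simp cong: image_cong)
  moreover have "subst_fm ?s id (instN (Var k) q) = subst_fm Var id q"
    unfolding instN_def subst_fm_comp
    by (rule subst_fm_scoped[OF q(1)]) (use q(2) in \<open>auto split: nat.split\<close>)
  ultimately have "liftN ` G \<turnstile> q"
    using derives_subst[OF d, of ?s id] by simp
  then show ?thesis by (rule derives.ForallNI)
qed

lemma derives_fresh_ForallS:
  assumes G: "\<And>p. p \<in> G \<Longrightarrow> fresh k p" and q: "scoped_fm n n q" "n \<le> k"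
    and d: "G \<turnstile> instS k q"
  shows "G \<turnstile> ForallS q"
proof -
  let ?r = "\<lambda>i. if i = k then 0 else Suc i"
  have "subst_fm Var ?r p = liftS p" if "p \<in> G" for p
    unfolding liftS_def by (rule freshD[OF G[OF that]]) auto
  then have "subst_fm Var ?r ` G = liftS ` G" by (simp cong: image_cong)
  moreover have "subst_fm Var ?r (instS k q) = subst_fm Var id q"
    unfolding instS_def subst_fm_comp
    by (rule subst_fm_scoped[OF q(1)]) (use q(2) in \<open>auto split: nat.split\<close>)
  ultimately have "liftS ` G \<turnstile> q"
    using derives_subst[OF d, of Var ?r] by simp
  then show ?thesis by (rule derives.ForallSI)
qed

text \<open>The supply of fresh indices is unbounded because a witness must also avoid the finitely
  many variables of the formula that it instantiates; adding one formula uses up only finitely many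
  indices.\<close>

definition extendable :: "fm set \<Rightarrow> bool" where
  "extendable G \<longleftrightarrow> \<not> G \<turnstile> Falsum \<and> (\<forall>m. \<exists>k\<ge>m. \<forall>p\<in>G. fresh k p)"

lemma fresh_insert:
  assumes "\<forall>m. \<exists>k\<ge>m. \<forall>p\<in>G. fresh k p"
  shows "\<forall>m. \<exists>k\<ge>m. \<forall>p\<in>insert q G. fresh k p"
proof
  fix m
  obtain n where n: "scoped_fm n n q" using scoped_fm_exists by blast
  obtain k where k: "k \<ge> max m n" "\<forall>p\<in>G. fresh k p" using assms by blast
  have "fresh k q" using n k(1) by (auto intro: scoped_imp_fresh)
  then show "\<exists>k\<ge>m. \<forall>p\<in>insert q G. fresh k p" using k by (intro exI[of _ k]) auto
qed

definition witnessed :: "fm set \<Rightarrow> fm \<Rightarrow> bool" where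
  "witnessed G p \<longleftrightarrow> (p \<in> G \<or> Neg p \<in> G) \<and>
     (\<forall>q. p = ForallN q \<longrightarrow> Neg p \<in> G \<longrightarrow> (\<exists>t. Neg (instN t q) \<in> G)) \<and>
     (\<forall>q. p = ForallS q \<longrightarrow> Neg p \<in> G \<longrightarrow> (\<exists>X. Neg (instS X q) \<in> G))"

lemma extend_witnessed:
  assumes "extendable G"
  shows "\<exists>G'. G \<subseteq> G' \<and> extendable G' \<and> witnessed G' p"
proof (cases "insert p G \<turnstile> Falsum")
  case False
  have "Neg p \<notin> insert p G"
    using False by (metis Assm derives_NegE insertI1)
  then show ?thesis
    using False assms fresh_insert[of G p] unfolding extendable_def witnessed_def
    by (intro exI[of _ "insert p G"]) auto
next
  case True
  then have Np: "G \<turnstile> Neg p" by (simp add: Neg_def derives.ImpI)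
  let ?G = "insert (Neg p) G"
  have c: "\<not> ?G \<turnstile> Falsum"
    using Np assms derives_cut unfolding extendable_def by blast
  have f: "\<forall>m. \<exists>k\<ge>m. \<forall>p\<in>?G. fresh k p"
    using assms fresh_insert unfolding extendable_def by blast
  consider (N) q where "p = ForallN q" | (S) q where "p = ForallS q" |
    (other) "\<And>q. p \<noteq> ForallN q" "\<And>q. p \<noteq> ForallS q" by blast
  then show ?thesis
  proof cases
    case (N q)
    obtain n where n: "scoped_fm n n q" using scoped_fm_exists by blast
    obtain k where k: "k \<ge> n" "\<forall>p\<in>?G. fresh k p" using f by blast
    let ?H = "insert (Neg (instN (Var k) q)) ?G"
    have "\<not> ?H \<turnstile> Falsum"
    proof
      assume "?H \<turnstile> Falsum"
      then have "?G \<turnstile> ForallN q"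
        using derives_fresh_ForallN[of ?G k n q] n k by (blast intro: derives.Contr)
      then show False using c N by (metis Assm derives_NegE insertI1)
    qed
    moreover have "\<forall>m. \<exists>k\<ge>m. \<forall>p\<in>?H. fresh k p" by (rule fresh_insert[OF f])
    ultimately show ?thesis
      unfolding extendable_def witnessed_def using N by (intro exI[of _ ?H]) auto
  next
    case (S q)
    obtain n where n: "scoped_fm n n q" using scoped_fm_exists by blast
    obtain k where k: "k \<ge> n" "\<forall>p\<in>?G. fresh k p" using f by blast
    let ?H = "insert (Neg (instS k q)) ?G"
    have "\<not> ?H \<turnstile> Falsum"
    proof
      assume "?H \<turnstile> Falsum"
      then have "?G \<turnstile> ForallS q"
        using derives_fresh_ForallS[of ?G k n q] n k by (blast intro: derives.Contr)
      then show False using c S by (metis Assm derives_NegE insertI1)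
    qed
    moreover have "\<forall>m. \<exists>k\<ge>m. \<forall>p\<in>?H. fresh k p" by (rule fresh_insert[OF f])
    ultimately show ?thesis
      unfolding extendable_def witnessed_def using S by (intro exI[of _ ?H]) auto
  next
    case other
    then show ?thesis
      unfolding extendable_def witnessed_def using c f by (intro exI[of _ ?G]) auto
  qed
qed

text \<open>Even indices carry the old formulas, which leaves every odd index fresh. Halving the
  indices is a substitution that undoes the doubling, so a contradiction would carry over to
  \<open>G\<close>.\<close>

lemma extendable_doubled:
  assumes "\<not> G \<turnstile> Falsum"
  shows "extendable (subst_fm (\<lambda>i. Var (2 * i)) (\<lambda>i. 2 * i) ` G)"
  unfolding extendable_def
proof (intro conjI allI notI)
  let ?d = "subst_fm (\<lambda>i. Var (2 * i)) (\<lambda>i. 2 * i)"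
  let ?h = "subst_fm (\<lambda>i. Var (i div 2)) (\<lambda>i. i div 2)"
  assume "?d ` G \<turnstile> Falsum"
  then have "?h ` ?d ` G \<turnstile> ?h Falsum" by (rule derives_subst)
  moreover have "?h (?d p) = p" for p by (simp add: subst_fm_comp)
  ultimately show False using assms by (simp add: image_image)
next
  fix m :: nat
  show "\<exists>k\<ge>m. \<forall>p\<in>subst_fm (\<lambda>i. Var (2 * i)) (\<lambda>i. 2 * i) ` G. fresh k p"
  proof (intro exI[of _ "2 * m + 1"] conjI ballI)
    fix p assume "p \<in> subst_fm (\<lambda>i. Var (2 * i)) (\<lambda>i. 2 * i) ` G"
    then obtain q where q: "p = subst_fm (\<lambda>i. Var (2 * i)) (\<lambda>i. 2 * i) q" by blast
    have "2 * i \<noteq> 2 * m + 1" for i by presburger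
    then show "fresh (2 * m + 1) p"
      unfolding fresh_def q subst_fm_comp
      by (auto intro!: arg_cong2[of _ _ _ _ "\<lambda>s r. subst_fm s r q"])
  qed simp
qed

section \<open>Truth in a maximal consistent set with witnesses\<close>

locale henkin =
  fixes H :: "fm set"
  assumes consistent: "\<not> H \<turnstile> Falsum" and witnessed: "witnessed H p"
begin

lemma in_iff: "p \<in> H \<longleftrightarrow> H \<turnstile> p"
  using consistent witnessed[of p] unfolding witnessed_def
  by (meson derives.Assm derives_NegE)

lemma Falsum_notin: "Falsum \<notin> H"
  using consistent in_iff by blast

lemma Neg_in: "Neg p \<in> H \<longleftrightarrow> p \<notin> H"
  using consistent witnessed[of p] unfolding witnessed_def
  by (meson derives.Assm derives_NegE)

lemma Imp_in: "Imp p q \<in> H \<longleftrightarrow> (p \<in> H \<longrightarrow> q \<in> H)"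
proof
  show "Imp p q \<in> H \<Longrightarrow> p \<in> H \<longrightarrow> q \<in> H"
    using in_iff derives.ImpE by blast
next
  assume *: "p \<in> H \<longrightarrow> q \<in> H"
  show "Imp p q \<in> H"
  proof (cases "p \<in> H")
    case True
    then have "insert p H \<turnstile> q" using * by (blast intro: derives.Assm)
    then show ?thesis by (simp add: in_iff derives.ImpI)
  next
    case False
    then have "insert p H \<turnstile> Neg p" by (simp add: Neg_in derives.Assm)
    then have "insert p H \<turnstile> q" by (blast intro: derives_NegE derives.Assm)
    then show ?thesis by (simp add: in_iff derives.ImpI)
  qed
qed

lemma ForallN_in: "ForallN p \<in> H \<longleftrightarrow> (\<forall>t. instN t p \<in> H)"
proof
  show "ForallN p \<in> H \<Longrightarrow> \<forall>t. instN t p \<in> H"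
    unfolding in_iff by (blast intro: derives.ForallNE)
  have "Neg (ForallN p) \<in> H \<Longrightarrow> \<exists>t. Neg (instN t p) \<in> H"
    using witnessed[of "ForallN p"] unfolding witnessed_def by blast
  then show "\<forall>t. instN t p \<in> H \<Longrightarrow> ForallN p \<in> H"
    unfolding Neg_in by blast
qed

lemma ForallS_in: "ForallS p \<in> H \<longleftrightarrow> (\<forall>X. instS X p \<in> H)"
proof
  show "ForallS p \<in> H \<Longrightarrow> \<forall>X. instS X p \<in> H"
    unfolding in_iff by (blast intro: derives.ForallSE)
  have "Neg (ForallS p) \<in> H \<Longrightarrow> \<exists>X. Neg (instS X p) \<in> H"
    using witnessed[of "ForallS p"] unfolding witnessed_def by blast
  then show "\<forall>X. instS X p \<in> H \<Longrightarrow> ForallS p \<in> H"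
    unfolding Neg_in by blast
qed

lemma Eq_refl: "Eq t t \<in> H"
  by (simp add: in_iff derives.EqRefl)

lemma Eq_subst: "Eq t u \<in> H \<Longrightarrow> instN t p \<in> H \<Longrightarrow> instN u p \<in> H"
  using in_iff derives.EqSubst by blast

lemma Eq_sym: "Eq t u \<in> H \<Longrightarrow> Eq u t \<in> H"
  using Eq_subst[of t u "Eq (Var 0) (lift_tm t)"] Eq_refl by (simp add: instN_def)

lemma Eq_trans: "Eq t u \<in> H \<Longrightarrow> Eq u w \<in> H \<Longrightarrow> Eq t w \<in> H"
  using Eq_subst[of u w "Eq (lift_tm t) (Var 0)"] by (simp add: instN_def)

lemma Eq_Plus: "Eq t t' \<in> H \<Longrightarrow> Eq u u' \<in> H \<Longrightarrow> Eq (Plus t u) (Plus t' u') \<in> H"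
  using Eq_subst[of t t' "Eq (lift_tm (Plus t u)) (Plus (Var 0) (lift_tm u))"]
    Eq_subst[of u u' "Eq (lift_tm (Plus t u)) (Plus (lift_tm t') (Var 0))"] Eq_refl
  by (simp add: instN_def)

lemma Eq_Times: "Eq t t' \<in> H \<Longrightarrow> Eq u u' \<in> H \<Longrightarrow> Eq (Times t u) (Times t' u') \<in> H"
  using Eq_subst[of t t' "Eq (lift_tm (Times t u)) (Times (Var 0) (lift_tm u))"]
    Eq_subst[of u u' "Eq (lift_tm (Times t u)) (Times (lift_tm t') (Var 0))"] Eq_refl
  by (simp add: instN_def)

lemma Eq_Lt: "Eq t t' \<in> H \<Longrightarrow> Eq u u' \<in> H \<Longrightarrow> Lt t u \<in> H \<Longrightarrow> Lt t' u' \<in> H"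
  using Eq_subst[of t t' "Lt (Var 0) (lift_tm u)"] Eq_subst[of u u' "Lt (lift_tm t') (Var 0)"]
  by (simp add: instN_def)

lemma Eq_Mem: "Eq t t' \<in> H \<Longrightarrow> Mem t X \<in> H \<Longrightarrow> Mem t' X \<in> H"
  using Eq_subst[of t t' "Mem (Var 0) X"] by (simp add: instN_def)

end

lemma henkin_extension:
  assumes "extendable G"
  shows "\<exists>H. G \<subseteq> H \<and> henkin H"
proof -
  let ?P = "\<lambda>n K. extendable K \<and> G \<subseteq> K \<and> (n > 0 \<longrightarrow> witnessed K (from_nat (n - 1)))"
  have "\<exists>f. \<forall>n. ?P n (f n) \<and> f n \<subseteq> f (Suc n)"
  proof (rule dependent_nat_choice)
    show "\<exists>K. ?P 0 K" using assms by auto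
  next
    fix K n assume "?P n K"
    then show "\<exists>K'. ?P (Suc n) K' \<and> K \<subseteq> K'"
      using extend_witnessed[of K "from_nat n"] by auto
  qed
  then obtain f where f: "\<And>n. ?P n (f n)" "\<And>n. f n \<subseteq> f (Suc n)" by blast
  have mono: "m \<le> n \<Longrightarrow> f m \<subseteq> f n" for m n
    using f(2) by (rule lift_Suc_mono_le)
  let ?H = "\<Union>n. f n"
  have cons: "\<not> ?H \<turnstile> Falsum"
  proof
    assume "?H \<turnstile> Falsum"
    then obtain F where F: "finite F" "F \<subseteq> ?H" "F \<turnstile> Falsum" using derives_finite by blast
    have "\<exists>n. F \<subseteq> f n"
      using F(1,2)
    proof (induction F)
      case (insert p F)
      then obtain m n where "F \<subseteq> f n" "p \<in> f m" by blast
      then have "insert p F \<subseteq> f (max m n)"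
        using mono[of n "max m n"] mono[of m "max m n"] by auto
      then show ?case ..
    qed simp
    then obtain n where "F \<subseteq> f n" ..
    then have "f n \<turnstile> Falsum" using F(3) derives_weaken by blast
    then show False using f(1)[of n] unfolding extendable_def by blast
  qed
  have "witnessed ?H p" for p
  proof -
    have w: "witnessed (f (Suc (to_nat p))) p" using f(1)[of "Suc (to_nat p)"] by simp
    \<comment> \<open>If \<open>Neg p\<close> enters the union at all, it is already present at the
      stage that decides \<open>p\<close>: otherwise \<open>p\<close> is there, against consistency.
      So the witness found at that stage serves the union.\<close>
    have "Neg p \<in> ?H \<Longrightarrow> Neg p \<in> f (Suc (to_nat p))"
      using w cons unfolding witnessed_def by (meson UN_I UNIV_I derives.Assm derives_NegE)
    then show ?thesis
      using w unfolding witnessed_def by blast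
  qed
  then have "henkin ?H" using cons by (simp add: henkin_def)
  moreover have "G \<subseteq> ?H" using f(1) by blast
  ultimately show ?thesis by blast
qed

section \<open>Structures and completeness\<close>

locale number_structure =
  fixes zero one :: 'n
    and plus times :: "'n \<Rightarrow> 'n \<Rightarrow> 'n"
    and less :: "'n \<Rightarrow> 'n \<Rightarrow> bool"
    and mem :: "'n \<Rightarrow> 's \<Rightarrow> bool"
begin

primrec eval :: "(nat \<Rightarrow> 'n) \<Rightarrow> tm \<Rightarrow> 'n" where
  "eval v (Var i) = v i"
| "eval v Zero = zero"
| "eval v One = one"
| "eval v (Plus t u) = plus (eval v t) (eval v u)"
| "eval v (Times t u) = times (eval v t) (eval v u)"

primrec sat :: "(nat \<Rightarrow> 'n) \<Rightarrow> (nat \<Rightarrow> 's) \<Rightarrow> fm \<Rightarrow> bool" where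
  "sat v w (Eq t u) \<longleftrightarrow> eval v t = eval v u"
| "sat v w (Lt t u) \<longleftrightarrow> less (eval v t) (eval v u)"
| "sat v w (Mem t X) \<longleftrightarrow> mem (eval v t) (w X)"
| "sat v w Falsum \<longleftrightarrow> False"
| "sat v w (Imp p q) \<longleftrightarrow> (sat v w p \<longrightarrow> sat v w q)"
| "sat v w (ForallN p) \<longleftrightarrow> (\<forall>x. sat (case_nat x v) w p)"
| "sat v w (ForallS p) \<longleftrightarrow> (\<forall>X. sat v (case_nat X w) p)"

end

text \<open>The domain is any type onto which \<open>e\<close> maps the terms with provable equality
  as kernel; \<open>inv e\<close> supplies representatives. Set variables denote themselves, which
  is possible since the language has no equality between sets.\<close>

lemma (in henkin) term_model:
  fixes e :: "tm \<Rightarrow> 'n"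
  assumes e: "\<And>t u. e t = e u \<longleftrightarrow> Eq t u \<in> H" and "surj e"
  shows "\<exists>zero one plus times less (mem :: 'n \<Rightarrow> nat \<Rightarrow> bool). \<forall>p s r.
    number_structure.sat zero one plus times less mem (\<lambda>i. e (s i)) r p \<longleftrightarrow> subst_fm s r p \<in> H"
proof -
  define i where "i = inv e"
  have ei [simp]: "e (i x) = x" for x
    unfolding i_def using \<open>surj e\<close> by (simp add: surj_f_inv_f)
  have ie: "Eq (i (e t)) t \<in> H" "Eq t (i (e t)) \<in> H" for t
    using e ei by metis+
  define plus where "plus = (\<lambda>x y. e (Plus (i x) (i y)))"
  define times where "times = (\<lambda>x y. e (Times (i x) (i y)))"
  define less where "less = (\<lambda>x y. Lt (i x) (i y) \<in> H)"
  define mem where "mem = (\<lambda>x (X :: nat). Mem (i x) X \<in> H)"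
  interpret number_structure "e Zero" "e One" plus times less mem .
  have plus: "plus (e t) (e u) = e (Plus t u)" for t u
    unfolding plus_def e by (intro Eq_Plus ie)
  have times: "times (e t) (e u) = e (Times t u)" for t u
    unfolding times_def e by (intro Eq_Times ie)
  have less: "less (e t) (e u) \<longleftrightarrow> Lt t u \<in> H" for t u
    unfolding less_def using Eq_Lt ie by blast
  have mem: "mem (e t) X \<longleftrightarrow> Mem t X \<in> H" for t X
    unfolding mem_def using Eq_Mem ie by blast
  have eval: "eval (\<lambda>i. e (s i)) t = e (subst_tm s t)" for s t
    by (induction t) (simp_all add: plus times)
  have "sat (\<lambda>i. e (s i)) r p \<longleftrightarrow> subst_fm s r p \<in> H" for s r p
  proof (induction p arbitrary: s r)
    case (ForallN p)
    have inst: "instN t (subst_fm (up s) r p) = subst_fm (case_nat t s) r p" for t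
      unfolding instN_def subst_fm_comp
      by (rule arg_cong2[of _ _ _ _ "\<lambda>s r. subst_fm s r p"])
        (auto simp: lift_tm_def subst_tm_comp split: nat.split)
    have "case_nat (e t) (\<lambda>i. e (s i)) = (\<lambda>i. e (case_nat t s i))" for t
      by (rule ext) (simp split: nat.split)
    then have "sat (case_nat (e t) (\<lambda>i. e (s i))) r p \<longleftrightarrow> subst_fm (case_nat t s) r p \<in> H" for t
      using ForallN.IH[of "case_nat t s" r] by simp
    then have "sat (\<lambda>i. e (s i)) r (ForallN p) \<longleftrightarrow> (\<forall>t. subst_fm (case_nat t s) r p \<in> H)"
      using \<open>surj e\<close> by (metis ei sat.simps(6))
    then show ?case by (simp add: ForallN_in inst)
  next
    case (ForallS p)
    have inst: "instS X (subst_fm s (case_nat 0 (\<lambda>i. Suc (r i))) p) = subst_fm s (case_nat X r) p" for X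
      unfolding instS_def subst_fm_comp
      by (rule arg_cong2[of _ _ _ _ "\<lambda>s r. subst_fm s r p"])
        (auto split: nat.split)
    show ?case by (simp add: ForallS_in inst ForallS)
  qed (simp_all add: eval e less mem Imp_in Falsum_notin)
  then show ?thesis by blast
qed

text \<open>Infinitely many provably distinct terms make the term model equipotent with any given
  infinite countable type.\<close>

lemma completeness:
  fixes num :: "nat \<Rightarrow> tm"
  assumes "\<not> G \<turnstile> Falsum"
    and distinct: "\<And>m n. n < m \<Longrightarrow> G \<turnstile> Neg (Eq (num m) (num n))"
    and closed: "\<And>n s. subst_tm s (num n) = num n"
    and inf: "infinite (UNIV :: 'n::countable set)"
  shows "\<exists>zero one plus times less (mem :: 'n \<Rightarrow> nat \<Rightarrow> bool) v w. \<forall>p\<in>G.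
    number_structure.sat zero one plus times less mem v w p"
proof -
  let ?d = "subst_fm (\<lambda>i. Var (2 * i)) (\<lambda>i. 2 * i)"
  obtain H where H: "?d ` G \<subseteq> H" "henkin H"
    using henkin_extension[OF extendable_doubled[OF assms(1)]] by blast
  interpret henkin H by (rule H)
  let ?c = "\<lambda>t. {u. Eq t u \<in> H}"
  have c: "?c t = ?c u \<longleftrightarrow> Eq t u \<in> H" for t u
    using Eq_refl Eq_sym Eq_trans by blast
  have "Neg (Eq (num m) (num n)) \<in> H" if "n < m" for m n
    using derives_weaken[OF derives_subst[OF distinct[OF that]] H(1)] closed in_iff by simp
  then have nc: "?c (num m) = ?c (num n) \<Longrightarrow> m = n" for m n
    unfolding c using Neg_in Eq_sym by (metis linorder_neqE_nat)
  have "inj (\<lambda>n. ?c (num n))"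
    by (rule injI) (rule nc)
  then have "infinite ((\<lambda>n. ?c (num n)) ` UNIV)"
    using finite_imageD infinite_UNIV_nat by blast
  then have "infinite (range ?c)"
    by (rule contrapos_nn) (auto elim!: finite_subset[rotated])
  moreover have "countable (range ?c)" by simp
  ultimately obtain f :: "tm set \<Rightarrow> nat" where f: "bij_betw f (range ?c) UNIV"
    using countableE_infinite by blast
  obtain g :: "'n \<Rightarrow> nat" where g: "bij g"
    using countableE_infinite[of "UNIV :: 'n set"] inf by auto
  \<comment> \<open>Both the set of classes and \<open>'n\<close> are countably infinite; going
    through \<open>nat\<close> identifies them.\<close>
  define e where "e t = inv g (f (?c t))" for t
  have bij: "bij (inv g)" using g by (rule bij_imp_bij_inv)
  have "e t = e u \<longleftrightarrow> Eq t u \<in> H" for t u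
  proof -
    have "e t = e u \<longleftrightarrow> f (?c t) = f (?c u)"
      unfolding e_def using bij by (simp add: bij_def inj_eq)
    also have "\<dots> \<longleftrightarrow> ?c t = ?c u"
      using f by (intro inj_on_eq_iff[of f "range ?c"]) (auto simp: bij_betw_def)
    finally show ?thesis using c by simp
  qed
  moreover have "surj e"
  proof -
    have "range e = inv g ` f ` range ?c" unfolding e_def image_image by (rule refl)
    also have "f ` range ?c = UNIV" using f by (simp add: bij_betw_def)
    finally show ?thesis using bij by (simp add: bij_def)
  qed
  ultimately have "\<exists>zero one plus times less (mem :: 'n \<Rightarrow> nat \<Rightarrow> bool). \<forall>p s r.
    number_structure.sat zero one plus times less mem (\<lambda>i. e (s i)) r p \<longleftrightarrow> subst_fm s r p \<in> H"
    by (rule term_model)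
  then obtain zero one plus times less and mem :: "'n \<Rightarrow> nat \<Rightarrow> bool" where
    *: "\<forall>p s r. number_structure.sat zero one plus times less mem (\<lambda>i. e (s i)) r p \<longleftrightarrow> subst_fm s r p \<in> H"
    by (elim exE)
  have "\<forall>p\<in>G. number_structure.sat zero one plus times less mem
      (\<lambda>i. e (Var (2 * i))) (\<lambda>i. 2 * i) p"
    using H(1) unfolding *[rule_format] by blast
  then show ?thesis by blast
qed

section \<open>Bounded definability\<close>

context number_structure
begin

text \<open>\<open>Tm\<close> and \<open>Bd\<close> describe terms and bounded formulas by their
  denotations. Definability is then proved by introduction rules on HOL predicates, parameters are
  just constants, and de Bruijn indices survive only as arguments of the valuation.\<close>

inductive Tm :: "((nat \<Rightarrow> 'n) \<Rightarrow> 'n) \<Rightarrow> bool" where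
  Tm_var: "Tm (\<lambda>v. v i)"
| Tm_const: "Tm (\<lambda>v. a)"
| Tm_plus: "Tm T \<Longrightarrow> Tm U \<Longrightarrow> Tm (\<lambda>v. plus (T v) (U v))"
| Tm_times: "Tm T \<Longrightarrow> Tm U \<Longrightarrow> Tm (\<lambda>v. times (T v) (U v))"

inductive Bd :: "((nat \<Rightarrow> 'n) \<Rightarrow> bool) \<Rightarrow> bool" where
  Bd_eq: "Tm T \<Longrightarrow> Tm U \<Longrightarrow> Bd (\<lambda>v. T v = U v)"
| Bd_less: "Tm T \<Longrightarrow> Tm U \<Longrightarrow> Bd (\<lambda>v. less (T v) (U v))"
| Bd_mem: "Tm T \<Longrightarrow> Bd (\<lambda>v. mem (T v) X)"
| Bd_False: "Bd (\<lambda>v. False)"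
| Bd_imp: "Bd P \<Longrightarrow> Bd Q \<Longrightarrow> Bd (\<lambda>v. P v \<longrightarrow> Q v)"
| Bd_ball: "Tm T \<Longrightarrow> Bd (\<lambda>v. R (v 0) (\<lambda>i. v (Suc i))) \<Longrightarrow>
    Bd (\<lambda>v. \<forall>x. less x (T v) \<longrightarrow> R x v)"

lemma Bd_not: "Bd P \<Longrightarrow> Bd (\<lambda>v. \<not> P v)"
  using Bd_imp[OF _ Bd_False] by simp

lemma Bd_True: "Bd (\<lambda>v. True)"
  using Bd_not[OF Bd_False] by simp

lemma Bd_or: "Bd P \<Longrightarrow> Bd Q \<Longrightarrow> Bd (\<lambda>v. P v \<or> Q v)"
  using Bd_imp[OF Bd_not, of P Q] by (simp add: disj_imp)

lemma Bd_and: "Bd P \<Longrightarrow> Bd Q \<Longrightarrow> Bd (\<lambda>v. P v \<and> Q v)"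
  using Bd_not[OF Bd_imp[OF _ Bd_not], of P Q] by simp

lemma Bd_iff: "Bd P \<Longrightarrow> Bd Q \<Longrightarrow> Bd (\<lambda>v. P v \<longleftrightarrow> Q v)"
  unfolding iff_conv_conj_imp by (intro Bd_and Bd_imp)

lemma Bd_bex:
  assumes "Tm T" "Bd (\<lambda>v. R (v 0) (\<lambda>i. v (Suc i)))"
  shows "Bd (\<lambda>v. \<exists>x. less x (T v) \<and> R x v)"
  using Bd_not[OF Bd_ball[OF assms(1) Bd_not[OF assms(2)]]] by simp

lemma Bd_const: "Bd (\<lambda>v. P)"
  using Bd_True Bd_False by (cases P) simp_all

lemmas Bd_intros = Tm_var Tm_const Tm_plus Tm_times Bd_eq Bd_less Bd_mem Bd_const Bd_imp Bd_not
  Bd_or Bd_and Bd_iff Bd_ball Bd_bex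

lemma Tm_subst: "Tm T \<Longrightarrow> (\<And>i. Tm (U i)) \<Longrightarrow> Tm (\<lambda>v. T (\<lambda>i. U i v))"
  by (induction rule: Tm.induct) (auto intro: Tm.intros)

lemma Bd_subst: "Bd P \<Longrightarrow> (\<And>i. Tm (U i)) \<Longrightarrow> Bd (\<lambda>v. P (\<lambda>i. U i v))"
proof (induction arbitrary: U rule: Bd.induct)
  case (Bd_ball T R)
  let ?U = "case_nat (\<lambda>v. v 0) (\<lambda>i v. U i (\<lambda>i. v (Suc i)))"
  have "Tm (?U i)" for i
    using Tm_subst[OF Bd_ball.prems, of "\<lambda>i v. v (Suc i)"] by (auto intro: Tm_var split: nat.split)
  then have "Bd (\<lambda>v. R (v 0) (\<lambda>i. U i (\<lambda>i. v (Suc i))))"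
    using Bd_ball.IH[of ?U] by simp
  then show ?case
    by (intro Bd.Bd_ball[where R = "\<lambda>x v. R x (\<lambda>i. U i v)"] Tm_subst[OF Bd_ball.hyps(1)] Bd_ball.prems)
next
  case (Bd_eq T T')
  show ?case by (intro Bd.Bd_eq Tm_subst[OF Bd_eq.hyps(1)] Tm_subst[OF Bd_eq.hyps(2)] Bd_eq.prems)
next
  case (Bd_less T T')
  show ?case by (intro Bd.Bd_less Tm_subst[OF Bd_less.hyps(1)] Tm_subst[OF Bd_less.hyps(2)] Bd_less.prems)
next
  case (Bd_mem T X)
  show ?case by (intro Bd.Bd_mem Tm_subst[OF Bd_mem.hyps(1)] Bd_mem.prems)
next
  case Bd_False
  show ?case by (rule Bd.Bd_False)
next
  case (Bd_imp P Q)
  show ?case by (intro Bd.Bd_imp Bd_imp.IH Bd_imp.prems)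
qed

lemma Bd_subst1: "Bd (\<lambda>v. P (v 0)) \<Longrightarrow> Tm T \<Longrightarrow> Bd (\<lambda>v. P (T v))"
  using Bd_subst[of "\<lambda>v. P (v 0)" "\<lambda>i. T"] by simp

lemma Bd_subst2: "Bd (\<lambda>v. P (v 0) (v 1)) \<Longrightarrow> Tm T \<Longrightarrow> Tm U \<Longrightarrow> Bd (\<lambda>v. P (T v) (U v))"
  using Bd_subst[of "\<lambda>v. P (v 0) (v 1)" "case_nat T (\<lambda>i. U)"] by (simp split: nat.split)

section \<open>Truth of substituted formulas and of universal closures\<close>

lemma eval_subst: "eval v (subst_tm s t) = eval (\<lambda>i. eval v (s i)) t"
  by (induction t) simp_all

lemma eval_lift [simp]: "eval (case_nat x v) (lift_tm t) = eval v t"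
  by (simp add: lift_tm_def eval_subst)

lemma sat_subst: "sat v w (subst_fm s r p) \<longleftrightarrow> sat (\<lambda>i. eval v (s i)) (\<lambda>i. w (r i)) p"
proof (induction p arbitrary: v w s r)
  case (ForallN p)
  have "(\<lambda>i. eval (case_nat x v) (up s i)) = case_nat x (\<lambda>i. eval v (s i))" for x
    by (rule ext) (simp split: nat.split)
  then show ?case by (simp add: ForallN)
next
  case (ForallS p)
  have "(\<lambda>i. case_nat X w (case_nat 0 (\<lambda>i. Suc (r i)) i)) = case_nat X (\<lambda>i. w (r i))" for X
    by (rule ext) (simp split: nat.split)
  then show ?case by (simp add: ForallS)
qed (simp_all add: eval_subst)

lemma sat_Neg [simp]: "sat v w (Neg p) \<longleftrightarrow> \<not> sat v w p"
  by (simp add: Neg_def)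

lemma sat_Conj [simp]: "sat v w (Conj p q) \<longleftrightarrow> sat v w p \<and> sat v w q"
  by (simp add: Conj_def)

lemma sat_Disj [simp]: "sat v w (Disj p q) \<longleftrightarrow> sat v w p \<or> sat v w q"
  by (auto simp: Disj_def)

lemma sat_Iff [simp]: "sat v w (Iff p q) \<longleftrightarrow> (sat v w p \<longleftrightarrow> sat v w q)"
  by (auto simp: Iff_def)

lemma sat_ExistsN [simp]: "sat v w (ExistsN p) \<longleftrightarrow> (\<exists>x. sat (case_nat x v) w p)"
  by (simp add: ExistsN_def)

lemma sat_ExistsS [simp]: "sat v w (ExistsS p) \<longleftrightarrow> (\<exists>X. sat v (case_nat X w) p)"
  by (simp add: ExistsS_def)

lemma sat_BForall [simp]:
  "sat v w (BForall t p) \<longleftrightarrow> (\<forall>x. less x (eval v t) \<longrightarrow> sat (case_nat x v) w p)"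
  by (simp add: BForall_def)

lemma eval_scoped: "scoped_tm n t \<Longrightarrow> \<forall>i<n. v i = v' i \<Longrightarrow> eval v t = eval v' t"
  by (induction t) auto

lemma sat_scoped:
  "scoped_fm n k p \<Longrightarrow> \<forall>i<n. v i = v' i \<Longrightarrow> \<forall>i<k. w i = w' i \<Longrightarrow> sat v w p \<longleftrightarrow> sat v' w' p"
proof (induction p arbitrary: n k v v' w w')
  case (Eq t u)
  then show ?case using eval_scoped[of n t v v'] eval_scoped[of n u v v'] by simp
next
  case (Lt t u)
  then show ?case using eval_scoped[of n t v v'] eval_scoped[of n u v v'] by simp
next
  case (Mem t X)
  then show ?case using eval_scoped[of n t v v'] by simp
next
  case (Imp p q)
  then show ?case
    using Imp.IH(1)[of n k v v' w w'] Imp.IH(2)[of n k v v' w w'] by simp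
next
  case (ForallN p)
  have "sat (case_nat x v) w p \<longleftrightarrow> sat (case_nat x v') w' p" for x
    by (rule ForallN.IH[of "Suc n" k]) (use ForallN.prems in \<open>auto split: nat.split\<close>)
  then show ?case by simp
next
  case (ForallS p)
  have "sat v (case_nat X w) p \<longleftrightarrow> sat v' (case_nat X w') p" for X
    by (rule ForallS.IH[of n "Suc k"]) (use ForallS.prems in \<open>auto split: nat.split\<close>)
  then show ?case by simp
qed simp

lemma sat_ForallN_pow:
  "sat v w ((ForallN ^^ n) p) \<Longrightarrow> sat (\<lambda>i. if i < n then v' i else v (i - n)) w p"
proof (induction n arbitrary: v)
  case (Suc n)
  have "sat (\<lambda>i. if i < n then v' i else case_nat (v' n) v (i - n)) w p"
    using Suc by simp
  moreover have "(\<lambda>i. if i < n then v' i else case_nat (v' n) v (i - n)) =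
      (\<lambda>i. if i < Suc n then v' i else v (i - Suc n))"
    by (rule ext) (auto split: nat.split intro!: arg_cong[of _ _ v])
  ultimately show ?case by simp
qed simp

lemma sat_ForallS_pow:
  "sat v w ((ForallS ^^ n) p) \<Longrightarrow> sat v (\<lambda>i. if i < n then w' i else w (i - n)) p"
proof (induction n arbitrary: w)
  case (Suc n)
  have "sat v (\<lambda>i. if i < n then w' i else case_nat (w' n) w (i - n)) p"
    using Suc by simp
  moreover have "(\<lambda>i. if i < n then w' i else case_nat (w' n) w (i - n)) =
      (\<lambda>i. if i < Suc n then w' i else w (i - Suc n))"
    by (rule ext) (auto split: nat.split intro!: arg_cong[of _ _ w])
  ultimately show ?case by simp
qed simp

text \<open>A closure over all variables of \<open>p\<close> is a sentence, so its truth under one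
  valuation gives \<open>p\<close> under every other.\<close>

lemma sat_universal_closure:
  assumes "\<And>q. q \<in> universal_closures A \<Longrightarrow> sat v w q" "p \<in> A"
  shows "sat v' w' p"
proof -
  obtain n where n: "scoped_fm n n p" using scoped_fm_exists by blast
  then have "sat v w ((ForallS ^^ n) ((ForallN ^^ n) p))"
    using assms unfolding universal_closures_def by blast
  then have "sat (\<lambda>i. if i < n then v' i else v (i - n)) (\<lambda>i. if i < n then w' i else w (i - n)) p"
    by (intro sat_ForallN_pow sat_ForallS_pow)
  then show ?thesis
    using sat_scoped[OF n, of "\<lambda>i. if i < n then v' i else v (i - n)" v'
        "\<lambda>i. if i < n then w' i else w (i - n)" w'] by simp
qed

text \<open>The enumerations \<open>a\<close> and \<open>w\<close> of both sorts supply the parameters: beyond the \<open>m\<close> variables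
  in use, the variable with index \<open>m + j\<close> denotes the parameter \<open>a j\<close>.\<close>

definition padded :: "(nat \<Rightarrow> 'n) \<Rightarrow> nat \<Rightarrow> (nat \<Rightarrow> 'n) \<Rightarrow> nat \<Rightarrow> 'n" where
  "padded a m v i = (if i < m then v i else a (i - m))"

lemma padded_case_nat: "padded a (Suc m) (case_nat x v) = case_nat x (padded a m v)"
  by (rule ext) (auto simp: padded_def split: nat.split)

definition definable_tm :: "(nat \<Rightarrow> 'n) \<Rightarrow> nat \<Rightarrow> ((nat \<Rightarrow> 'n) \<Rightarrow> 'n) \<Rightarrow> bool" where
  "definable_tm a m T \<longleftrightarrow> (\<exists>t. \<forall>v. eval (padded a m v) t = T v)"

definition definable :: "(nat \<Rightarrow> 'n) \<Rightarrow> (nat \<Rightarrow> 's) \<Rightarrow> nat \<Rightarrow> ((nat \<Rightarrow> 'n) \<Rightarrow> bool) \<Rightarrow> bool" where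
  "definable a w m P \<longleftrightarrow> (\<exists>p. bounded_fm p \<and> (\<forall>v. sat (padded a m v) w p \<longleftrightarrow> P v))"

lemma definable_tmI: "(\<And>v. eval (padded a m v) t = T v) \<Longrightarrow> definable_tm a m T"
  unfolding definable_tm_def by blast

lemma definableI:
  "bounded_fm p \<Longrightarrow> (\<And>v. sat (padded a m v) w p \<longleftrightarrow> P v) \<Longrightarrow> definable a w m P"
  unfolding definable_def by blast

text \<open>The claim is made for all large \<open>m\<close>: a variable \<open>v i\<close> keeps
  its meaning only if \<open>i < m\<close>, and the bounds needed for subterms combine without being
  computed.\<close>

lemma Tm_definable:
  assumes "Tm T" "surj a"
  shows "\<forall>\<^sub>F m in sequentially. definable_tm a m T"
  using assms(1)
proof induction
  case (Tm_var i)
  show ?case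
    using eventually_gt_at_top[of i]
  proof eventually_elim
    case (elim m)
    then show ?case by (intro definable_tmI[of _ _ "Var i"]) (simp add: padded_def)
  qed
next
  case (Tm_const x)
  obtain j where "a j = x" using assms(2) by (metis surjD)
  then have "definable_tm a m (\<lambda>v. x)" for m
    by (intro definable_tmI[of _ _ "Var (m + j)"]) (simp add: padded_def)
  then show ?case by simp
next
  case (Tm_plus T U)
  from Tm_plus.IH show ?case
  proof eventually_elim
    case (elim m)
    then obtain t u where "\<forall>v. eval (padded a m v) t = T v" "\<forall>v. eval (padded a m v) u = U v"
      unfolding definable_tm_def by blast
    then show ?case by (intro definable_tmI[of _ _ "Plus t u"]) simp
  qed
next
  case (Tm_times T U)
  from Tm_times.IH show ?case
  proof eventually_elim
    case (elim m)
    then obtain t u where "\<forall>v. eval (padded a m v) t = T v" "\<forall>v. eval (padded a m v) u = U v"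
      unfolding definable_tm_def by blast
    then show ?case by (intro definable_tmI[of _ _ "Times t u"]) simp
  qed
qed

lemma Bd_definable:
  assumes "Bd P" "surj a" "surj w"
  shows "\<forall>\<^sub>F m in sequentially. definable a w m P"
  using assms(1)
proof induction
  case (Bd_eq T U)
  from Bd_eq.hyps[THEN Tm_definable[OF _ \<open>surj a\<close>]] show ?case
  proof eventually_elim
    case (elim m)
    then obtain t u where "\<forall>v. eval (padded a m v) t = T v" "\<forall>v. eval (padded a m v) u = U v"
      unfolding definable_tm_def by blast
    then show ?case by (intro definableI[of "Eq t u"]) (simp_all add: bounded_fm.intros)
  qed
next
  case (Bd_less T U)
  from Bd_less.hyps[THEN Tm_definable[OF _ \<open>surj a\<close>]] show ?case
  proof eventually_elim
    case (elim m)
    then obtain t u where "\<forall>v. eval (padded a m v) t = T v" "\<forall>v. eval (padded a m v) u = U v"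
      unfolding definable_tm_def by blast
    then show ?case by (intro definableI[of "Lt t u"]) (simp_all add: bounded_fm.intros)
  qed
next
  case (Bd_mem T X)
  obtain k where "w k = X" using \<open>surj w\<close> by (metis surjD)
  from Tm_definable[OF Bd_mem.hyps \<open>surj a\<close>] show ?case
  proof eventually_elim
    case (elim m)
    then obtain t where "\<forall>v. eval (padded a m v) t = T v"
      unfolding definable_tm_def by blast
    then show ?case using \<open>w k = X\<close>
      by (intro definableI[of "Mem t k"]) (simp_all add: bounded_fm.intros)
  qed
next
  case Bd_False
  show ?case
    by (intro always_eventually allI definableI[of Falsum]) (simp_all add: bounded_fm.intros)
next
  case (Bd_imp P Q)
  from Bd_imp.IH show ?case
  proof eventually_elim
    case (elim m)
    then obtain p q where "bounded_fm p" "\<forall>v. sat (padded a m v) w p \<longleftrightarrow> P v"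
      "bounded_fm q" "\<forall>v. sat (padded a m v) w q \<longleftrightarrow> Q v"
      unfolding definable_def by blast
    then show ?case by (intro definableI[of "Imp p q"]) (simp_all add: bounded_fm.intros)
  qed
next
  case (Bd_ball T R)
  have "\<forall>\<^sub>F m in sequentially. definable a w (Suc m) (\<lambda>v. R (v 0) (\<lambda>i. v (Suc i)))"
    by (rule eventually_sequentially_Suc[THEN iffD2, OF Bd_ball.IH])
  with Tm_definable[OF Bd_ball.hyps(1) \<open>surj a\<close>] show ?case
  proof eventually_elim
    case (elim m)
    then obtain t p where t: "\<forall>v. eval (padded a m v) t = T v" and p: "bounded_fm p"
      "\<forall>v. sat (padded a (Suc m) v) w p \<longleftrightarrow> R (v 0) (\<lambda>i. v (Suc i))"
      unfolding definable_def definable_tm_def by blast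
    have "sat (case_nat x (padded a m v)) w p \<longleftrightarrow> R x v" for x v
      using p(2)[rule_format, of "case_nat x v"] by (simp add: padded_case_nat)
    then show ?case
      using t p(1) by (intro definableI[of "BForall t p"]) (simp_all add: bounded_fm.intros)
  qed
qed

text \<open>The form needed for the schemes: index 0 is the quantified witness, index 1 the
  distinguished variable. Keeping all large \<open>m\<close> allows two matrices to share one
  valuation in comprehension.\<close>

lemma Bd_definable_2:
  assumes "Bd (\<lambda>v. P (v 0) (v 1))" "surj a" "surj w"
  shows "\<forall>\<^sub>F m in sequentially. \<exists>p. bounded_fm p \<and>
    (\<forall>x y. sat (case_nat x (case_nat y (padded a m (\<lambda>_. zero)))) w p \<longleftrightarrow> P x y)"
proof -
  have "\<forall>\<^sub>F m in sequentially. definable a w (Suc (Suc m)) (\<lambda>v. P (v 0) (v 1))"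
    by (rule eventually_sequentially_Suc[THEN iffD2, OF eventually_sequentially_Suc[THEN iffD2, OF Bd_definable[OF assms]]])
  then show ?thesis
  proof eventually_elim
    case (elim m)
    then obtain p where "bounded_fm p"
      "\<forall>v. sat (padded a (Suc (Suc m)) v) w p \<longleftrightarrow> P (v 0) (v 1)"
      unfolding definable_def by blast
    then have "sat (case_nat x (case_nat y (padded a m (\<lambda>_. zero)))) w p \<longleftrightarrow> P x y" for x y
      using padded_case_nat by (metis (no_types) One_nat_def nat.case)
    with \<open>bounded_fm p\<close> show ?case by blast
  qed
qed

end

section \<open>Models of \<open>RCA\<^sub>0\<close>\<close>

locale rca0_model = number_structure +
  assumes plus_one_neq_zero: "plus n one \<noteq> zero"
    and plus_one_inj: "plus m one = plus n one \<Longrightarrow> m = n"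
    and plus_zero: "plus m zero = m"
    and plus_plus_one: "plus m (plus n one) = plus (plus m n) one"
    and times_zero: "times m zero = zero"
    and times_plus_one: "times m (plus n one) = plus (times m n) m"
    and not_less_zero: "\<not> less m zero"
    and less_plus_one: "less m (plus n one) \<longleftrightarrow> less m n \<or> m = n"
    and sigma1_induct: "\<And>P n. Bd (\<lambda>v. P (v 0) (v 1)) \<Longrightarrow> \<exists>z. P z zero \<Longrightarrow>
      (\<And>n. \<exists>z. P z n \<Longrightarrow> \<exists>z. P z (plus n one)) \<Longrightarrow> \<exists>z. P z n"
    and delta1_comprehension: "\<And>P Q. Bd (\<lambda>v. P (v 0) (v 1)) \<Longrightarrow> Bd (\<lambda>v. Q (v 0) (v 1)) \<Longrightarrow>
      (\<And>n. (\<exists>z. P z n) \<longleftrightarrow> (\<forall>z. Q z n)) \<Longrightarrow> \<exists>X. \<forall>n. mem n X \<longleftrightarrow> (\<exists>z. P z n)"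

text \<open>Countability of both sorts is used here: as \<open>a\<close> and \<open>w\<close> are
  onto, every parameter is the value of a variable, so the schemes hold for all bounded predicates
  with parameters.\<close>

lemma (in number_structure) sat_RCA0_imp_model:
  assumes sat: "\<And>p. p \<in> RCA0 \<Longrightarrow> sat v0 w0 p" and a: "surj (a :: nat \<Rightarrow> 'n)" and w: "surj (w :: nat \<Rightarrow> 's)"
  shows "rca0_model zero one plus times less mem"
proof -
  have "\<forall>p\<in>basic_axioms. sat v0 w0 p"
    using sat unfolding RCA0_def by blast
  then have basic: "\<forall>n. plus n one \<noteq> zero" "\<forall>m n. plus m one = plus n one \<longrightarrow> m = n"
    "\<forall>m. plus m zero = m" "\<forall>m n. plus m (plus n one) = plus (plus m n) one"
    "\<forall>m. times m zero = zero" "\<forall>m n. times m (plus n one) = plus (times m n) m"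
    "\<forall>m. \<not> less m zero" "\<forall>m n. less m (plus n one) \<longleftrightarrow> less m n \<or> m = n"
    by (simp_all add: basic_axioms_def s_all_def s_neg_def s_imp_def s_iff_def s_disj_def s_eq_def
        s_lt_def s_plus_def s_times_def s_zero_def s_one_def bound_num_def)
  have ind: "sat V W (induction_fm p)" if "p \<in> Sigma01" for V W p
    by (rule sat_universal_closure[where A = "{induction_fm p | p. p \<in> Sigma01}"])
      (use sat that in \<open>auto simp: RCA0_def\<close>)
  have compr: "sat V W (comprehension_fm p q)" if "p \<in> Sigma01" "q \<in> Pi01" for V W p q
    by (rule sat_universal_closure[where A = "{comprehension_fm p q | p q. p \<in> Sigma01 \<and> q \<in> Pi01}"])
      (use sat that in \<open>auto simp: RCA0_def\<close>)
  have inst: "(\<lambda>i. eval V (case_nat t Var i)) = case_nat (eval V t) V" for V t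
    by (rule ext) (simp split: nat.split)
  have suc: "(\<lambda>i. eval (case_nat x V) (case_nat t (\<lambda>i. Var (Suc i)) i)) =
      case_nat (eval (case_nat x V) t) V" for V x t
    by (rule ext) (simp split: nat.split)
  show ?thesis
  proof
    fix P n
    assume P: "Bd (\<lambda>v. P (v 0) (v 1))" "\<exists>z. P z zero" "\<And>n. \<exists>z. P z n \<Longrightarrow> \<exists>z. P z (plus n one)"
    obtain V p where p: "bounded_fm p" and V: "\<And>z n. sat (case_nat z (case_nat n V)) w p \<longleftrightarrow> P z n"
      using eventually_happens[OF Bd_definable_2[OF P(1) a w]] by auto
    have "sat V w (induction_fm (ExistsN p))"
      by (rule ind) (use p in \<open>auto simp: Sigma01_def\<close>)
    then show "\<exists>z. P z n"
      using P(2,3) unfolding induction_fm_def instN_def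
      by (simp add: sat_subst inst suc V)
  next
    fix P Q
    assume P: "Bd (\<lambda>v. P (v 0) (v 1))" and Q: "Bd (\<lambda>v. Q (v 0) (v 1))"
      and PQ: "\<And>n. (\<exists>z. P z n) \<longleftrightarrow> (\<forall>z. Q z n)"
    obtain V p q where p: "bounded_fm p" and Vp: "\<And>z n. sat (case_nat z (case_nat n V)) w p \<longleftrightarrow> P z n"
      and q: "bounded_fm q" and Vq: "\<And>z n. sat (case_nat z (case_nat n V)) w q \<longleftrightarrow> Q z n"
      using eventually_happens[OF eventually_conj[OF Bd_definable_2[OF P a w] Bd_definable_2[OF Q a w]]]
      by auto
    have "sat V w (comprehension_fm (ExistsN p) (ForallN q))"
      by (rule compr) (use p q in \<open>auto simp: Sigma01_def Pi01_def\<close>)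
    then have "(\<forall>n. (\<exists>z. P z n) \<longleftrightarrow> (\<forall>z. Q z n)) \<longrightarrow> (\<exists>X. \<forall>n. mem n X \<longleftrightarrow> (\<exists>z. P z n))"
      unfolding comprehension_fm_def liftS_def sat.simps sat_ExistsN sat_ExistsS sat_Iff sat_subst
        eval.simps nat.case Vp Vq .
    from mp[OF this allI[OF PQ]] show "\<exists>X. \<forall>n. mem n X \<longleftrightarrow> (\<exists>z. P z n)" .
  qed (use basic in blast)+
qed

section \<open>Discretely ordered semirings\<close>

text \<open>The facts about numbers that a type class can hold, as no sets occur in them. Standard
  arithmetic satisfies them as well, which will provide default operations.\<close>

locale discrete_semiring =
  fixes zero one :: 'n
    and plus times :: "'n \<Rightarrow> 'n \<Rightarrow> 'n"
    and less :: "'n \<Rightarrow> 'n \<Rightarrow> bool"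
  assumes plus_assoc: "plus (plus a b) c = plus a (plus b c)"
    and plus_comm: "plus a b = plus b a"
    and zero_plus: "plus zero a = a"
    and plus_cancel: "plus a c = plus b c \<Longrightarrow> a = b"
    and times_assoc: "times (times a b) c = times a (times b c)"
    and times_comm: "times a b = times b a"
    and one_times: "times one a = a"
    and zero_times: "times zero a = zero"
    and distrib: "times (plus a b) c = plus (times a c) (times b c)"
    and plus_one_not_zero: "plus a one \<noteq> zero"
    and less_iff: "less a b \<longleftrightarrow> (\<exists>c. b = plus (plus a c) one)"
    and linear: "less a b \<or> a = b \<or> less b a"

context rca0_model
begin

section \<open>Arithmetic of the model from bounded induction\<close>

lemma bounded_induct:
  assumes "Bd (\<lambda>v. P (v 0))" "P zero" "\<And>n. P n \<Longrightarrow> P (plus n one)"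
  shows "P n"
  using sigma1_induct[of "\<lambda>z n. P n" n] Bd_subst1[OF assms(1) Tm_var] assms(2,3) by simp

lemma bounded_comprehension:
  assumes "Bd (\<lambda>v. P (v 0))"
  shows "\<exists>X. \<forall>n. mem n X \<longleftrightarrow> P n"
  using delta1_comprehension[of "\<lambda>z n. P n" "\<lambda>z n. P n"] Bd_subst1[OF assms Tm_var] by simp

lemma zero_plus: "plus zero a = a"
  by (rule bounded_induct[of "\<lambda>a. plus zero a = a"])
    (intro Bd_intros, simp_all add: plus_zero plus_plus_one)

lemma plus_assoc: "plus (plus a b) c = plus a (plus b c)"
  by (rule bounded_induct[of "\<lambda>c. plus (plus a b) c = plus a (plus b c)"])
    (intro Bd_intros, simp_all add: plus_zero plus_plus_one)

lemma one_plus: "plus one a = plus a one"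
  by (rule bounded_induct[of "\<lambda>a. plus one a = plus a one"])
    (intro Bd_intros, simp_all add: plus_zero zero_plus plus_plus_one)

lemma plus_comm: "plus a b = plus b a"
proof (rule bounded_induct[of "\<lambda>b. plus a b = plus b a"])
  show "Bd (\<lambda>v. plus a (v 0) = plus (v 0) a)" by (intro Bd_intros)
  show "plus a zero = plus zero a" by (simp add: plus_zero zero_plus)
  fix n assume "plus a n = plus n a"
  then show "plus a (plus n one) = plus (plus n one) a"
    by (simp add: plus_plus_one) (simp add: plus_assoc one_plus)
qed

lemma plus_cancel: "plus a c = plus b c \<Longrightarrow> a = b"
proof -
  have "plus a c = plus b c \<longrightarrow> a = b"
    by (rule bounded_induct[of "\<lambda>c. plus a c = plus b c \<longrightarrow> a = b"])
      (intro Bd_intros, auto simp: plus_zero plus_plus_one dest: plus_one_inj)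
  then show "plus a c = plus b c \<Longrightarrow> a = b" ..
qed

lemma distrib_left: "times a (plus b c) = plus (times a b) (times a c)"
  by (rule bounded_induct[of "\<lambda>c. times a (plus b c) = plus (times a b) (times a c)"])
    (intro Bd_intros, simp_all add: plus_zero times_zero times_plus_one plus_plus_one flip: plus_assoc)

lemma zero_times: "times zero a = zero"
  by (rule bounded_induct[of "\<lambda>a. times zero a = zero"])
    (intro Bd_intros, simp_all add: plus_zero times_zero times_plus_one)

lemma distrib: "times (plus a b) c = plus (times a c) (times b c)"
proof (rule bounded_induct[of "\<lambda>c. times (plus a b) c = plus (times a c) (times b c)"])
  show "Bd (\<lambda>v. times (plus a b) (v 0) = plus (times a (v 0)) (times b (v 0)))"
    by (intro Bd_intros)
  show "times (plus a b) zero = plus (times a zero) (times b zero)"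
    by (simp add: times_zero plus_zero)
  fix n assume IH: "times (plus a b) n = plus (times a n) (times b n)"
  have "plus (plus x y) (plus a b) = plus (plus x a) (plus y b)" for x y
    by (metis plus_assoc plus_comm)
  then show "times (plus a b) (plus n one) = plus (times a (plus n one)) (times b (plus n one))"
    by (simp add: times_plus_one IH)
qed

lemma times_one: "times a one = a"
  using times_plus_one[of a zero] by (simp add: zero_plus times_zero)

lemma one_times: "times one a = a"
  by (rule bounded_induct[of "\<lambda>a. times one a = a"])
    (intro Bd_intros, simp_all add: times_zero times_plus_one)

lemma times_comm: "times a b = times b a"
  by (rule bounded_induct[of "\<lambda>b. times a b = times b a"])
    (intro Bd_intros, simp_all add: times_zero zero_times times_plus_one distrib one_times)

lemma times_assoc: "times (times a b) c = times a (times b c)"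
  by (rule bounded_induct[of "\<lambda>c. times (times a b) c = times a (times b c)"])
    (intro Bd_intros, simp_all add: times_zero times_plus_one times_one distrib_left)

lemma less_iff: "less a b \<longleftrightarrow> (\<exists>c. b = plus (plus a c) one)"
proof
  assume "less a b"
  \<comment> \<open>The witness is pulled in front of the implication, which makes the claim a
    Sigma^0_1 formula.\<close>
  have "\<exists>c. less a b \<longrightarrow> b = plus (plus a c) one"
  proof (rule sigma1_induct[of "\<lambda>c b. less a b \<longrightarrow> b = plus (plus a c) one"])
    show "Bd (\<lambda>v. less a (v 1) \<longrightarrow> v 1 = plus (plus a (v 0)) one)" by (intro Bd_intros)
    show "\<exists>z. less a zero \<longrightarrow> zero = plus (plus a z) one" by (simp add: not_less_zero)
    fix n assume "\<exists>c. less a n \<longrightarrow> n = plus (plus a c) one"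
    then show "\<exists>c. less a (plus n one) \<longrightarrow> plus n one = plus (plus a c) one"
      by (metis less_plus_one plus_plus_one plus_zero)
  qed
  with \<open>less a b\<close> show "\<exists>c. b = plus (plus a c) one" by blast
next
  assume "\<exists>c. b = plus (plus a c) one"
  then obtain c where b: "b = plus (plus a c) one" ..
  have "less a (plus (plus a c) one)"
    by (rule bounded_induct[of "\<lambda>c. less a (plus (plus a c) one)"])
      (intro Bd_intros, auto simp: less_plus_one plus_zero plus_plus_one)
  then show "less a b" by (simp add: b)
qed

lemma linear: "less a b \<or> a = b \<or> less b a"
proof (rule bounded_induct[of "\<lambda>b. less a b \<or> a = b \<or> less b a"])
  show "Bd (\<lambda>v. less a (v 0) \<or> a = v 0 \<or> less (v 0) a)" by (intro Bd_intros)
  have "zero = a \<or> less zero a"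
    by (rule bounded_induct[of "\<lambda>a. zero = a \<or> less zero a"])
      (intro Bd_intros, auto simp: less_plus_one)
  then show "less a zero \<or> a = zero \<or> less zero a" by blast
  fix n assume IH: "less a n \<or> a = n \<or> less n a"
  have "a = plus n one \<or> less (plus n one) a" if "a = plus (plus n c) one" for c
  proof -
    have "c = zero \<or> less zero c"
      by (rule bounded_induct[of "\<lambda>c. c = zero \<or> less zero c"])
        (intro Bd_intros, auto simp: less_plus_one)
    then show ?thesis
      using that less_iff by (metis plus_assoc plus_comm plus_zero)
  qed
  then show "less a (plus n one) \<or> a = plus n one \<or> less (plus n one) a"
    using IH less_plus_one less_iff by blast
qed

sublocale discrete_semiring zero one plus times less
  by standard (rule plus_assoc plus_comm zero_plus times_assoc times_comm one_times zero_times
      distrib plus_one_neq_zero less_iff linear | erule plus_cancel)+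

end

section \<open>The numbers of a countermodel as an ordered semiring\<close>

text \<open>A type class gives the possibly nonstandard numbers the simplifier's reasoning for
  semirings and orders; \<open>canonically_ordered_monoid_add\<close> identifies the order with the
  existence of a difference.\<close>

class peano = discrete_linordered_semidom + canonically_ordered_monoid_add

datatype number = Number nat

instance number :: countable by countable_datatype

lemma infinite_number: "infinite (UNIV :: number set)"
  using finite_imageD[of Number UNIV] finite_subset[of "range Number" UNIV] by (auto simp: inj_def)

definition countermodel ::
  "number \<Rightarrow> number \<Rightarrow> (number \<Rightarrow> number \<Rightarrow> number) \<Rightarrow> (number \<Rightarrow> number \<Rightarrow> number) \<Rightarrow>
   (number \<Rightarrow> number \<Rightarrow> bool) \<Rightarrow> bool" where
  "countermodel z e p t l \<longleftrightarrow> (\<exists>(mem :: number \<Rightarrow> nat \<Rightarrow> bool) v w.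
     \<forall>q\<in>RCA0 \<union> {EM, Neg DNR_jump}. number_structure.sat z e p t l mem v w q)"

text \<open>Type classes cannot be instantiated inside a proof, hence the operations of \<open>number\<close> are
  those of an arbitrary countermodel of the theorem, if there is one. The theorem will follow since
  there is none.\<close>

definition number_ops where
  "number_ops = (SOME (z, e, p, t, l).
     discrete_semiring z e p t l \<and>
     ((\<exists>z e p t l. countermodel z e p t l) \<longrightarrow> countermodel z e p t l))"

lemma countermodel_discrete_semiring:
  assumes "countermodel z e p t l"
  shows "discrete_semiring z e p t l"
proof -
  obtain mem :: "number \<Rightarrow> nat \<Rightarrow> bool" and v w where
    *: "\<And>q. q \<in> RCA0 \<Longrightarrow> number_structure.sat z e p t l mem v w q"
    using assms unfolding countermodel_def by blast
  interpret rca0_model z e p t l mem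
    by (rule number_structure.sat_RCA0_imp_model[OF * surj_from_nat surj_id])
  show ?thesis ..
qed

lemma number_ops:
  "case number_ops of (z, e, p, t, l) \<Rightarrow> discrete_semiring z e p t l \<and>
     ((\<exists>z e p t l. countermodel z e p t l) \<longrightarrow> countermodel z e p t l)"
  unfolding number_ops_def
proof (rule someI_ex)
  show "\<exists>ops. case ops of (z, e, p, t, l) \<Rightarrow> discrete_semiring z e p t l \<and>
     ((\<exists>z e p t l. countermodel z e p t l) \<longrightarrow> countermodel z e p t l)"
  proof (cases "\<exists>z e p t l. countermodel z e p t l")
    case True
    then show ?thesis using countermodel_discrete_semiring by fast
  next
    case False
    \<comment> \<open>With no countermodel to copy, standard arithmetic serves as default.\<close>
    let ?n = "case_number id"
    have "discrete_semiring (Number 0) (Number 1) (\<lambda>a b. Number (?n a + ?n b))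
        (\<lambda>a b. Number (?n a * ?n b)) (\<lambda>a b. ?n a < ?n b)"
    proof
      fix a b :: number
      show "?n a < ?n b \<longleftrightarrow> (\<exists>c. b = Number (?n (Number (?n a + ?n c)) + ?n (Number 1)))"
        by (cases b) (auto intro!: exI[of _ "Number (?n b - Suc (?n a))"])
    qed (auto simp: algebra_simps split: number.splits)
    with False show ?thesis by blast
  qed
qed

instantiation number :: peano
begin

definition "(0 :: number) = (case number_ops of (z, e, p, t, l) \<Rightarrow> z)"
definition "(1 :: number) = (case number_ops of (z, e, p, t, l) \<Rightarrow> e)"
definition "(a :: number) + b = (case number_ops of (z, e, p, t, l) \<Rightarrow> p a b)"
definition "(a :: number) * b = (case number_ops of (z, e, p, t, l) \<Rightarrow> t a b)"
definition "(a :: number) < b = (case number_ops of (z, e, p, t, l) \<Rightarrow> l a b)"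
definition "(a :: number) \<le> b \<longleftrightarrow> a < b \<or> a = b"
definition "(a :: number) - b = (if b \<le> a then THE c. a = b + c else 0)"

lemma number_class_ops:
  "discrete_semiring (0 :: number) 1 (+) (*) (<)"
  "countermodel z' e' p' t' l' \<Longrightarrow> countermodel (0 :: number) 1 (+) (*) (<)"
proof -
  obtain z e p t l where *: "number_ops = (z, e, p, t, l)"
    by (rule prod_cases5)
  have eqs: "(0 :: number) = z" "(1 :: number) = e" "((+) :: number \<Rightarrow> _) = p"
    "((*) :: number \<Rightarrow> _) = t" "((<) :: number \<Rightarrow> _) = l"
    unfolding zero_number_def one_number_def plus_number_def times_number_def less_number_def fun_eq_iff *
    by simp_all
  show "discrete_semiring (0 :: number) 1 (+) (*) (<)"
    "countermodel z' e' p' t' l' \<Longrightarrow> countermodel (0 :: number) 1 (+) (*) (<)"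
    using number_ops unfolding * eqs by auto
qed

instance
proof
  interpret discrete_semiring "0 :: number" 1 "(+)" "(*)" "(<)" by (rule number_class_ops)
  have plus_zero: "a + 0 = a" for a :: number
    using zero_plus plus_comm by metis
  have cancel_left: "c + a = c + b \<longleftrightarrow> a = b" for a b c :: number
    using plus_cancel plus_comm by metis
  have succ: "a = 0 \<or> (\<exists>c. a = c + 1)" for a :: number
    using linear[of 0 a] less_iff zero_plus plus_one_not_zero by metis
  have le_iff: "a \<le> b \<longleftrightarrow> (\<exists>c. b = a + c)" for a b :: number
  proof
    show "a \<le> b \<Longrightarrow> \<exists>c. b = a + c"
      unfolding less_eq_number_def less_iff by (metis plus_assoc plus_zero)
    assume "\<exists>c. b = a + c"
    then obtain c where "b = a + c" ..
    then show "a \<le> b"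
      unfolding less_eq_number_def less_iff using succ[of c] by (metis plus_assoc plus_zero)
  qed
  have irrefl: "\<not> a < a" for a :: number
    unfolding less_iff by (metis plus_assoc plus_zero cancel_left plus_one_not_zero)
  have diff: "(a + b) - a = b" for a b :: number
    unfolding minus_number_def using le_iff cancel_left by auto
  have asym: "a < b \<Longrightarrow> \<not> b < a" for a b :: number
    unfolding less_iff by (metis plus_assoc plus_zero cancel_left plus_one_not_zero)
  have le_antisym: "a \<le> b \<Longrightarrow> b \<le> a \<Longrightarrow> a = b" for a b :: number
    unfolding less_eq_number_def using asym by blast
  have le_linear: "a \<le> b \<or> b \<le> a" for a b :: number
    unfolding less_eq_number_def using linear by blast
  have distrib_left: "a * (b + c) = a * b + a * c" for a b c :: number
    using distrib times_comm by metis
  have times_zero: "a * 0 = 0" for a :: number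
    using zero_times times_comm by metis
  have mono: "c * a < c * b" if "a < b" "0 < c" for a b c :: number
  proof -
    obtain k where k: "b = a + k + 1" using \<open>a < b\<close> less_iff by blast
    obtain d where d: "c = d + 1" using \<open>0 < c\<close> less_iff zero_plus by auto
    have "c * b = c * a + (c * k + d) + 1"
      by (simp add: k distrib_left plus_assoc) (simp add: d distrib one_times times_comm[of d 1])
    then show ?thesis using less_iff by blast
  qed
  have diff_zero: "a - b = 0" if "\<not> b \<le> a" for a b :: number
    using that by (simp add: minus_number_def)
  have zero_less: "a \<noteq> 0 \<Longrightarrow> 0 < a" for a :: number
    using succ less_iff zero_plus by metis
  fix a b c :: number
  show "a + b + c = a + (b + c)" by (rule plus_assoc)
  show "a + b = b + a" by (rule plus_comm)
  show "0 + a = a" by (rule zero_plus)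
  show "a < b \<longleftrightarrow> a \<le> b \<and> \<not> b \<le> a"
    unfolding less_eq_number_def using irrefl asym by metis
  show "a \<le> a" by (simp add: less_eq_number_def)
  show "a \<le> b \<Longrightarrow> b \<le> c \<Longrightarrow> a \<le> c" unfolding le_iff using plus_assoc by metis
  show "a \<le> b \<Longrightarrow> b \<le> a \<Longrightarrow> a = b" by (rule le_antisym)
  show "a \<le> b \<longleftrightarrow> (\<exists>c. b = a + c)" by (rule le_iff)
  show "a + b - a = b" by (rule diff)
  show "a - b - c = a - (b + c)"
  proof (cases "b \<le> a")
    case True
    then obtain k where k: "a = b + k" using le_iff by blast
    have "a - b = k" using k diff by simp
    show ?thesis
    proof (cases "c \<le> k")
      case True
      then obtain j where j: "k = c + j" using le_iff by blast
      have "a - (b + c) = j" using k j diff[of "b + c" j] by (simp add: plus_assoc)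
      then show ?thesis using \<open>a - b = k\<close> j diff by simp
    next
      case False
      then have "\<not> b + c \<le> a" unfolding k le_iff plus_assoc cancel_left .
      then show ?thesis using \<open>a - b = k\<close> False diff_zero by simp
    qed
  next
    case False
    then have "\<not> b + c \<le> a" unfolding le_iff using plus_assoc by metis
    moreover have "0 - c = 0"
      using diff_zero diff[of 0 0] zero_plus[of 0] le_antisym le_iff[of 0 c] zero_plus by metis
    ultimately show ?thesis using False diff_zero by simp
  qed
  show "a \<le> b \<Longrightarrow> c + a \<le> c + b" unfolding le_iff using plus_assoc by metis
  show "a \<le> b \<or> b \<le> a" by (rule le_linear)
  show "a * b * c = a * (b * c)" by (rule times_assoc)
  show "a * b = b * a" by (rule times_comm)
  show "(a + b) * c = a * c + b * c" by (rule distrib)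
  show "0 * a = 0" by (rule zero_times)
  show "a * 0 = 0" by (rule times_zero)
  show "a < b \<Longrightarrow> 0 < c \<Longrightarrow> c * a < c * b" by (rule mono)
  show "1 * a = a" by (rule one_times)
  show "(0 :: number) \<noteq> 1" using plus_one_not_zero[of 0] zero_plus by metis
  show "a * (b - c) = a * b - a * c"
  proof (cases "c \<le> b")
    case True
    then obtain k where "b = c + k" using le_iff by blast
    then show ?thesis using diff distrib_left by simp
  next
    case False
    show ?thesis
    proof (cases "a = 0")
      case True
      then show ?thesis using diff[of 0 0] zero_plus zero_times by simp
    next
      case a: False
      have "b < c" using False linear unfolding less_eq_number_def by blast
      then have "a * b < a * c" using a mono zero_less by blast
      then have "\<not> a * c \<le> a * b" unfolding less_eq_number_def using irrefl asym by metis
      then show ?thesis using False diff_zero times_zero by simp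
    qed
  qed
  show "a * (b + c) = a * b + a * c" by (rule distrib_left)
  show "a \<noteq> 0 \<Longrightarrow> b \<noteq> 0 \<Longrightarrow> a * b \<noteq> 0"
    using mono[of 0 b a] zero_less[of a] zero_less[of b] times_zero irrefl by metis
  show "(0 :: number) < 1" using less_iff zero_plus by metis
  show "b \<le> a \<Longrightarrow> a - b + b = a" using le_iff diff plus_comm by metis
  show "a < b \<longleftrightarrow> a + 1 \<le> b" unfolding less_iff le_iff using plus_assoc plus_comm by metis
qed

end

section \<open>Coding in a model\<close>

locale peano_model = rca0_model 0 1 "(+)" "(*)" "(<)" mem for mem :: "'p :: peano \<Rightarrow> 'b \<Rightarrow> bool"

lemma less_plus_one_iff: "(a :: 'p :: peano) < b + 1 \<longleftrightarrow> a \<le> b"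
  by (simp add: less_eq_iff_succ_less)

lemma plus_one_le_iff: "(a :: 'p :: peano) + 1 \<le> b \<longleftrightarrow> a < b"
  by (simp add: less_iff_succ_less_eq)

lemma less_iff_ex_plus_one: "(a :: 'p :: peano) < b \<longleftrightarrow> (\<exists>c. b = a + c + 1)"
  unfolding less_iff_succ_less_eq le_iff_add by (simp add: ac_simps)

lemma one_le: "(a :: 'p :: peano) \<noteq> 0 \<Longrightarrow> 1 \<le> a"
  using less_iff_succ_less_eq[of 0 a] by (simp add: zero_less_iff_neq_zero)

lemma le_square: "(a :: 'p :: peano) \<le> a * a"
  using mult_mono[of 1 a a a] one_le[of a] by (cases "a = 0") auto

section \<open>The quadratic pairing function\<close>

definition pair :: "'p :: peano \<Rightarrow> 'p \<Rightarrow> 'p" where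
  "pair x y = (x + y) * (x + y) + x"

text \<open>With \<open>s = x + y\<close>, the code lies between s^2 and s^2 + s, hence below (s +
  1)^2, so codes with different sums occupy separate intervals.\<close>

lemma pair_less:
  assumes "(x :: 'p :: peano) + y < x' + y'"
  shows "pair x y < pair x' y'"
proof -
  let ?s = "x + y"
  have "pair x y \<le> ?s * ?s + ?s" unfolding pair_def by (intro add_left_mono) simp
  also have "\<dots> < (?s * ?s + ?s + ?s) + 1" unfolding less_plus_one_iff by simp
  also have "\<dots> = (?s + 1) * (?s + 1)" by (simp add: algebra_simps)
  also have "\<dots> \<le> (x' + y') * (x' + y')"
    using assms by (intro mult_mono) (simp_all add: plus_one_le_iff)
  also have "\<dots> \<le> pair x' y'" by (simp add: pair_def)
  finally show ?thesis .
qed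

lemma pair_eq_iff [simp]: "pair (x :: 'p :: peano) y = pair x' y' \<longleftrightarrow> x = x' \<and> y = y'"
proof
  assume eq: "pair x y = pair x' y'"
  then have s: "x + y = x' + y'"
    using pair_less[of x y x' y'] pair_less[of x' y' x y] by (metis linorder_neqE less_irrefl)
  then have "x = x'" using eq by (simp add: pair_def)
  then show "x = x' \<and> y = y'" using s by simp
qed simp

lemma fst_le_pair: "x \<le> pair x y"
  by (simp add: pair_def)

lemma snd_le_pair: "(y :: 'p :: peano) \<le> pair x y"
proof -
  have "y \<le> x + y" by simp
  also have "\<dots> \<le> (x + y) * (x + y)" by (rule le_square)
  also have "\<dots> \<le> pair x y" by (simp add: pair_def)
  finally show ?thesis .
qed

lemma pair_mono: "x \<le> x' \<Longrightarrow> y \<le> y' \<Longrightarrow> pair (x :: 'p :: peano) y \<le> pair x' y'"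
  unfolding pair_def by (intro add_mono mult_mono) simp_all

text \<open>The moduli \<open>1 + (x + 1) * b\<close> with \<open>x < n\<close> are coprime in pairs if all positive numbers up to
  \<open>n\<close> divide \<open>b\<close>: modulo the first, \<open>b * (x + 1)\<close> is \<open>-1\<close>, and a combination of both is \<open>y - x\<close>, which
  divides \<open>b\<close>.\<close>

lemma dvd_modulus_cancel:
  fixes a b x y :: "'p :: peano"
  assumes b: "\<And>i. i < n \<Longrightarrow> (i + 1) dvd b" and "x < n" "y < n" "x \<noteq> y"
    and dvd: "(1 + (x + 1) * b) dvd a * (1 + (y + 1) * b)"
  shows "(1 + (x + 1) * b) dvd a"
proof -
  let ?m = "1 + (x + 1) * b"
  have "\<exists>j. j < n \<and> ?m dvd a * (j + 1)"
  proof (cases "x < y")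
    case True
    then obtain j where y: "y = x + j + 1" using less_iff_ex_plus_one by blast
    then have "j < n" using \<open>y < n\<close> by (metis add.assoc add.commute le_less_trans le_add_same_cancel2 zero_le)
    have "a * (y + 1) * ?m = (x + 1) * (a * (1 + (y + 1) * b)) + a * (j + 1)"
      by (simp add: y algebra_simps)
    moreover have "?m dvd a * (y + 1) * ?m" "?m dvd (x + 1) * (a * (1 + (y + 1) * b))"
      using dvd by (simp_all only: dvd_triv_right dvd_mult)
    ultimately have "?m dvd a * (j + 1)" using dvd_add_right_iff by metis
    with \<open>j < n\<close> show ?thesis by blast
  next
    case False
    then have "y < x" using \<open>x \<noteq> y\<close> by simp
    then obtain j where x: "x = y + j + 1" using less_iff_ex_plus_one by blast
    then have "j < n" using \<open>x < n\<close> by (metis add.assoc add.commute le_less_trans le_add_same_cancel2 zero_le)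
    have "(x + 1) * (a * (1 + (y + 1) * b)) = a * (y + 1) * ?m + a * (j + 1)"
      by (simp add: x algebra_simps)
    moreover have "?m dvd a * (y + 1) * ?m" "?m dvd (x + 1) * (a * (1 + (y + 1) * b))"
      using dvd by (simp_all only: dvd_triv_right dvd_mult)
    ultimately have "?m dvd a * (j + 1)" using dvd_add_right_iff by metis
    with \<open>j < n\<close> show ?thesis by blast
  qed
  then obtain j where j: "j < n" "?m dvd a * (j + 1)" by blast
  then obtain q where "b = (j + 1) * q" using b by (meson dvdE)
  then have "a * (b * (x + 1)) = a * (j + 1) * (q * (x + 1))" by (simp add: ac_simps)
  then have "?m dvd a * (b * (x + 1))" using j(2) by (metis dvd_mult2)
  moreover have "a * ?m = a + a * (b * (x + 1))" by (simp add: algebra_simps)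
  ultimately show ?thesis using dvd_add_left_iff dvd_triv_right by metis
qed

context peano_model
begin

section \<open>Bounded predicates on codes\<close>

lemma Bd_subst3:
  "Bd (\<lambda>v. P (v 0) (v 1) (v 2)) \<Longrightarrow> Tm T0 \<Longrightarrow> Tm T1 \<Longrightarrow> Tm T2 \<Longrightarrow>
   Bd (\<lambda>v. P (T0 v) (T1 v) (T2 v))"
  using Bd_subst[of "\<lambda>v. P (v 0) (v 1) (v 2)" "case_nat T0 (case_nat T1 (\<lambda>i. T2))"]
  by (simp add: numeral_2_eq_2 split: nat.split)

lemma Bd_subst4:
  "Bd (\<lambda>v. P (v 0) (v 1) (v 2) (v 3)) \<Longrightarrow> Tm T0 \<Longrightarrow> Tm T1 \<Longrightarrow> Tm T2 \<Longrightarrow> Tm T3 \<Longrightarrow>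
   Bd (\<lambda>v. P (T0 v) (T1 v) (T2 v) (T3 v))"
  using Bd_subst[of "\<lambda>v. P (v 0) (v 1) (v 2) (v 3)"
      "case_nat T0 (case_nat T1 (case_nat T2 (\<lambda>i. T3)))"]
  by (simp add: numeral_2_eq_2 numeral_3_eq_3 split: nat.split)

lemma Bd_subst5:
  "Bd (\<lambda>v. P (v 0) (v 1) (v 2) (v 3) (v 4)) \<Longrightarrow>
   Tm T0 \<Longrightarrow> Tm T1 \<Longrightarrow> Tm T2 \<Longrightarrow> Tm T3 \<Longrightarrow> Tm T4 \<Longrightarrow>
   Bd (\<lambda>v. P (T0 v) (T1 v) (T2 v) (T3 v) (T4 v))"
  using Bd_subst[of "\<lambda>v. P (v 0) (v 1) (v 2) (v 3) (v 4)"
      "case_nat T0 (case_nat T1 (case_nat T2 (case_nat T3 (\<lambda>i. T4))))"]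
  by (simp add: numeral_eq_Suc split: nat.split)

lemma Bd_le: "Tm T \<Longrightarrow> Tm U \<Longrightarrow> Bd (\<lambda>v. T v \<le> U v)"
  unfolding less_plus_one_iff[symmetric] by (intro Bd_intros)

lemma Bd_ball_le:
  assumes "Tm T" "Bd (\<lambda>v. R (v 0) (\<lambda>i. v (Suc i)))"
  shows "Bd (\<lambda>v. \<forall>x. x \<le> T v \<longrightarrow> R x v)"
  unfolding less_plus_one_iff[symmetric] by (intro Bd_intros assms)

lemma Bd_bex_le:
  assumes "Tm T" "Bd (\<lambda>v. R (v 0) (\<lambda>i. v (Suc i)))"
  shows "Bd (\<lambda>v. \<exists>x. x \<le> T v \<and> R x v)"
  unfolding less_plus_one_iff[symmetric] by (intro Bd_intros assms)

lemma Tm_pair: "Tm T \<Longrightarrow> Tm U \<Longrightarrow> Tm (\<lambda>v. pair (T v) (U v))"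
  unfolding pair_def by (intro Bd_intros)

text \<open>For a nonzero divisor the quotient is at most \<open>a\<close>, and for divisor 0 the
  quotient 0 serves. This makes divisibility a bounded predicate.\<close>

lemma dvd_iff_bounded: "x dvd (a :: 'p) \<longleftrightarrow> (\<exists>q\<le>a. a = x * q)"
proof (cases "x = 0")
  case False
  show ?thesis
  proof
    assume "x dvd a"
    then obtain q where "a = x * q" by (rule dvdE)
    moreover have "1 * q \<le> x * q" using False by (intro mult_right_mono one_le) simp_all
    ultimately show "\<exists>q\<le>a. a = x * q" by auto
  qed auto
qed auto

lemma Bd_dvd: "Tm T \<Longrightarrow> Tm U \<Longrightarrow> Bd (\<lambda>v. T v dvd U v)"
  by (rule Bd_subst2[of "(dvd)"]) (unfold dvd_iff_bounded, intro Bd_intros Bd_bex_le)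

lemmas Bd_peano = Bd_intros Bd_le Bd_ball_le Bd_bex_le Tm_pair

section \<open>Least elements, course-of-values induction and collection\<close>

lemma bounded_least:
  assumes "Bd (\<lambda>v. P (v 0))" "P n"
  shows "\<exists>m\<le>n. P m \<and> (\<forall>k<m. \<not> P k)"
proof (rule ccontr)
  assume no: "\<not> ?thesis"
  have "\<forall>k<m. k \<le> n \<longrightarrow> \<not> P k" for m
  proof (rule bounded_induct[of "\<lambda>m. \<forall>k<m. k \<le> n \<longrightarrow> \<not> P k"])
    show "Bd (\<lambda>v. \<forall>k<v 0. k \<le> n \<longrightarrow> \<not> P k)" by (intro Bd_peano assms(1))
  next
    fix m assume "\<forall>k<m. k \<le> n \<longrightarrow> \<not> P k"
    then show "\<forall>k<m + 1. k \<le> n \<longrightarrow> \<not> P k"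
      using no unfolding less_plus_one_iff by (metis le_less less_le_trans less_imp_le)
  qed (simp add: not_less)
  from this[of "n + 1"] show False using assms(2) by (simp add: less_plus_one_iff)
qed

lemma bounded_less_induct:
  assumes "Bd (\<lambda>v. P (v 0))" "\<And>n. (\<And>k. k < n \<Longrightarrow> P k) \<Longrightarrow> P n"
  shows "P n"
  using bounded_least[of "\<lambda>n. \<not> P n" n] Bd_not[OF assms(1)] assms(2) by blast

text \<open>Sigma^0_1 induction on the number \<open>k\<close> of arguments already covered, with
  the common bound \<open>s\<close> as witness. The guard \<open>k \<le> n\<close> confines the
  claim to arguments for which a value is assumed.\<close>

lemma bounded_collection:
  assumes "Bd (\<lambda>v. P (v 0) (v 1))" "\<And>x. x < n \<Longrightarrow> \<exists>z. P z x"
  shows "\<exists>s. \<forall>x<n. \<exists>z<s. P z x"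
proof -
  have "\<exists>s. k \<le> n \<longrightarrow> (\<forall>x<k. \<exists>z<s. P z x)" for k
  proof (rule sigma1_induct[of "\<lambda>s k. k \<le> n \<longrightarrow> (\<forall>x<k. \<exists>z<s. P z x)"])
    show "Bd (\<lambda>v. v 1 \<le> n \<longrightarrow> (\<forall>x<v 1. \<exists>z<v 0. P z x))"
      by (intro Bd_peano Bd_subst2[OF assms(1)])
  next
    fix k assume "\<exists>s. k \<le> n \<longrightarrow> (\<forall>x<k. \<exists>z<s. P z x)"
    then obtain s where s: "k \<le> n \<longrightarrow> (\<forall>x<k. \<exists>z<s. P z x)" ..
    show "\<exists>s. k + 1 \<le> n \<longrightarrow> (\<forall>x<k + 1. \<exists>z<s. P z x)"
    proof (cases "k < n")
      case True
      then obtain z where z: "P z k" using assms(2) by blast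
      show ?thesis
      proof (rule exI[of _ "max s (z + 1)"], intro impI allI)
        fix x assume "k + 1 \<le> n" "x < k + 1"
        then consider "x < k" | "x = k" unfolding less_plus_one_iff by (auto simp: le_less)
        then show "\<exists>y<max s (z + 1). P y x"
          using s z True by cases (auto simp: less_max_iff_disj less_imp_le less_plus_one_iff)
      qed
    qed (simp add: plus_one_le_iff)
  qed (simp add: not_less)
  then show ?thesis by blast
qed

subsection \<open>Finite sets\<close>

text \<open>The number \<open>\<langle>n, \<langle>a, b\<rangle>\<rangle>\<close> codes the set of those \<open>x < n\<close> for which \<open>1 + (x + 1) * b\<close> divides
  \<open>a\<close>.\<close>

definition In :: "'p \<Rightarrow> 'p \<Rightarrow> bool" where
  "In x d \<longleftrightarrow> (\<exists>n\<le>d. \<exists>a\<le>d. \<exists>b\<le>d. d = pair n (pair a b) \<and> x < n \<and> 1 + (x + 1) * b dvd a)"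

lemma Bd_In: "Tm T \<Longrightarrow> Tm U \<Longrightarrow> Bd (\<lambda>v. In (T v) (U v))"
  by (rule Bd_subst2[of In]) (unfold In_def, intro Bd_peano Bd_dvd)

lemma In_pair: "In x (pair n (pair a b)) \<longleftrightarrow> x < n \<and> 1 + (x + 1) * b dvd a"
  unfolding In_def pair_eq_iff
  using fst_le_pair snd_le_pair order_trans by (smt (verit, best))

lemma In_less: "In x d \<Longrightarrow> x < d"
  unfolding In_def by auto

text \<open>Stands in for a factorial: asking only for divisibility makes the claim Sigma^0_1
  without coding a product, and positivity excludes the multiple 0.\<close>

lemma common_multiple: "\<exists>b>0. \<forall>i<n. (i + 1) dvd (b :: 'p)"
proof (rule sigma1_induct[of "\<lambda>b n. 0 < b \<and> (\<forall>i<n. (i + 1) dvd b)"])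
  show "Bd (\<lambda>v. 0 < v 0 \<and> (\<forall>i<v 1. (i + 1) dvd v 0))" by (intro Bd_peano Bd_dvd)
  show "\<exists>b::'p. 0 < b \<and> (\<forall>i<0. (i + 1) dvd b)" by (intro exI[of _ 1]) (simp add: not_less)
  fix n assume "\<exists>b::'p. 0 < b \<and> (\<forall>i<n. (i + 1) dvd b)"
  then obtain b :: 'p where "0 < b" "\<forall>i<n. (i + 1) dvd b" by blast
  then show "\<exists>b::'p. 0 < b \<and> (\<forall>i<n + 1. (i + 1) dvd b)"
    by (intro exI[of _ "b * (n + 1)"])
      (auto simp: less_plus_one_iff le_less zero_less_iff_neq_zero intro: dvd_mult2)
qed

lemma finite_comprehension:
  assumes P: "Bd (\<lambda>v. P (v 0))"
  shows "\<exists>d. \<forall>x. In x d \<longleftrightarrow> x < n \<and> P x"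
proof -
  obtain b :: 'p where b: "0 < b" "\<And>i. i < n \<Longrightarrow> (i + 1) dvd b" using common_multiple by blast
  \<comment> \<open>The intended \<open>a\<close> is the product of the moduli of the members below
    \<open>k\<close>.\<close>
  have "\<exists>a. k \<le> n \<longrightarrow> (\<forall>x<n. 1 + (x + 1) * b dvd a \<longleftrightarrow> x < k \<and> P x)" for k
  proof (rule sigma1_induct[of "\<lambda>a k. k \<le> n \<longrightarrow> (\<forall>x<n. 1 + (x + 1) * b dvd a \<longleftrightarrow> x < k \<and> P x)"])
    show "Bd (\<lambda>v. v 1 \<le> n \<longrightarrow> (\<forall>x<n. 1 + (x + 1) * b dvd v 0 \<longleftrightarrow> x < v 1 \<and> P x))"
      by (intro Bd_peano Bd_dvd Bd_subst1[OF P])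
  next
    \<comment> \<open>The empty product 1 codes the empty set, as \<open>b > 0\<close> makes every
      modulus exceed 1.\<close>
    have "\<not> 1 + (x + 1) * b dvd 1" for x
    proof
      assume "1 + (x + 1) * b dvd 1"
      then obtain q where q: "1 = (1 + (x + 1) * b) * q" by (rule dvdE)
      then have "(1 + (x + 1) * b) * 1 \<le> (1 + (x + 1) * b) * q"
        by (intro mult_left_mono one_le) auto
      then have "(x + 1) * b \<le> 0" using q by simp
      then show False using b(1) by simp
    qed
    then show "\<exists>a. 0 \<le> n \<longrightarrow> (\<forall>x<n. 1 + (x + 1) * b dvd a \<longleftrightarrow> x < 0 \<and> P x)"
      by (intro exI[of _ 1]) (simp add: not_less)
  next
    fix k assume "\<exists>a. k \<le> n \<longrightarrow> (\<forall>x<n. 1 + (x + 1) * b dvd a \<longleftrightarrow> x < k \<and> P x)"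
    then obtain a where a: "k \<le> n \<longrightarrow> (\<forall>x<n. 1 + (x + 1) * b dvd a \<longleftrightarrow> x < k \<and> P x)" ..
    have lt: "x < k + 1 \<longleftrightarrow> x < k \<or> x = k" for x by (simp add: less_plus_one_iff le_less)
    show "\<exists>a. k + 1 \<le> n \<longrightarrow> (\<forall>x<n. 1 + (x + 1) * b dvd a \<longleftrightarrow> x < k + 1 \<and> P x)"
    proof (cases "k < n \<and> P k")
      case True
      have "1 + (x + 1) * b dvd a * (1 + (k + 1) * b) \<longleftrightarrow> x < k + 1 \<and> P x" if "x < n" for x
      proof (cases "x = k")
        case x: False
        \<comment> \<open>The moduli are coprime in pairs, hence the new factor affects only the
          membership of \<open>k\<close>.\<close>
        have "1 + (x + 1) * b dvd a * (1 + (k + 1) * b) \<longleftrightarrow> 1 + (x + 1) * b dvd a"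
          using dvd_modulus_cancel[of n b x k a] b(2) that x True by (blast intro: dvd_mult2)
        then show ?thesis using a x that True by (auto simp: lt less_imp_le)
      qed (use True in \<open>simp add: less_plus_one_iff\<close>)
      then show ?thesis by blast
    next
      case False
      then show ?thesis using a unfolding lt plus_one_le_iff by (metis less_imp_le)
    qed
  qed
  then obtain a where "\<forall>x<n. 1 + (x + 1) * b dvd a \<longleftrightarrow> x < n \<and> P x" by blast
  then show ?thesis by (intro exI[of _ "pair n (pair a b)"]) (auto simp: In_pair)
qed

subsection \<open>The pigeonhole principle\<close>

text \<open>A coded counterexample to the pigeonhole principle: \<open>m + 1\<close> pigeons,
  \<open>m\<close> holes, no hole shared. The relation may be multivalued, which spares the choice
  of a hole.\<close>

definition collapse :: "'p \<Rightarrow> 'p \<Rightarrow> bool" where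
  "collapse r m \<longleftrightarrow> (\<forall>i\<le>m. \<exists>j<m. In (pair i j) r) \<and>
     (\<forall>i\<le>m. \<forall>i'\<le>m. \<forall>j<m. In (pair i j) r \<longrightarrow> In (pair i' j) r \<longrightarrow> i = i')"

lemma relation_comprehension:
  assumes "Bd (\<lambda>v. R (v 0) (v 1))"
  shows "\<exists>r. \<forall>i\<le>m. \<forall>j\<le>m. In (pair i j) r \<longleftrightarrow> R i j"
proof -
  have "Bd (\<lambda>v. \<exists>i\<le>v 0. \<exists>j\<le>v 0. v 0 = pair i j \<and> R i j)"
    by (intro Bd_peano Bd_subst2[OF assms])
  from finite_comprehension[OF this, of "pair m m + 1"] obtain r where
    r: "\<And>x. In x r \<longleftrightarrow> x < pair m m + 1 \<and> (\<exists>i\<le>x. \<exists>j\<le>x. x = pair i j \<and> R i j)" by blast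
  have "In (pair i j) r \<longleftrightarrow> R i j" if "i \<le> m" "j \<le> m" for i j
    unfolding r less_plus_one_iff using pair_mono[OF that] fst_le_pair snd_le_pair by auto
  then show ?thesis by blast
qed

lemma collapse_step:
  assumes "collapse r (m + 1)"
  shows "\<exists>r'. collapse r' m"
proof -
  \<comment> \<open>The pigeon in the last hole \<open>m\<close> moves to the hole of the last
    pigeon \<open>m + 1\<close>; then the last hole and the last pigeon are dropped.\<close>
  let ?R = "\<lambda>i j. j < m \<and> (In (pair i j) r \<or> In (pair i m) r \<and> In (pair (m + 1) j) r)"
  have total: "\<exists>j\<le>m. In (pair i j) r" if "i \<le> m + 1" for i
    using assms that unfolding collapse_def less_plus_one_iff by blast
  have inj: "i = i'" if "In (pair i j) r" "In (pair i' j) r" "i \<le> m + 1" "i' \<le> m + 1" "j \<le> m" for i i' j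
    using assms that unfolding collapse_def less_plus_one_iff by blast
  have "Bd (\<lambda>v. ?R (v 0) (v 1))" by (intro Bd_peano Bd_In)
  from relation_comprehension[of ?R, OF this, of m]
  obtain r' where r': "\<And>i j. i \<le> m \<Longrightarrow> j \<le> m \<Longrightarrow> In (pair i j) r' \<longleftrightarrow> ?R i j" by blast
  have m: "i \<le> m + 1" "i \<noteq> m + 1" if "i \<le> m" for i
    using that less_plus_one_iff[of i m] by auto
  have "collapse r' m"
    unfolding collapse_def
  proof (intro conjI allI impI)
    fix i assume i: "i \<le> m"
    then obtain j where j: "j \<le> m" "In (pair i j) r" using total m by blast
    show "\<exists>j<m. In (pair i j) r'"
    proof (cases "j = m")
      case True
      obtain j' where j': "j' \<le> m" "In (pair (m + 1) j') r" using total[of "m + 1"] by blast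
      have "j' \<noteq> m" using inj[of i m "m + 1"] j j' True m[OF i] by auto
      then have "j' < m" using j' by simp
      then show ?thesis using r'[of i j'] i j j' True by auto
    next
      case False
      then have "j < m" using j by simp
      then show ?thesis using r'[of i j] i j by auto
    qed
  next
    fix i i' j assume *: "i \<le> m" "i' \<le> m" "j < m" "In (pair i j) r'" "In (pair i' j) r'"
    then have "?R i j" "?R i' j" using r' by auto
    then show "i = i'"
      using inj m * by (metis less_imp_le order_refl)
  qed
  then show ?thesis ..
qed

text \<open>A counterexample is coded and then shrunk until no hole is left. Coding is what turns
  this descent into a Sigma^0_1 induction.\<close>

lemma pigeonhole:
  assumes R: "Bd (\<lambda>v. R (v 0) (v 1))" and total: "\<And>i. i \<le> m \<Longrightarrow> \<exists>j<m. R i j"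
  shows "\<exists>i\<le>m. \<exists>i'\<le>m. \<exists>j<m. R i j \<and> R i' j \<and> i \<noteq> i'"
proof (rule ccontr)
  assume no: "\<not> ?thesis"
  obtain r where "\<And>i j. i \<le> m \<Longrightarrow> j \<le> m \<Longrightarrow> In (pair i j) r \<longleftrightarrow> R i j"
    using relation_comprehension[OF R] by blast
  then have r: "collapse r m"
    unfolding collapse_def using total no by (metis less_imp_le)
  \<comment> \<open>Here \<open>k\<close> counts the steps taken and \<open>n\<close> the holes
    left; the equation \<open>n + k = m\<close> turns the descent into an ascending
    induction.\<close>
  have "\<exists>r. \<forall>n\<le>m. n + k = m \<longrightarrow> collapse r n" for k
  proof (rule sigma1_induct[of "\<lambda>r k. \<forall>n\<le>m. n + k = m \<longrightarrow> collapse r n"])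
    show "Bd (\<lambda>v. \<forall>n\<le>m. n + v 1 = m \<longrightarrow> collapse (v 0) n)"
      unfolding collapse_def by (intro Bd_peano Bd_In)
    show "\<exists>r. \<forall>n\<le>m. n + 0 = m \<longrightarrow> collapse r n" using r by auto
    fix k assume "\<exists>r. \<forall>n\<le>m. n + k = m \<longrightarrow> collapse r n"
    then obtain r where r: "\<And>n. n \<le> m \<Longrightarrow> n + k = m \<Longrightarrow> collapse r n" by blast
    show "\<exists>r. \<forall>n\<le>m. n + (k + 1) = m \<longrightarrow> collapse r n"
    proof (cases "\<exists>n. n + (k + 1) = m")
      case True
      then obtain n where n: "n + (k + 1) = m" ..
      then have "(n + 1) + k = m" by (simp add: ac_simps)
      moreover from this have "n + 1 \<le> m" by auto
      ultimately obtain r' where "collapse r' n" using collapse_step r by blast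
      then show ?thesis using n by (metis add_right_cancel)
    qed blast
  qed
  from this[of m] obtain r where "collapse r 0" by auto
  then show False unfolding collapse_def by (auto simp: not_less)
qed

end

section \<open>Evaluation of the formulas\<close>

context number_structure
begin

text \<open>A scoped term is stable if its value does not change when further quantifiers are entered.\<close>

definition stable :: "stm \<Rightarrow> nat \<Rightarrow> (nat \<Rightarrow> 'n) \<Rightarrow> bool" where
  "stable t d v \<longleftrightarrow> (\<forall>n v'. (\<forall>i. v' (n + i) = v i) \<longrightarrow> eval v' (t (n + d)) = eval v (t d))"

lemma stableD: "stable t d v \<Longrightarrow> (\<And>i. v' (n + i) = v i) \<Longrightarrow> eval v' (t (n + d)) = eval v (t d)"
  unfolding stable_def by blast

lemma eval_stable [simp]: "stable t d v \<Longrightarrow> eval (case_nat x v) (t (Suc d)) = eval v (t d)"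
  using stableD[of t d v "case_nat x v" 1] by simp

lemma stable_Suc [simp]: "stable t d v \<Longrightarrow> stable t (Suc d) (case_nat x v)"
proof -
  assume t: "stable t d v"
  have "eval v' (t (n + Suc d)) = eval v (t d)" if v': "\<And>i. v' (n + i) = case_nat x v i" for n v'
    using stableD[OF t, of v' "Suc n"] v'[of "Suc _"] by simp
  then show ?thesis using t unfolding stable_def[of t "Suc d"] by simp
qed

lemma eval_bound [simp]: "eval (case_nat x v) (bound_num d (Suc d)) = x"
  by (simp add: bound_num_def)

lemma stable_bound [simp]: "stable (bound_num d) (Suc d) (case_nat x v)"
  unfolding stable_def by (auto simp: bound_num_def dest: spec[of _ 0])

lemma stable_plus [simp]: "stable t d v \<Longrightarrow> stable u d v \<Longrightarrow> stable (t \<^bold>+ u) d v"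
  by (simp add: stable_def s_plus_def)

lemma stable_times [simp]: "stable t d v \<Longrightarrow> stable u d v \<Longrightarrow> stable (t \<^bold>* u) d v"
  by (simp add: stable_def s_times_def)

lemma stable_zero [simp]: "stable \<^bold>0 d v"
  by (simp add: stable_def s_zero_def)

lemma stable_one [simp]: "stable \<^bold>1 d v"
  by (simp add: stable_def s_one_def)

lemma stable_pair [simp]: "stable t d v \<Longrightarrow> stable u d v \<Longrightarrow> stable \<^bold>\<langle>t, u\<^bold>\<rangle> d v"
  by (simp add: s_pair_def)

lemma eval_s [simp]:
  "eval v ((t \<^bold>+ u) d) = plus (eval v (t d)) (eval v (u d))"
  "eval v ((t \<^bold>* u) d) = times (eval v (t d)) (eval v (u d))"
  "eval v (\<^bold>0 d) = zero"
  "eval v (\<^bold>1 d) = one"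
  by (simp_all add: s_plus_def s_times_def s_zero_def s_one_def)

lemma sat_s [simp]:
  "sat v w ((t \<^bold>= u) d k) \<longleftrightarrow> eval v (t d) = eval v (u d)"
  "sat v w ((t \<^bold>< u) d k) \<longleftrightarrow> less (eval v (t d)) (eval v (u d))"
  "sat v w ((t \<^bold>\<in> X) d k) \<longleftrightarrow> mem (eval v (t d)) (w (X k))"
  "sat v w ((\<^bold>\<not> A) d k) \<longleftrightarrow> \<not> sat v w (A d k)"
  "sat v w ((A \<^bold>\<and> B) d k) \<longleftrightarrow> sat v w (A d k) \<and> sat v w (B d k)"
  "sat v w ((A \<^bold>\<or> B) d k) \<longleftrightarrow> sat v w (A d k) \<or> sat v w (B d k)"
  "sat v w ((A \<^bold>\<longrightarrow> B) d k) \<longleftrightarrow> (sat v w (A d k) \<longrightarrow> sat v w (B d k))"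
  "sat v w (s_all C d k) \<longleftrightarrow> (\<forall>x. sat (case_nat x v) w (C (bound_num d) (Suc d) k))"
  "sat v w (s_ex C d k) \<longleftrightarrow> (\<exists>x. sat (case_nat x v) w (C (bound_num d) (Suc d) k))"
  "sat v w (s_allS S d k) \<longleftrightarrow> (\<forall>X. sat v (case_nat X w) (S (bound_set k) d (Suc k)))"
  "sat v w (s_exS S d k) \<longleftrightarrow> (\<exists>X. sat v (case_nat X w) (S (bound_set k) d (Suc k)))"
  "sat v w (s_ball t C d k) \<longleftrightarrow>
     (\<forall>x. less x (eval v (t d)) \<longrightarrow> sat (case_nat x v) w (C (bound_num d) (Suc d) k))"
  "sat v w (s_bex t C d k) \<longleftrightarrow>
     (\<exists>x. less x (eval v (t d)) \<and> sat (case_nat x v) w (C (bound_num d) (Suc d) k))"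
  by (simp_all add: s_eq_def s_lt_def s_mem_def s_neg_def s_conj_def s_disj_def s_imp_def
      s_all_def s_ex_def s_allS_def s_exS_def s_ball_def s_bex_def)

text \<open>The scoped formula \<open>Q\<close> with one argument expresses the predicate \<open>q\<close>, also when further
  number quantifiers are entered.\<close>

definition expresses :: "(stm \<Rightarrow> sfm) \<Rightarrow> ('n \<Rightarrow> bool) \<Rightarrow> nat \<Rightarrow> (nat \<Rightarrow> 'n) \<Rightarrow> (nat \<Rightarrow> 's) \<Rightarrow> nat \<Rightarrow> bool" where
  "expresses Q q d v w k \<longleftrightarrow> (\<forall>n v' t. (\<forall>i. v' (n + i) = v i) \<longrightarrow> stable t (n + d) v' \<longrightarrow>
     (sat v' w (Q t (n + d) k) \<longleftrightarrow> q (eval v' (t (n + d)))))"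

lemma sat_expresses [simp]:
  "expresses Q q d v w k \<Longrightarrow> stable t d v \<Longrightarrow> sat v w (Q t d k) \<longleftrightarrow> q (eval v (t d))"
  unfolding expresses_def by (metis add_0)

lemma expresses_Suc [simp]:
  "expresses Q q d v w k \<Longrightarrow> expresses Q q (Suc d) (case_nat x v) w k"
proof -
  assume Q: "expresses Q q d v w k"
  show ?thesis
    unfolding expresses_def
  proof (intro allI impI)
    fix n v' t assume v': "\<forall>i. v' (n + i) = case_nat x v i" and t: "stable t (n + Suc d) v'"
    have "\<forall>i. v' (Suc n + i) = v i" using v'[rule_format, of "Suc _"] by simp
    then show "sat v' w (Q t (n + Suc d) k) \<longleftrightarrow> q (eval v' (t (n + Suc d)))"
      using Q[unfolded expresses_def, rule_format, of v' "Suc n" t] t by simp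
  qed
qed

lemma expressesI:
  assumes "\<And>d v t. stable t d v \<Longrightarrow> sat v w (Q t d k) \<longleftrightarrow> q (eval v (t d))"
  shows "expresses Q q d v w k"
  unfolding expresses_def using assms by blast

end

context peano_model
begin

lemma eval_pair [simp]: "eval v (\<^bold>\<langle>t, u\<^bold>\<rangle> d) = pair (eval v (t d)) (eval v (u d))"
  by (simp add: s_pair_def pair_def)

lemma eval_num [simp]: "eval v (s_num n d) = of_nat n"
  unfolding s_num_def by (induction n) (simp_all add: add.commute)

lemma stable_num [simp]: "stable (s_num n) d v"
  by (simp add: stable_def)

lemma lt_plus_one [simp]: "x < y + 1 \<longleftrightarrow> x \<le> (y :: 'p)"
  by (rule less_plus_one_iff)

section \<open>Computations as predicates on the model\<close>

definition entry :: "'p \<Rightarrow> 'p \<Rightarrow> 'p \<Rightarrow> bool" where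
  "entry c i y \<longleftrightarrow> (\<exists>a\<le>c. \<exists>b\<le>c. \<exists>q\<le>a.
     c = pair a b \<and> y < 1 + (i + 1) * b \<and> a = q * (1 + (i + 1) * b) + y)"

definition earlier :: "'p \<Rightarrow> 'p \<Rightarrow> 'p \<Rightarrow> 'p \<Rightarrow> 'p \<Rightarrow> bool" where
  "earlier c i e x y \<longleftrightarrow> (\<exists>j<i. entry c j (pair e (pair x y)))"

text \<open>The argument \<open>q\<close> tells whether \<open>x\<close> belongs to the oracle.\<close>

definition justified :: "bool \<Rightarrow> 'p \<Rightarrow> 'p \<Rightarrow> 'p \<Rightarrow> 'p \<Rightarrow> 'p \<Rightarrow> bool" where
  "justified q c i e x y \<longleftrightarrow>
     (e = pair 0 0 \<and> y = 0) \<or>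
     (e = pair 1 0 \<and> y = x + 1) \<or>
     (e = pair 2 0 \<and> y = x) \<or>
     (e = pair 3 0 \<and> (\<exists>z\<le>c. x = pair y z)) \<or>
     (e = pair 4 0 \<and> (\<exists>z\<le>c. x = pair z y)) \<or>
     (e = pair 5 0 \<and> ((q \<and> y = 1) \<or> (\<not> q \<and> y = 0))) \<or>
     (\<exists>a\<le>c. \<exists>b\<le>c. e = pair 6 (pair a b) \<and> (\<exists>z\<le>c. earlier c i b x z \<and> earlier c i a z y)) \<or>
     (\<exists>a\<le>c. \<exists>b\<le>c. e = pair 7 (pair a b) \<and>
        (\<exists>v\<le>c. \<exists>w\<le>c. earlier c i a x v \<and> earlier c i b x w \<and> y = pair v w)) \<or>
     (\<exists>a\<le>c. \<exists>b\<le>c. e = pair 8 (pair a b) \<and>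
        (\<exists>u\<le>c. (x = pair u 0 \<and> earlier c i a u y) \<or>
           (\<exists>n\<le>c. \<exists>w\<le>c. x = pair u (n + 1) \<and>
              earlier c i e (pair u n) w \<and> earlier c i b (pair (pair u n) w) y))) \<or>
     (\<exists>a\<le>c. e = pair 9 a \<and> earlier c i a (pair x y) 0 \<and>
        (\<forall>z<y. \<exists>w\<le>c. earlier c i a (pair x z) (w + 1)))"

definition computation :: "('p \<Rightarrow> bool) \<Rightarrow> 'p \<Rightarrow> 'p \<Rightarrow> bool" where
  "computation Q c n \<longleftrightarrow> (\<forall>i\<le>n. \<exists>e\<le>c. \<exists>x\<le>c. \<exists>y\<le>c.
     entry c i (pair e (pair x y)) \<and> justified (Q x) c i e x y)"

definition jump :: "'b \<Rightarrow> 'p \<Rightarrow> bool" where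
  "jump X m \<longleftrightarrow> (\<exists>y c n. computation (\<lambda>x. mem x X) c n \<and> entry c n (pair m (pair m y)))"

lemma sat_entry [simp]:
  "stable c d v \<Longrightarrow> stable i d v \<Longrightarrow> stable y d v \<Longrightarrow>
   sat v w (s_entry c i y d k) \<longleftrightarrow> entry (eval v (c d)) (eval v (i d)) (eval v (y d))"
  by (simp add: s_entry_def entry_def)

lemma sat_earlier [simp]:
  "stable c d v \<Longrightarrow> stable i d v \<Longrightarrow> stable e d v \<Longrightarrow> stable x d v \<Longrightarrow> stable y d v \<Longrightarrow>
   sat v w (s_earlier c i e x y d k) \<longleftrightarrow>
     earlier (eval v (c d)) (eval v (i d)) (eval v (e d)) (eval v (x d)) (eval v (y d))"
  by (simp add: s_earlier_def earlier_def)

lemma sat_justified: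
  "stable c d v \<Longrightarrow> stable i d v \<Longrightarrow> stable e d v \<Longrightarrow> stable x d v \<Longrightarrow> stable y d v \<Longrightarrow>
   expresses Q q d v w k \<Longrightarrow>
   sat v w (s_justified Q c i e x y d k) \<longleftrightarrow> justified (q (eval v (x d)))
     (eval v (c d)) (eval v (i d)) (eval v (e d)) (eval v (x d)) (eval v (y d))"
  by (simp add: s_justified_def justified_def del: pair_eq_iff)

lemma sat_computation:
  "stable c d v \<Longrightarrow> stable n d v \<Longrightarrow> expresses Q q d v w k \<Longrightarrow>
   sat v w (s_computation Q c n d k) \<longleftrightarrow> computation q (eval v (c d)) (eval v (n d))"
  by (simp add: s_computation_def computation_def sat_justified[where q = q])

lemma sat_Phi:
  "stable e d v \<Longrightarrow> stable x d v \<Longrightarrow> stable y d v \<Longrightarrow> expresses Q q d v w k \<Longrightarrow>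
   sat v w (s_Phi Q e x y d k) \<longleftrightarrow> (\<exists>c n. computation q c n \<and>
     entry c n (pair (eval v (e d)) (pair (eval v (x d)) (eval v (y d)))))"
  by (simp add: s_Phi_def sat_computation[where q = q])

lemma expresses_mem [simp]: "expresses (\<lambda>m. m \<^bold>\<in> X) (\<lambda>x. mem x (w (X k))) d v w k"
  by (rule expressesI) simp

lemma expresses_jump [simp]: "expresses (s_jump X) (jump (w (X k))) d v w k"
  by (rule expressesI)
    (simp add: s_jump_def jump_def sat_Phi[where q = "\<lambda>x. mem x (w (X k))"])

lemma sat_DNR_jump:
  "sat v w DNR_jump \<longleftrightarrow> (\<forall>X. \<exists>F.
     (\<forall>z. mem z F \<longrightarrow> (\<exists>x y. z = pair x y)) \<and>
     (\<forall>x. \<exists>y. mem (pair x y) F) \<and>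
     (\<forall>x y z. mem (pair x y) F \<and> mem (pair x z) F \<longrightarrow> y = z) \<and>
     (\<forall>e y. (\<exists>c n. computation (jump X) c n \<and> entry c n (pair e (pair e y))) \<longrightarrow>
        \<not> mem (pair e y) F))"
proof -
  have "sat v w (s_Phi (s_jump X) e x y d k) \<longleftrightarrow> (\<exists>c n. computation (jump (w (X k))) c n \<and>
      entry c n (pair (eval v (e d)) (pair (eval v (x d)) (eval v (y d)))))"
    if "stable e d v" "stable x d v" "stable y d v" for v w e x y d k X
    using that by (simp add: sat_Phi[where q = "jump (w (X k))"])
  then show ?thesis
    by (simp add: DNR_jump_def s_dnc_def s_function_def bound_set_def)
qed

definition tournament :: "'b \<Rightarrow> 'b \<Rightarrow> bool" where
  "tournament T D \<longleftrightarrow>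
     (\<forall>z. mem z T \<longrightarrow> (\<exists>x y. mem x D \<and> mem y D \<and> z = pair x y)) \<and>
     (\<forall>x. \<not> mem (pair x x) T) \<and>
     (\<forall>x y. mem x D \<and> mem y D \<and> x \<noteq> y \<longrightarrow> (mem (pair x y) T \<longleftrightarrow> \<not> mem (pair y x) T))"

lemma sat_EM:
  "sat v w EM \<longleftrightarrow> (\<forall>D T. (\<forall>n. \<exists>m>n. mem m D) \<and> tournament T D \<longrightarrow> (\<exists>H.
     (\<forall>x. mem x H \<longrightarrow> mem x D) \<and> (\<forall>n. \<exists>m>n. mem m H) \<and>
     (\<forall>x y z. mem x H \<and> mem y H \<and> mem z H \<and> mem (pair x y) T \<and> mem (pair y z) T \<longrightarrow>
        mem (pair x z) T)))"
proof -
  have "(a \<and> \<not> b \<or> \<not> a \<and> b) \<longleftrightarrow> (a \<longleftrightarrow> \<not> b)" for a b by blast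
  then show ?thesis
    by (simp add: EM_def s_infinite_def s_tournament_def s_subset_def s_transitive_on_def
        bound_set_def tournament_def)
qed

end

section \<open>Computations relative to the jump\<close>

lemma quotient_unique:
  fixes q q' m y y' :: "'a :: peano"
  assumes "q * m + y = q' * m + y'" "y < m" "y' < m"
  shows "y = y'"
proof -
  have "q * m + y < q' * m + y'" if "q < q'" "y < m" for q q' y y'
  proof -
    have "q * m + y < q * m + m" using that(2) by simp
    also have "\<dots> = (q + 1) * m" by (simp add: algebra_simps)
    also have "\<dots> \<le> q' * m" using that(1) by (intro mult_right_mono) (simp_all add: plus_one_le_iff)
    also have "\<dots> \<le> q' * m + y'" by simp
    finally show ?thesis .
  qed
  from this[of q q' y y'] this[of q' q y' y] have "q = q'"
    using assms by (metis less_irrefl linorder_neqE)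
  then show ?thesis using assms(1) by simp
qed

context peano_model
begin

lemma entry_unique: "entry c i y \<Longrightarrow> entry c i y' \<Longrightarrow> y = y'"
  unfolding entry_def by (auto intro: quotient_unique)

lemma entry_le: "entry c i y \<Longrightarrow> y \<le> c"
proof -
  assume "entry c i y"
  then obtain a b q where "c = pair a b" "a = q * (1 + (i + 1) * b) + y"
    unfolding entry_def by blast
  then have "y \<le> a" "a \<le> c" using fst_le_pair by auto
  then show "y \<le> c" by simp
qed

lemma Bd_entry: "Tm T0 \<Longrightarrow> Tm T1 \<Longrightarrow> Tm T2 \<Longrightarrow> Bd (\<lambda>v. entry (T0 v) (T1 v) (T2 v))"
  by (rule Bd_subst3[of entry]) (unfold entry_def, intro Bd_peano)

lemma Bd_earlier:
  "Tm T0 \<Longrightarrow> Tm T1 \<Longrightarrow> Tm T2 \<Longrightarrow> Tm T3 \<Longrightarrow> Tm T4 \<Longrightarrow>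
   Bd (\<lambda>v. earlier (T0 v) (T1 v) (T2 v) (T3 v) (T4 v))"
  by (rule Bd_subst5[of earlier]) (unfold earlier_def, intro Bd_peano Bd_entry)

lemma Bd_justified_const:
  "Tm T0 \<Longrightarrow> Tm T1 \<Longrightarrow> Tm T2 \<Longrightarrow> Tm T3 \<Longrightarrow> Tm T4 \<Longrightarrow>
   Bd (\<lambda>v. justified q (T0 v) (T1 v) (T2 v) (T3 v) (T4 v))"
  by (rule Bd_subst5[of "justified q"]) (unfold justified_def, intro Bd_peano Bd_earlier)

text \<open>The oracle enters \<open>justified\<close> only through a truth value, so a case
  distinction reduces an oracle given by a bounded predicate to the two constant answers.\<close>

lemma Bd_justified:
  assumes "Bd Q" "Tm T0" "Tm T1" "Tm T2" "Tm T3" "Tm T4"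
  shows "Bd (\<lambda>v. justified (Q v) (T0 v) (T1 v) (T2 v) (T3 v) (T4 v))"
proof -
  have "(\<lambda>v. justified (Q v) (T0 v) (T1 v) (T2 v) (T3 v) (T4 v)) =
      (\<lambda>v. Q v \<and> justified True (T0 v) (T1 v) (T2 v) (T3 v) (T4 v) \<or>
        \<not> Q v \<and> justified False (T0 v) (T1 v) (T2 v) (T3 v) (T4 v))"
  proof
    show "justified (Q v) (T0 v) (T1 v) (T2 v) (T3 v) (T4 v) \<longleftrightarrow>
        Q v \<and> justified True (T0 v) (T1 v) (T2 v) (T3 v) (T4 v) \<or>
        \<not> Q v \<and> justified False (T0 v) (T1 v) (T2 v) (T3 v) (T4 v)" for v
      by (cases "Q v") simp_all
  qed
  then show ?thesis
    by (simp only:) (intro Bd_or Bd_and Bd_not Bd_justified_const assms)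
qed

lemma Bd_computation_mem:
  "Tm T0 \<Longrightarrow> Tm T1 \<Longrightarrow> Bd (\<lambda>v. computation (\<lambda>x. mem x X) (T0 v) (T1 v))"
  by (rule Bd_subst2[of "computation (\<lambda>x. mem x X)"])
    (unfold computation_def, intro Bd_peano Bd_entry Bd_justified)

text \<open>A stage of the enumeration of the jump: bounding all witnesses by \<open>s\<close> gives
  a bounded predicate that increases to the jump with \<open>s\<close>.\<close>

definition jump_below :: "'b \<Rightarrow> 'p \<Rightarrow> 'p \<Rightarrow> bool" where
  "jump_below X s m \<longleftrightarrow> (\<exists>y<s. \<exists>c<s. \<exists>n<s. computation (\<lambda>x. mem x X) c n \<and> entry c n (pair m (pair m y)))"

lemma Bd_jump_below: "Tm T0 \<Longrightarrow> Tm T1 \<Longrightarrow> Bd (\<lambda>v. jump_below X (T0 v) (T1 v))"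
  by (rule Bd_subst2[of "jump_below X"])
    (unfold jump_below_def, intro Bd_peano Bd_entry Bd_computation_mem)

lemma Bd_computation_below:
  "Tm T0 \<Longrightarrow> Tm T1 \<Longrightarrow> Tm T2 \<Longrightarrow> Bd (\<lambda>v. computation (jump_below X (T0 v)) (T1 v) (T2 v))"
  by (rule Bd_subst3[of "\<lambda>s. computation (jump_below X s)"])
    (unfold computation_def, intro Bd_peano Bd_entry Bd_justified Bd_jump_below)

lemma jump_below_mono: "jump_below X s m \<Longrightarrow> s \<le> s' \<Longrightarrow> jump_below X s' m"
  unfolding jump_below_def using less_le_trans by blast

lemma jump_iff_below: "jump X m \<longleftrightarrow> (\<exists>s. jump_below X s m)"
proof
  assume "jump X m"
  then obtain y c n where "computation (\<lambda>x. mem x X) c n" "entry c n (pair m (pair m y))"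
    unfolding jump_def by blast
  moreover have "y < y + c + n + 1" "c < y + c + n + 1" "n < y + c + n + 1"
    unfolding less_plus_one_iff by (simp_all add: add.assoc add_increasing)
  ultimately show "\<exists>s. jump_below X s m" unfolding jump_below_def by blast
qed (auto simp: jump_def jump_below_def)

text \<open>An index fits only one scheme, and the scheme determines the value from earlier entries.
  The two entries may stem from different computations, which agree on what comes earlier by
  hypothesis.\<close>

lemma justified_unique:
  assumes j: "justified q c i e x y" "justified q c' j e x y'"
    and earlier: "\<And>e x y y'. earlier c i e x y \<Longrightarrow> earlier c' j e x y' \<Longrightarrow> y = y'"
  shows "y = y'"
proof -
  \<comment> \<open>Different results of a minimization conflict: at the smaller one, one
    computation records the value 0 and the other a successor.\<close>
  have minim: False if "y < y'" "earlier c i a (pair x y) 0"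
    "\<forall>z<y'. \<exists>w\<le>c'. earlier c' j a (pair x z) (w + 1)" for a y y'
    using that earlier by fastforce
  have minim': False if "y < y'" "earlier c' j a (pair x y) 0"
    "\<forall>z<y'. \<exists>w\<le>c. earlier c i a (pair x z) (w + 1)" for a y y'
    using that earlier by fastforce
  show ?thesis
    using j(1)
    unfolding justified_def[of q c i]
  proof (elim disjE exE conjE)
    fix a b z assume e: "e = pair 6 (pair a b)" "earlier c i b x z" "earlier c i a z y"
    then obtain z' where "earlier c' j b x z'" "earlier c' j a z' y'"
      using j(2) unfolding justified_def by auto
    then show ?thesis using e earlier by blast
  next
    fix a b v w assume e: "e = pair 7 (pair a b)" "earlier c i a x v" "earlier c i b x w" "y = pair v w"
    then obtain v' w' where "earlier c' j a x v'" "earlier c' j b x w'" "y' = pair v' w'"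
      using j(2) unfolding justified_def by auto
    then show ?thesis using e earlier by blast
  next
    fix a b u assume e: "e = pair 8 (pair a b)" "x = pair u 0" "earlier c i a u y"
    then have "earlier c' j a u y'"
      using j(2) unfolding justified_def by auto
    then show ?thesis using e earlier by blast
  next
    fix a b u n w assume e: "e = pair 8 (pair a b)" "x = pair u (n + 1)"
      "earlier c i e (pair u n) w" "earlier c i b (pair (pair u n) w) y"
    then obtain w' where "earlier c' j e (pair u n) w'" "earlier c' j b (pair (pair u n) w') y'"
      using j(2) unfolding justified_def by auto
    then show ?thesis using e earlier by blast
  next
    fix a assume e: "e = pair 9 a" "earlier c i a (pair x y) 0"
      "\<forall>z<y. \<exists>w\<le>c. earlier c i a (pair x z) (w + 1)"
    then have "earlier c' j a (pair x y') 0" "\<forall>z<y'. \<exists>w\<le>c'. earlier c' j a (pair x z) (w + 1)"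
      using j(2) unfolding justified_def by auto
    then show ?thesis using e minim minim' by (metis linorder_neqE)
  qed (use j(2) in \<open>auto simp: justified_def\<close>)
qed

lemma computation_justified:
  "computation Q c n \<Longrightarrow> i \<le> n \<Longrightarrow> entry c i (pair e (pair x y)) \<Longrightarrow> justified (Q x) c i e x y"
  unfolding computation_def using entry_unique by (metis pair_eq_iff)

lemma computation_unique:
  assumes c: "computation Q c n" "computation Q c' n'"
    and entry: "entry c n (pair e (pair x y))" "entry c' n' (pair e (pair x y'))"
  shows "y = y'"
proof -
  \<comment> \<open>The predicate speaks of entries but not of the oracle. So it is bounded for
    every \<open>Q\<close>, in particular for the jump, and bounded induction applies.\<close>
  let ?P = "\<lambda>i. i \<le> n \<longrightarrow> (\<forall>j\<le>n'. \<forall>e\<le>c. \<forall>x\<le>c. \<forall>y\<le>c. \<forall>y'\<le>c'.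
    entry c i (pair e (pair x y)) \<longrightarrow> entry c' j (pair e (pair x y')) \<longrightarrow> y = y')"
  have le: "e \<le> c \<and> x \<le> c \<and> y \<le> c" if "entry c i (pair e (pair x y))" for c i e x y
    using entry_le[OF that] fst_le_pair snd_le_pair by (meson order_trans)
  have "?P n"
  proof (rule bounded_less_induct[of ?P])
    show "Bd (\<lambda>v. ?P (v 0))" by (intro Bd_peano Bd_entry)
    fix i assume IH: "\<And>k. k < i \<Longrightarrow> ?P k"
    show "?P i"
    proof (intro impI allI)
      fix j e x y y'
      assume *: "i \<le> n" "j \<le> n'" "entry c i (pair e (pair x y))" "entry c' j (pair e (pair x y'))"
      show "y = y'"
      proof (rule justified_unique)
        show "justified (Q x) c i e x y" "justified (Q x) c' j e x y'"
          using computation_justified c * by blast+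
        fix e x y y' assume "earlier c i e x y" "earlier c' j e x y'"
        then obtain k l where k: "k < i" "entry c k (pair e (pair x y))"
          and l: "l < j" "entry c' l (pair e (pair x y'))"
          unfolding earlier_def by blast
        have "k \<le> n" "l \<le> n'" using k(1) l(1) *(1,2) by auto
        then show "y = y'" using IH[OF k(1)] k(2) l(2) le[OF k(2)] le[OF l(2)] by blast
      qed
    qed
  qed
  then show ?thesis using entry le by blast
qed

text \<open>Only the oracle's answers 1 have to wait for a stage, since \<open>jump_below\<close>
  never exceeds the jump. Bounded collection over the entries makes one stage serve for all of
  them.\<close>

lemma computation_jump_stages:
  assumes "computation (jump X) c n"
  shows "\<exists>t. \<forall>s\<ge>t. computation (jump_below X s) c n"
proof -
  let ?P = "\<lambda>t i. \<forall>x\<le>c. entry c i (pair (pair 5 0) (pair x 1)) \<longrightarrow> jump_below X t x"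
  have "\<exists>t. ?P t i" if "i < n + 1" for i
  proof (cases "\<exists>x. entry c i (pair (pair 5 0) (pair x 1))")
    case True
    then obtain x where x: "entry c i (pair (pair 5 0) (pair x 1))" ..
    then have "justified (jump X x) c i (pair 5 0) x 1"
      using computation_justified[OF assms _ x] that by (simp add: less_plus_one_iff)
    then have "jump X x" unfolding justified_def by simp
    then obtain t where "jump_below X t x" using jump_iff_below by blast
    then show ?thesis using x entry_unique by (metis pair_eq_iff)
  qed blast
  moreover have "Bd (\<lambda>v. ?P (v 0) (v 1))" by (intro Bd_peano Bd_entry Bd_jump_below)
  ultimately obtain t where t: "\<forall>i<n + 1. \<exists>s<t. ?P s i"
    using bounded_collection[of ?P "n + 1"] by blast
  have "computation (jump_below X s) c n" if "t \<le> s" for s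
    unfolding computation_def
  proof (intro allI impI)
    fix i assume "i \<le> n"
    then obtain e x y where *: "e \<le> c" "x \<le> c" "y \<le> c" "entry c i (pair e (pair x y))"
      and j: "justified (jump X x) c i e x y"
      using assms unfolding computation_def by blast
    have "justified (jump_below X s x) c i e x y"
    proof (cases "jump X x \<longleftrightarrow> jump_below X s x")
      case True
      then show ?thesis using j by simp
    next
      case False
      then have x: "jump X x" "\<not> jump_below X s x" using jump_iff_below by blast+
      have "\<not> (e = pair 5 0 \<and> y = 1)"
      proof
        assume "e = pair 5 0 \<and> y = 1"
        moreover obtain s' where "s' < t" "?P s' i" using t \<open>i \<le> n\<close> less_plus_one_iff by blast
        ultimately have "jump_below X s' x" using * by blast
        then show False using x(2) jump_below_mono \<open>s' < t\<close> \<open>t \<le> s\<close> by (meson less_imp_le order_trans)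
      qed
      then show ?thesis using j x unfolding justified_def by blast
    qed
    then show "\<exists>e\<le>c. \<exists>x\<le>c. \<exists>y\<le>c. entry c i (pair e (pair x y)) \<and> justified (jump_below X s x) c i e x y"
      using * by blast
  qed
  then show ?thesis by blast
qed

text \<open>Each entry asks the oracle about a single \<open>x\<close>, so one suitable stage per
  entry is enough and no common one has to be found.\<close>

lemma computation_jump_limit:
  assumes "\<And>s. t \<le> s \<Longrightarrow> computation (jump_below X s) c n"
  shows "computation (jump X) c n"
  unfolding computation_def
proof (intro allI impI)
  fix i assume "i \<le> n"
  then obtain e x y where *: "e \<le> c" "x \<le> c" "y \<le> c" "entry c i (pair e (pair x y))"
    using assms[of t] unfolding computation_def by blast
  obtain s where s: "t \<le> s" "jump X x \<longleftrightarrow> jump_below X s x"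
  proof (cases "jump X x")
    case True
    then obtain s where s: "jump_below X s x" using jump_iff_below by blast
    then have "jump_below X (max s t) x" using jump_below_mono by (meson max.cobounded1)
    then show ?thesis using that[of "max s t"] True by simp
  next
    case False
    then show ?thesis using that[of t] jump_iff_below by blast
  qed
  have "justified (jump X x) c i e x y"
    using computation_justified[OF assms[OF s(1)] \<open>i \<le> n\<close> *(4)] s(2) by simp
  then show "\<exists>e\<le>c. \<exists>x\<le>c. \<exists>y\<le>c. entry c i (pair e (pair x y)) \<and> justified (jump X x) c i e x y"
    using * by blast
qed

subsection \<open>Guessing values of computations\<close>

text \<open>A candidate \<open>t = \<langle>\<langle>c, n\<rangle>, r\<rangle>\<close> consists of a computation and padding, and it counts as long as
  the computation has been correct at all stages from \<open>t\<close> on. The guess at stage \<open>s\<close> is the value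
  of the least candidate. The padding allows a correct computation to start as late as it needs,
  and the false candidates below it die one by one, so that plain bounding suffices to
  get rid of them all.\<close>

definition candidate :: "'b \<Rightarrow> 'p \<Rightarrow> 'p \<Rightarrow> 'p \<Rightarrow> 'p \<Rightarrow> bool" where
  "candidate X e t s d \<longleftrightarrow> (\<exists>c\<le>t. \<exists>n\<le>t. \<exists>r\<le>t. t = pair (pair c n) r \<and> entry c n (pair e (pair e d)) \<and>
     (\<forall>s'\<le>s. t \<le> s' \<longrightarrow> computation (jump_below X s') c n))"

definition guess :: "'b \<Rightarrow> 'p \<Rightarrow> 'p \<Rightarrow> 'p \<Rightarrow> bool" where
  "guess X e s d \<longleftrightarrow> (\<exists>t\<le>s. candidate X e t s d \<and> (\<forall>t'<t. \<forall>d'\<le>t'. \<not> candidate X e t' s d'))"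

lemma Bd_candidate:
  "Tm T0 \<Longrightarrow> Tm T1 \<Longrightarrow> Tm T2 \<Longrightarrow> Tm T3 \<Longrightarrow> Bd (\<lambda>v. candidate X (T0 v) (T1 v) (T2 v) (T3 v))"
  by (rule Bd_subst4[of "candidate X"])
    (unfold candidate_def, intro Bd_peano Bd_entry Bd_computation_below)

lemma Bd_guess: "Tm T0 \<Longrightarrow> Tm T1 \<Longrightarrow> Tm T2 \<Longrightarrow> Bd (\<lambda>v. guess X (T0 v) (T1 v) (T2 v))"
  by (rule Bd_subst3[of "guess X"]) (unfold guess_def, intro Bd_peano Bd_candidate)

text \<open>Justifies the bound \<open>d' \<le> t'\<close> in \<open>guess\<close>, which is thus a
  bounded predicate without missing a candidate.\<close>

lemma candidate_le:
  assumes "candidate X e t s d"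
  shows "d \<le> t"
proof -
  obtain c n where "c \<le> t" "entry c n (pair e (pair e d))"
    using assms unfolding candidate_def by blast
  then show ?thesis
    using entry_le[of c n "pair e (pair e d)"] snd_le_pair[of d e] snd_le_pair[of "pair e d" e] by auto
qed

text \<open>The computation is part of \<open>t\<close>, so the value does not depend on the
  stage.\<close>

lemma candidate_unique:
  assumes "candidate X e t s d" "candidate X e t s' d'"
  shows "d = d'"
proof -
  obtain c n r where "t = pair (pair c n) r" "entry c n (pair e (pair e d))"
    using assms(1) unfolding candidate_def by blast
  moreover obtain c' n' r' where "t = pair (pair c' n') r'" "entry c' n' (pair e (pair e d'))"
    using assms(2) unfolding candidate_def by blast
  ultimately show ?thesis using entry_unique[of c n "pair e (pair e d)" "pair e (pair e d')"] by simp
qed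

lemma candidate_antimono:
  assumes "candidate X e t s d" "s' \<le> s"
  shows "candidate X e t s' d"
proof -
  obtain c n r where *: "c \<le> t" "n \<le> t" "r \<le> t" "t = pair (pair c n) r" "entry c n (pair e (pair e d))"
    "\<forall>s'\<le>s. t \<le> s' \<longrightarrow> computation (jump_below X s') c n"
    using assms(1) unfolding candidate_def by blast
  have "\<forall>s''\<le>s'. t \<le> s'' \<longrightarrow> computation (jump_below X s'') c n"
    using *(6) order_trans[OF _ assms(2)] by blast
  with *(1-5) show ?thesis unfolding candidate_def by blast
qed

lemma guess_unique:
  assumes "guess X e s d" "guess X e s d'"
  shows "d = d'"
proof -
  obtain t where t: "candidate X e t s d" "\<forall>t'<t. \<forall>d'\<le>t'. \<not> candidate X e t' s d'"
    using assms(1) unfolding guess_def by blast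
  obtain t' where t': "candidate X e t' s d'" "\<forall>t''<t'. \<forall>d'\<le>t''. \<not> candidate X e t'' s d'"
    using assms(2) unfolding guess_def by blast
  have "\<not> t < t'" using t'(2)[rule_format, of t d] t(1) candidate_le[OF t(1)] by blast
  moreover have "\<not> t' < t" using t(2)[rule_format, of t' d'] t'(1) candidate_le[OF t'(1)] by blast
  ultimately have "t = t'" using linorder_less_linear[of t t'] by blast
  then show ?thesis using candidate_unique t(1) t'(1) by simp
qed

lemma guess_le:
  assumes "guess X e s d"
  shows "d \<le> s"
proof -
  obtain t where "t \<le> s" "candidate X e t s d" using assms unfolding guess_def by blast
  then show ?thesis using candidate_le[of X e t s d] by simp
qed

lemma candidateE:
  assumes "candidate X e t s d"
  obtains c n r where "t = pair (pair c n) r" "entry c n (pair e (pair e d))"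
    "\<And>s'. s' \<le> s \<Longrightarrow> t \<le> s' \<Longrightarrow> computation (jump_below X s') c n"
proof -
  from assms obtain c n r where "t = pair (pair c n) r" "entry c n (pair e (pair e d))"
    "\<forall>s'\<le>s. t \<le> s' \<longrightarrow> computation (jump_below X s') c n"
    unfolding candidate_def by blast
  then show thesis by (intro that[of c n r]) simp_all
qed

lemma candidate_limit:
  assumes "\<And>s. candidate X e t s d"
  shows "\<exists>c n. computation (jump X) c n \<and> entry c n (pair e (pair e d))"
proof -
  obtain c n r where t: "t = pair (pair c n) r" "entry c n (pair e (pair e d))"
    by (rule candidateE[OF assms])
  have "computation (jump_below X s) c n" if ts: "t \<le> s" for s
  proof -
    obtain c' n' r' where "t = pair (pair c' n') r'" "computation (jump_below X s) c' n'"
      using candidateE[OF assms[of s]] ts order_refl[of s] by metis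
    then show ?thesis using t(1) by simp
  qed
  then have "computation (jump X) c n" by (rule computation_jump_limit)
  then show ?thesis using t(2) by blast
qed

lemma guess_limit:
  assumes c: "computation (jump X) c n" "entry c n (pair e (pair e d))"
  shows "\<exists>s0. \<forall>s\<ge>s0. guess X e s d"
proof -
  obtain r where r: "\<And>s. r \<le> s \<Longrightarrow> computation (jump_below X s) c n"
    using computation_jump_stages[OF c(1)] by blast
  let ?t = "pair (pair c n) r"
  have le: "c \<le> ?t" "n \<le> ?t" "r \<le> ?t"
    using fst_le_pair[of c n] snd_le_pair[of n c] fst_le_pair[of "pair c n" r] snd_le_pair[of r "pair c n"]
    by auto
  have "\<forall>s'\<le>s. ?t \<le> s' \<longrightarrow> computation (jump_below X s') c n" for s
    using r order_trans[OF le(3)] by blast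
  then have cand: "candidate X e ?t s d" for s
    unfolding candidate_def using c(2) le by blast
  let ?P = "\<lambda>s t. \<forall>d'\<le>t. candidate X e t s d' \<longrightarrow> d' = d"
  \<comment> \<open>Some stage refutes a false candidate \<open>t\<close>: one surviving at all
    stages would be a correct computation relative to the jump, with value \<open>d\<close> by
    uniqueness.\<close>
  have "\<exists>s. ?P s t" for t
  proof (rule ccontr)
    assume no: "\<not> ?thesis"
    then obtain d' where d': "candidate X e t 0 d'" "d' \<noteq> d" by blast
    have "candidate X e t s d'" for s
    proof -
      obtain d'' where "candidate X e t s d''" using no by blast
      then show ?thesis using candidate_unique[OF d'(1), of s d''] by simp
    qed
    then obtain c' n' where "computation (jump X) c' n'" "entry c' n' (pair e (pair e d'))"
      using candidate_limit by blast
    then show False using computation_unique[OF c(1) _ c(2)] d'(2) by blast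
  qed
  moreover have "Bd (\<lambda>v. ?P (v 0) (v 1))" by (intro Bd_peano Bd_candidate)
  ultimately obtain s0 where s0: "\<forall>t<?t + 1. \<exists>s<s0. ?P s t"
    using bounded_collection[of ?P "?t + 1"] by blast
  have "guess X e s d" if s: "max s0 ?t \<le> s" for s
  proof -
    let ?Q = "\<lambda>t. \<exists>d'\<le>t. candidate X e t s d'"
    have "Bd (\<lambda>v. ?Q (v 0))" by (intro Bd_peano Bd_candidate)
    moreover have "?Q ?t" using cand[of s] candidate_le[OF cand] by blast
    ultimately obtain t where t: "t \<le> ?t" "?Q t" "\<forall>t'<t. \<not> ?Q t'"
      using bounded_least[of ?Q ?t] by blast
    then obtain d' where d': "d' \<le> t" "candidate X e t s d'" by blast
    obtain s' where s': "s' < s0" "?P s' t" using s0 t(1) less_plus_one_iff[of t ?t] by blast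
    have "s' \<le> s" using s'(1) s by auto
    \<comment> \<open>A candidate of stage \<open>s\<close> was one already at the earlier stage
      \<open>s'\<close>, where only the value \<open>d\<close> is left.\<close>
    then have "d' = d" using s'(2) d' candidate_antimono[OF d'(2)] by blast
    moreover have "t \<le> s" using t(1) s by auto
    ultimately show ?thesis unfolding guess_def using t(3) d'(2) by blast
  qed
  then show ?thesis by blast
qed

end

section \<open>The tournament\<close>

context peano_model
begin

abbreviation triple :: "'p \<Rightarrow> 'p \<Rightarrow> 'p \<Rightarrow> 'p \<Rightarrow> bool" where
  "triple d i x y \<equiv> In (pair i (pair x y)) d"

lemma triple_less: "triple d i x y \<Longrightarrow> i < d \<and> x < d \<and> y < d"
  using In_less fst_le_pair snd_le_pair by (meson le_less_trans order_trans)

text \<open>Members of a coded set are less than its code, and so are their components. Hence these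
  quantifiers are bounded although no bound is written.\<close>

lemma Bd_all_triple:
  assumes "Tm D" "Bd (\<lambda>v. R (v (Suc (Suc 0))) (v (Suc 0)) (v 0) (\<lambda>i. v (Suc (Suc (Suc i)))))"
  shows "Bd (\<lambda>v. \<forall>i x y. triple (D v) i x y \<longrightarrow> R i x y v)"
proof -
  have D: "Tm (\<lambda>v. D (\<lambda>i. v (Suc i)))" "Tm (\<lambda>v. D (\<lambda>i. v (Suc (Suc i))))"
    "Tm (\<lambda>v. D (\<lambda>i. v (Suc (Suc (Suc i)))))"
    by (intro Tm_subst[OF assms(1)] Tm_var)+
  have "(\<lambda>v. \<forall>i x y. triple (D v) i x y \<longrightarrow> R i x y v) =
      (\<lambda>v. \<forall>i\<le>D v. \<forall>x\<le>D v. \<forall>y\<le>D v. triple (D v) i x y \<longrightarrow> R i x y v)"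
    using triple_less by (intro ext) (meson less_imp_le)
  moreover have "Bd \<dots>" by (intro Bd_peano Bd_In D assms)
  ultimately show ?thesis by simp
qed

lemma Bd_ex_triple:
  assumes "Tm D" "Bd (\<lambda>v. R (v (Suc (Suc 0))) (v (Suc 0)) (v 0) (\<lambda>i. v (Suc (Suc (Suc i)))))"
  shows "Bd (\<lambda>v. \<exists>i x y. triple (D v) i x y \<and> R i x y v)"
proof -
  have "Bd (\<lambda>v. \<not> (\<forall>i x y. triple (D v) i x y \<longrightarrow> \<not> R i x y v))"
    by (intro Bd_not Bd_all_triple assms)
  then show ?thesis by simp
qed

text \<open>The number \<open>d\<close> codes a sequence of \<open>L\<close> pairs of numbers, all of them distinct.\<close>

definition proper :: "'p \<Rightarrow> 'p \<Rightarrow> bool" where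
  "proper L d \<longleftrightarrow> (\<forall>i<L. \<exists>j x y. triple d j x y \<and> j = i) \<and>
     (\<forall>i x y. triple d i x y \<longrightarrow> x \<noteq> y \<and> (\<forall>i' x' y'. triple d i' x' y' \<longrightarrow>
        x = x' \<or> x = y' \<or> y = x' \<or> y = y' \<longrightarrow> i = i'))"

lemma Bd_proper: "Tm T0 \<Longrightarrow> Tm T1 \<Longrightarrow> Bd (\<lambda>v. proper (T0 v) (T1 v))"
  by (rule Bd_subst2[of proper]) (unfold proper_def, intro Bd_all_triple Bd_ex_triple Bd_peano)

text \<open>Requirement \<open>e\<close> has to spoil its guess if that codes \<open>2e + 1\<close> pairs. A selection at stage \<open>s\<close>
  for the requirements below \<open>k\<close> consists of one pair from each of these guesses, and the selected
  pairs are disjoint.\<close>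

definition selection :: "'b \<Rightarrow> 'p \<Rightarrow> 'p \<Rightarrow> 'p \<Rightarrow> bool" where
  "selection X s u k \<longleftrightarrow>
     (\<forall>e<k. \<forall>d\<le>s. guess X e s d \<longrightarrow> proper (e + e + 1) d \<longrightarrow>
        (\<exists>i x y. triple d i x y \<and> triple u e x y)) \<and>
     (\<forall>e x y. triple u e x y \<longrightarrow> e < k \<and> x \<noteq> y \<and> (\<forall>e' x' y'. triple u e' x' y' \<longrightarrow>
        e = e' \<or> x = x' \<or> x = y' \<or> y = x' \<or> y = y' \<longrightarrow> e = e' \<and> x = x' \<and> y = y'))"

lemma Bd_selection: "Tm T0 \<Longrightarrow> Tm T1 \<Longrightarrow> Tm T2 \<Longrightarrow> Bd (\<lambda>v. selection X (T0 v) (T1 v) (T2 v))"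
  by (rule Bd_subst3[of "selection X"])
    (unfold selection_def, intro Bd_all_triple Bd_ex_triple Bd_peano Bd_guess Bd_proper Bd_In)

lemma insert_code: "\<exists>d'. \<forall>z. In z d' \<longleftrightarrow> In z d \<or> z = a"
proof -
  have "Bd (\<lambda>v. In (v 0) d \<or> v 0 = a)" by (intro Bd_peano Bd_In)
  from finite_comprehension[of "\<lambda>z. In z d \<or> z = a", OF this, of "d + a + 1"]
  obtain d' where d': "\<And>z. In z d' \<longleftrightarrow> z < d + a + 1 \<and> (In z d \<or> z = a)" by blast
  have "z < d + a + 1" if "In z d \<or> z = a" for z
    using that In_less[of z d] unfolding less_plus_one_iff
    by (auto intro: add_increasing add_increasing2 less_imp_le)
  then show ?thesis using d' by blast
qed

lemma empty_code: "\<exists>d. \<forall>z. \<not> In z d"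
proof -
  have "Bd (\<lambda>v. False)" by (rule Bd_const)
  from finite_comprehension[of "\<lambda>z. False", OF this] show ?thesis by blast
qed

text \<open>Each of the \<open>k\<close> pairs selected so far meets at most two of the \<open>2k + 1\<close> pairs of the guess.\<close>

lemma disjoint_pair:
  assumes sel: "selection X s u k" and d: "proper (k + k + 1) d"
  shows "\<exists>i x y. triple d i x y \<and> (\<forall>e x' y'. triple u e x' y' \<longrightarrow>
    x \<noteq> x' \<and> x \<noteq> y' \<and> y \<noteq> x' \<and> y \<noteq> y')"
proof (rule ccontr)
  assume no: "\<not> ?thesis"
  \<comment> \<open>Hole \<open>e\<close> stands for the first number of the pair selected for
    \<open>e\<close>, hole \<open>k + e\<close> for the second. Two pairs of the guess in one hole
    share that number.\<close>
  let ?R = "\<lambda>i j. \<exists>i' x y. triple d i' x y \<and> i' = i \<and> (\<exists>e x' y'. triple u e x' y' \<and>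
    ((j = e \<and> (x' = x \<or> x' = y)) \<or> (j = k + e \<and> (y' = x \<or> y' = y))))"
  have "Bd (\<lambda>v. ?R (v 0) (v 1))" by (intro Bd_ex_triple Bd_peano)
  moreover have "\<exists>j<k + k. ?R i j" if i: "i \<le> k + k" for i
  proof -
    obtain x y where xy: "triple d i x y"
      using d i unfolding proper_def less_plus_one_iff by blast
    then obtain e x' y' where e: "triple u e x' y'" "x = x' \<or> x = y' \<or> y = x' \<or> y = y'"
      using no by blast
    have "e < k" using sel e(1) unfolding selection_def by blast
    then have "e < k + k" "k + e < k + k" by (auto intro: less_le_trans)
    then show ?thesis using xy e by blast
  qed
  ultimately obtain i i' j where ij: "i \<noteq> i'" "?R i j" "?R i' j"
    using pigeonhole[of ?R "k + k"] by blast
  obtain x y e a b where 1: "triple d i x y" "triple u e a b"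
    "(j = e \<and> (a = x \<or> a = y)) \<or> (j = k + e \<and> (b = x \<or> b = y))"
    using ij(2) by blast
  obtain x' y' e' a' b' where 2: "triple d i' x' y'" "triple u e' a' b'"
    "(j = e' \<and> (a' = x' \<or> a' = y')) \<or> (j = k + e' \<and> (b' = x' \<or> b' = y'))"
    using ij(3) by blast
  have "e < k" "e' < k" using sel 1(2) 2(2) unfolding selection_def by blast+
  then have ne: "e \<noteq> k + e'" "e' \<noteq> k + e" by (auto simp: not_less dest: leD)
  then have "e = e'" using 1(3) 2(3) by auto
  then have "a = a'" "b = b'" using sel 1(2) 2(2) unfolding selection_def by blast+
  then have "x = x' \<or> x = y' \<or> y = x' \<or> y = y'" using 1(3) 2(3) ne \<open>e = e'\<close> by auto
  then show False using d 1(1) 2(1) ij(1) unfolding proper_def by blast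
qed

text \<open>Sigma^0_1 induction on \<open>k\<close> with the code of the selection as witness.
  Requirement \<open>k\<close> receives a pair that avoids all earlier ones, so nothing has to be
  revised.\<close>

lemma selection_exists: "\<exists>u. selection X s u k"
proof (rule sigma1_induct[of "selection X s"])
  show "Bd (\<lambda>v. selection X s (v 0) (v 1))" by (intro Bd_selection Bd_peano)
  obtain u where "\<And>z. \<not> In z u" using empty_code by blast
  then have "selection X s u 0" unfolding selection_def by (simp add: not_less)
  then show "\<exists>u. selection X s u 0" ..
next
  fix k assume "\<exists>u. selection X s u k"
  then obtain u where u: "selection X s u k" ..
  have lt: "e < k + 1 \<longleftrightarrow> e < k \<or> e = k" for e by (simp add: less_plus_one_iff le_less)
  show "\<exists>u. selection X s u (k + 1)"
  proof (cases "\<exists>d. guess X k s d \<and> proper (k + k + 1) d")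
    case False
    then have "selection X s u (k + 1)" using u unfolding selection_def lt by blast
    then show ?thesis ..
  next
    case True
    then obtain d where d: "guess X k s d" "proper (k + k + 1) d" by blast
    obtain i x y where xy: "triple d i x y"
      "\<And>e x' y'. triple u e x' y' \<Longrightarrow> x \<noteq> x' \<and> x \<noteq> y' \<and> y \<noteq> x' \<and> y \<noteq> y'"
      using disjoint_pair[OF u d(2)] by blast
    obtain u' where "\<And>z. In z u' \<longleftrightarrow> In z u \<or> z = pair k (pair x y)" using insert_code by blast
    then have u': "triple u' e a b \<longleftrightarrow> triple u e a b \<or> e = k \<and> a = x \<and> b = y" for e a b
      by simp
    have "x \<noteq> y" using d(2) xy(1) unfolding proper_def by blast
    have old: "e < k \<and> a \<noteq> b" if "triple u e a b" for e a b
      using u that unfolding selection_def by blast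
    have old_unique: "e = e' \<and> a = a' \<and> b = b'"
      if "triple u e a b" "triple u e' a' b'" "e = e' \<or> a = a' \<or> a = b' \<or> b = a' \<or> b = b'"
      for e a b e' a' b'
      using u that unfolding selection_def by blast
    have "selection X s u' (k + 1)"
      unfolding selection_def
    proof (intro conjI allI impI)
      fix e d' assume e: "e < k + 1" "d' \<le> s" "guess X e s d'" "proper (e + e + 1) d'"
      show "\<exists>i x y. triple d' i x y \<and> triple u' e x y"
      proof (cases "e = k")
        case True
        then have "d' = d" using guess_unique e(3) d(1) by blast
        then show ?thesis using xy(1) u' True by blast
      next
        case False
        then have "e < k" using e(1) lt by blast
        then have "\<exists>i x y. triple d' i x y \<and> triple u e x y"
          using u e(2-4) unfolding selection_def by blast
        then show ?thesis using u' by blast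
      qed
    next
      fix e a b assume "triple u' e a b"
      then show "e < k + 1" "a \<noteq> b"
        using old \<open>x \<noteq> y\<close> unfolding u' lt by blast+
    next
      fix e a b e' a' b'
      assume *: "triple u' e a b" "triple u' e' a' b'"
        "e = e' \<or> a = a' \<or> a = b' \<or> b = a' \<or> b = b'"
      consider "triple u e a b" "triple u e' a' b'" | "triple u e a b" "e' = k \<and> a' = x \<and> b' = y" |
        "e = k \<and> a = x \<and> b = y" "triple u e' a' b'" |
        "e = k \<and> a = x \<and> b = y" "e' = k \<and> a' = x \<and> b' = y"
        using *(1,2) unfolding u' by blast
      then have "e = e' \<and> a = a' \<and> b = b'"
      proof cases
        case 1
        then show ?thesis using old_unique *(3) by blast
      next
        case 2
        then show ?thesis using old[OF 2(1)] xy(2)[OF 2(1)] *(3) by auto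
      next
        case 3
        then show ?thesis using old[OF 3(2)] xy(2)[OF 3(2)] *(3) by auto
      qed auto
      then show "e = e'" "a = a'" "b = b'" by auto
    qed
    then show ?thesis ..
  qed
qed

text \<open>Taking the least code makes the selection a function of the stage, which the Delta^0_1
  definition of the edges relies on.\<close>

definition least_selection :: "'b \<Rightarrow> 'p \<Rightarrow> 'p \<Rightarrow> bool" where
  "least_selection X s u \<longleftrightarrow> selection X s u s \<and> (\<forall>u'<u. \<not> selection X s u' s)"

lemma Bd_least_selection: "Tm T0 \<Longrightarrow> Tm T1 \<Longrightarrow> Bd (\<lambda>v. least_selection X (T0 v) (T1 v))"
  by (rule Bd_subst2[of "least_selection X"])
    (unfold least_selection_def, intro Bd_peano Bd_selection)

lemma least_selection_exists: "\<exists>u. least_selection X s u"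
proof -
  obtain u where "selection X s u s" using selection_exists by blast
  moreover have "Bd (\<lambda>v. selection X s (v 0) s)" by (intro Bd_selection Bd_peano)
  ultimately show ?thesis
    using bounded_least[of "\<lambda>u. selection X s u s" u] unfolding least_selection_def by blast
qed

lemma least_selection_unique:
  assumes "least_selection X s u" "least_selection X s u'"
  shows "u = u'"
  using assms linorder_less_linear[of u u'] unfolding least_selection_def by blast

definition second :: "'p \<Rightarrow> 'p \<Rightarrow> bool" where
  "second u x \<longleftrightarrow> (\<exists>e z y. triple u e z y \<and> y = x)"

lemma Bd_second: "Tm T0 \<Longrightarrow> Tm T1 \<Longrightarrow> Bd (\<lambda>v. second (T0 v) (T1 v))"
  by (rule Bd_subst2[of second]) (unfold second_def, intro Bd_ex_triple Bd_peano)

text \<open>An edge leads to \<open>s\<close> from those smaller numbers which are second in a pair selected at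
  stage \<open>s\<close>.\<close>

definition edge :: "'b \<Rightarrow> 'p \<Rightarrow> 'p \<Rightarrow> bool" where
  "edge X x y \<longleftrightarrow> (x < y \<and> (\<exists>u. least_selection X y u \<and> second u x)) \<or>
     (y < x \<and> (\<exists>u. least_selection X x u \<and> \<not> second u y))"

lemma edge_iff_less:
  "least_selection X y u \<Longrightarrow> x < y \<Longrightarrow> edge X x y \<longleftrightarrow> second u x"
  unfolding edge_def using least_selection_unique by (metis less_asym)

lemma edge_iff_greater:
  "least_selection X x u \<Longrightarrow> y < x \<Longrightarrow> edge X x y \<longleftrightarrow> \<not> second u y"
  unfolding edge_def using least_selection_unique by (metis less_asym)

text \<open>\<open>?P\<close> asserts the edge for some least selection \<open>u\<close>, and
  \<open>?Q\<close> for all of them. They agree because there is exactly one, which makes the edge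
  relation Delta^0_1.\<close>

lemma edge_set: "\<exists>T. \<forall>z. mem z T \<longleftrightarrow> (\<exists>x y. z = pair x y \<and> edge X x y)"
proof -
  let ?P = "\<lambda>u n. \<exists>x\<le>n. \<exists>y\<le>n. n = pair x y \<and>
    (x < y \<and> least_selection X y u \<and> second u x \<or> y < x \<and> least_selection X x u \<and> \<not> second u y)"
  let ?Q = "\<lambda>u n. \<exists>x\<le>n. \<exists>y\<le>n. n = pair x y \<and>
    (x < y \<and> (least_selection X y u \<longrightarrow> second u x) \<or>
     y < x \<and> (least_selection X x u \<longrightarrow> \<not> second u y))"
  have P: "(\<exists>u. ?P u n) \<longleftrightarrow> (\<exists>x y. n = pair x y \<and> edge X x y)" for n
    unfolding edge_def using fst_le_pair snd_le_pair by blast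
  have Q: "(\<forall>u. ?Q u n) \<longleftrightarrow> (\<exists>x y. n = pair x y \<and> edge X x y)" for n
  proof (cases "\<exists>x y. n = pair x y")
    case True
    then obtain x y where n: "n = pair x y" by blast
    have *: "?Q u n \<longleftrightarrow> x < y \<and> (least_selection X y u \<longrightarrow> second u x) \<or>
      y < x \<and> (least_selection X x u \<longrightarrow> \<not> second u y)" for u
      unfolding n using fst_le_pair snd_le_pair by auto
    obtain u where u: "least_selection X x u" using least_selection_exists by blast
    obtain u' where u': "least_selection X y u'" using least_selection_exists by blast
    consider "x < y" | "y < x" | "x = y" using linorder_less_linear[of x y] by blast
    then show ?thesis
    proof cases
      case 1
      then have "\<not> y < x" by simp
      with 1 have "(\<forall>u. ?Q u n) \<longleftrightarrow> (\<forall>u. least_selection X y u \<longrightarrow> second u x)"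
        unfolding * by simp
      also have "\<dots> \<longleftrightarrow> second u' x" using least_selection_unique[OF u'] u' by metis
      finally show ?thesis using edge_iff_less[OF u' 1] n by simp
    next
      case 2
      then have "\<not> x < y" by simp
      with 2 have "(\<forall>u. ?Q u n) \<longleftrightarrow> (\<forall>u. least_selection X x u \<longrightarrow> \<not> second u y)"
        unfolding * by simp
      also have "\<dots> \<longleftrightarrow> \<not> second u y" using least_selection_unique[OF u] u by metis
      finally show ?thesis using edge_iff_greater[OF u 2] n by simp
    next
      case 3
      then show ?thesis unfolding * edge_def n by auto
    qed
  qed auto
  have BP: "Bd (\<lambda>v. ?P (v 0) (v 1))" by (intro Bd_peano Bd_least_selection Bd_second)
  have BQ: "Bd (\<lambda>v. ?Q (v 0) (v 1))" by (intro Bd_peano Bd_least_selection Bd_second)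
  from delta1_comprehension[of ?P ?Q, OF BP BQ, unfolded P Q] show ?thesis by blast
qed

lemma edge_tournament:
  assumes "\<And>z. mem z T \<longleftrightarrow> (\<exists>x y. z = pair x y \<and> edge X x y)" "\<And>x. mem x D"
  shows "tournament T D"
proof -
  have less: "edge X x y \<longleftrightarrow> \<not> edge X y x" if xy: "x < y" for x y
  proof -
    obtain u where u: "least_selection X y u" using least_selection_exists by blast
    show ?thesis using edge_iff_less[OF u xy] edge_iff_greater[OF u xy] by blast
  qed
  have neq: "edge X x y \<longleftrightarrow> \<not> edge X y x" if "x \<noteq> y" for x y
    using that less[of x y] less[of y x] linorder_less_linear[of x y] by blast
  have T: "mem (pair x y) T \<longleftrightarrow> edge X x y" for x y using assms(1) by simp
  show ?thesis
    unfolding tournament_def T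
  proof (intro conjI allI impI)
    show "\<exists>x y. mem x D \<and> mem y D \<and> z = pair x y" if "mem z T" for z
      using that assms by auto
    show "\<not> edge X x x" for x by (simp add: edge_def)
    show "edge X x y \<longleftrightarrow> \<not> edge X y x" if "mem x D \<and> mem y D \<and> x \<noteq> y" for x y
      using that neq[of x y] by blast
  qed
qed

text \<open>The pair selected for \<open>e\<close> at stage \<open>s\<close> yields a cycle through
  \<open>s\<close>. No set \<open>H\<close> appears: only the instances of transitivity that end in
  \<open>s\<close> matter.\<close>

lemma spoiled:
  assumes g: "guess X e s d" "proper (e + e + 1) d" and "e < s"
    and edges: "\<And>i x y. triple d i x y \<Longrightarrow> edge X x y"
    and trans: "\<And>i x y. triple d i x y \<Longrightarrow> edge X x y \<Longrightarrow> edge X y s \<Longrightarrow> edge X x s"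
  shows False
proof -
  obtain u where u: "least_selection X s u" using least_selection_exists by blast
  then have sel: "selection X s u s" unfolding least_selection_def by blast
  have "d \<le> s" using g(1) by (rule guess_le)
  then obtain i x y where xy: "triple d i x y" "triple u e x y"
    using sel g \<open>e < s\<close> unfolding selection_def by blast
  \<comment> \<open>Since \<open>d \<le> s\<close>, both numbers are below \<open>s\<close>, so
    their edges with \<open>s\<close> follow the selection of stage \<open>s\<close>.\<close>
  have lt: "x < s" "y < s" using triple_less[OF xy(1)] \<open>d \<le> s\<close> by auto
  have "edge X y s" unfolding edge_iff_less[OF u lt(2)] second_def using xy(2) by blast
  \<comment> \<open>A selected pair with second component \<open>x\<close> would meet the pair of
    \<open>e\<close>, hence coincide with it, giving \<open>y = x\<close>.\<close>
  moreover have "\<not> second u x"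
  proof
    assume "second u x"
    then obtain e' z where "triple u e' z x" unfolding second_def by blast
    then have "y = x" using sel xy(2) unfolding selection_def by blast
    then show False using sel xy(2) unfolding selection_def by blast
  qed
  then have "\<not> edge X x s" unfolding edge_iff_less[OF u lt(1)] .
  ultimately show False using trans xy(1) edges by blast
qed

section \<open>The diagonally non-computable function\<close>

definition block :: "'b \<Rightarrow> 'b \<Rightarrow> 'p \<Rightarrow> 'p \<Rightarrow> bool" where
  "block H T L d \<longleftrightarrow> proper L d \<and>
     (\<forall>i x y. triple d i x y \<longrightarrow> mem x H \<and> mem y H \<and> mem (pair x y) T)"

lemma Bd_block: "Tm T0 \<Longrightarrow> Tm T1 \<Longrightarrow> Bd (\<lambda>v. block H T (T0 v) (T1 v))"
  by (rule Bd_subst2[of "block H T"])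
    (unfold block_def, intro Bd_all_triple Bd_peano Bd_proper)

text \<open>Sigma^0_1 induction on the number of pairs. Two new vertices above the code
  \<open>d\<close> differ from all vertices in it, and the tournament tells in which order to take
  them.\<close>

lemma block_exists:
  assumes T: "tournament T D" and H: "\<And>x. mem x H \<Longrightarrow> mem x D" "\<And>n. \<exists>m>n. mem m H"
  shows "\<exists>d. block H T L d"
proof (rule sigma1_induct[of "\<lambda>d L. block H T L d"])
  show "Bd (\<lambda>v. block H T (v 1) (v 0))" by (intro Bd_block Bd_peano)
  obtain d where "\<And>z. \<not> In z d" using empty_code by blast
  then have "block H T 0 d" unfolding block_def proper_def by (simp add: not_less)
  then show "\<exists>d. block H T 0 d" ..
next
  fix L assume "\<exists>d. block H T L d"
  then obtain d where d: "block H T L d" ..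
  obtain a where a: "d < a" "mem a H" using H(2) by blast
  obtain b where b: "a < b" "mem b H" using H(2) by blast
  have "mem (pair a b) T \<or> mem (pair b a) T"
    using T a b H(1) unfolding tournament_def by (metis less_irrefl)
  then obtain x y where xy: "mem (pair x y) T" "x = a \<and> y = b \<or> x = b \<and> y = a" by blast
  have big: "d < x" "d < y" "x \<noteq> y" "mem x H" "mem y H" using xy(2) a b by auto
  obtain d' where "\<And>z. In z d' \<longleftrightarrow> In z d \<or> z = pair L (pair x y)" using insert_code by blast
  then have d': "triple d' i p q \<longleftrightarrow> triple d i p q \<or> i = L \<and> p = x \<and> q = y" for i p q
    by simp
  have old: "p < d" "q < d" "p \<noteq> q" "mem p H" "mem q H" "mem (pair p q) T" if "triple d i p q" for i p q
    using that triple_less d unfolding block_def proper_def by blast+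
  have old_unique: "i = i'" if "triple d i p q" "triple d i' p' q'"
    "p = p' \<or> p = q' \<or> q = p' \<or> q = q'" for i p q i' p' q'
    using that d unfolding block_def proper_def by blast
  have lt: "i < L + 1 \<longleftrightarrow> i < L \<or> i = L" for i by (simp add: less_plus_one_iff le_less)
  have "block H T (L + 1) d'"
    unfolding block_def proper_def
  proof (intro conjI allI impI)
    fix i assume "i < L + 1"
    then show "\<exists>j x y. triple d' j x y \<and> j = i"
      using d unfolding lt d' block_def proper_def by blast
  next
    fix i p q assume "triple d' i p q"
    then show "p \<noteq> q" "mem p H" "mem q H" "mem (pair p q) T"
      using old big xy(1) unfolding d' by blast+
  next
    fix i p q i' p' q'
    assume *: "triple d' i p q" "triple d' i' p' q'" "p = p' \<or> p = q' \<or> q = p' \<or> q = q'"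
    consider "triple d i p q" "triple d i' p' q'" | "triple d i p q" "i' = L \<and> p' = x \<and> q' = y" |
      "i = L \<and> p = x \<and> q = y" "triple d i' p' q'" |
      "i = L \<and> p = x \<and> q = y" "i' = L \<and> p' = x \<and> q' = y"
      using *(1,2) unfolding d' by blast
    then show "i = i'"
    proof cases
      case 1
      then show ?thesis using old_unique *(3) by blast
    next
      case 2
      then show ?thesis using old(1,2)[OF 2(1)] big(1,2) *(3) by auto
    next
      case 3
      then show ?thesis using old(1,2)[OF 3(2)] big(1,2) *(3) by auto
    qed auto
  qed
  then show "\<exists>d. block H T (L + 1) d" ..
qed

lemma EM_imp_DNR_jump:
  assumes "sat v w EM"
  shows "sat v w DNR_jump"
  unfolding sat_DNR_jump
proof
  fix X
  obtain T where T: "\<And>z. mem z T \<longleftrightarrow> (\<exists>x y. z = pair x y \<and> edge X x y)" using edge_set by blast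
  have "Bd (\<lambda>v. True)" by (rule Bd_const)
  from bounded_comprehension[of "\<lambda>_. True", OF this] obtain D where D: "\<And>x. mem x D" by blast
  have tourn: "tournament T D" using edge_tournament T D by blast
  have "\<exists>m>n. mem m D" for n using D less_plus_one_iff[of n n] by blast
  then have "(\<forall>n. \<exists>m>n. mem m D) \<and> tournament T D" using tourn by simp
  from assms[unfolded sat_EM, THEN spec, THEN spec, THEN mp, OF this] obtain H where inf: "\<forall>n. \<exists>m>n. mem m H" and trans: "\<forall>x y z. mem x H \<and> mem y H \<and> mem z H \<and>
      mem (pair x y) T \<and> mem (pair y z) T \<longrightarrow> mem (pair x z) T"
    by (elim exE conjE) (rule that)
  have H: "\<exists>m>n. mem m H" for n using inf by simp
  have T_pair: "mem (pair x y) T \<longleftrightarrow> edge X x y" for x y using T by auto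
  \<comment> \<open>Being a block is bounded in \<open>H\<close> and \<open>T\<close>, so the least
    one gives a function by bounded comprehension, without reference to the jump.\<close>
  let ?f = "\<lambda>e d. block H T (e + e + 1) d \<and> (\<forall>d'<d. \<not> block H T (e + e + 1) d')"
  have "Bd (\<lambda>v. \<exists>e\<le>v 0. \<exists>d\<le>v 0. v 0 = pair e d \<and> ?f e d)" by (intro Bd_peano Bd_block)
  from bounded_comprehension[of "\<lambda>z. \<exists>e\<le>z. \<exists>d\<le>z. z = pair e d \<and> ?f e d", OF this]
  obtain F where F: "\<And>z. mem z F \<longleftrightarrow> (\<exists>e\<le>z. \<exists>d\<le>z. z = pair e d \<and> ?f e d)" by blast
  have F_pair: "mem (pair e d) F \<longleftrightarrow> ?f e d" for e d
    unfolding F using fst_le_pair snd_le_pair by auto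
  show "\<exists>F. (\<forall>z. mem z F \<longrightarrow> (\<exists>x y. z = pair x y)) \<and>
     (\<forall>x. \<exists>y. mem (pair x y) F) \<and>
     (\<forall>x y z. mem (pair x y) F \<and> mem (pair x z) F \<longrightarrow> y = z) \<and>
     (\<forall>e y. (\<exists>c n. computation (jump X) c n \<and> entry c n (pair e (pair e y))) \<longrightarrow>
        \<not> mem (pair e y) F)"
  proof (rule exI[of _ F], intro conjI allI impI notI)
    fix z assume "mem z F"
    then show "\<exists>x y. z = pair x y" unfolding F by blast
  next
    fix e
    obtain d where "block H T (e + e + 1) d" using block_exists[OF tourn _ H] D by blast
    moreover have "Bd (\<lambda>v. block H T (e + e + 1) (v 0))" by (intro Bd_block Bd_peano)
    ultimately show "\<exists>d. mem (pair e d) F"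
      unfolding F_pair using bounded_least[of "block H T (e + e + 1)" d] by blast
  next
    fix e d d' assume "mem (pair e d) F \<and> mem (pair e d') F"
    then show "d = d'" unfolding F_pair using linorder_less_linear[of d d'] by blast
  next
    fix e d assume "\<exists>c n. computation (jump X) c n \<and> entry c n (pair e (pair e d))"
      and "mem (pair e d) F"
    then obtain s0 where s0: "\<And>s. s0 \<le> s \<Longrightarrow> guess X e s d" using guess_limit by blast
    have d: "block H T (e + e + 1) d" using \<open>mem (pair e d) F\<close> unfolding F_pair by blast
    \<comment> \<open>Beyond \<open>s0\<close> the guess for \<open>e\<close> is \<open>d\<close>,
      and \<open>e < s\<close> makes \<open>e\<close> one of the requirements served at stage
      \<open>s\<close>.\<close>
    obtain s where s: "max s0 e < s" "mem s H" using H by blast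
    show False
    proof (rule spoiled)
      show "guess X e s d" "e < s" using s0 s(1) by auto
      show "proper (e + e + 1) d" using d unfolding block_def by blast
      fix i x y assume xy: "triple d i x y"
      then have "mem x H" "mem y H" "mem (pair x y) T" using d unfolding block_def by blast+
      then show "edge X x y" "edge X y s \<Longrightarrow> edge X x s"
        using trans[rule_format, of x y s] s(2) unfolding T_pair by simp_all
    qed
  qed
qed

end

section \<open>Derivability\<close>

text \<open>Makes the term model infinite. Successors are stripped from both sides until one side is
  0 and the other a successor.\<close>

lemma numerals_distinct: "n < m \<Longrightarrow> RCA0 \<turnstile> Neg (Eq (s_num m 0) (s_num n 0))"
proof (induction m arbitrary: n)
  case (Suc m)
  have num_Suc: "s_num (Suc k) 0 = Plus (s_num k 0) One" for k by (simp add: s_num_def)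
  show ?case
  proof (cases n)
    case 0
    have "RCA0 \<turnstile> ForallN (Neg (Eq (Plus (Var 0) One) Zero))"
      by (rule derives.Assm) (simp add: RCA0_def basic_axioms_def s_all_def s_neg_def s_eq_def
          s_plus_def s_one_def s_zero_def bound_num_def)
    from ForallNE[OF this, of "s_num m 0"] show ?thesis
      by (simp add: 0 num_Suc instN_def s_num_def[of 0])
  next
    case (Suc k)
    let ?t = "s_num m 0" and ?u = "s_num k 0"
    have "RCA0 \<turnstile> ForallN (ForallN (Imp (Eq (Plus (Var 1) One) (Plus (Var 0) One)) (Eq (Var 1) (Var 0))))"
      by (rule derives.Assm) (simp add: RCA0_def basic_axioms_def s_all_def s_imp_def s_eq_def
          s_plus_def s_one_def bound_num_def)
    from ForallNE[OF ForallNE[OF this, of ?t, unfolded instN_def, simplified], of ?u]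
    have "RCA0 \<turnstile> Imp (Eq (Plus ?t One) (Plus ?u One)) (Eq ?t ?u)"
      by (simp add: instN_def)
    then have "insert (Eq (Plus ?t One) (Plus ?u One)) RCA0 \<turnstile> Eq ?t ?u"
      by (blast intro: derives.ImpE derives.Assm derives_weaken)
    moreover have "insert (Eq (Plus ?t One) (Plus ?u One)) RCA0 \<turnstile> Neg (Eq ?t ?u)"
      by (rule derives_weaken[OF Suc.IH]) (use Suc Suc.prems in auto)
    ultimately show ?thesis
      unfolding Suc num_Suc Neg_def by (blast intro: derives.ImpI derives.ImpE)
  qed
qed simp

lemma subst_s_num: "subst_tm s (s_num n 0) = s_num n 0"
  unfolding s_num_def by (induction n) simp_all

theorem theorem3p10:
  shows "RCA0 \<turnstile> Imp EM DNR_jump"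
proof (rule ccontr)
  assume no: "\<not> RCA0 \<turnstile> Imp EM DNR_jump"
  let ?G = "insert (Neg DNR_jump) (insert EM RCA0)"
  have cons: "\<not> ?G \<turnstile> Falsum"
    using no by (blast intro: derives.Contr derives.ImpI)
  have dist: "?G \<turnstile> Neg (Eq (s_num m 0) (s_num n 0))" if "n < m" for m n
    by (rule derives_weaken[OF numerals_distinct[OF that]]) blast
  have "?G = RCA0 \<union> {EM, Neg DNR_jump}" by blast
  with completeness[where num = "\<lambda>n. s_num n 0", OF cons dist subst_s_num infinite_number]
  have "\<exists>z e p t l. countermodel z e p t l" unfolding countermodel_def by simp
  \<comment> \<open>As a countermodel exists now, the operations chosen for \<open>number\<close>
    are those of one, so everything proved for the class \<open>peano\<close> holds in it.\<close>
  then have "countermodel (0 :: number) 1 (+) (*) (<)" using number_class_ops(2) by blast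
  then obtain mem :: "number \<Rightarrow> nat \<Rightarrow> bool" and v w where
    sat: "\<And>q. q \<in> RCA0 \<union> {EM, Neg DNR_jump} \<Longrightarrow> number_structure.sat 0 1 (+) (*) (<) mem v w q"
    unfolding countermodel_def by blast
  interpret rca0_model "0 :: number" 1 "(+)" "(*)" "(<)" mem
    by (rule number_structure.sat_RCA0_imp_model[OF sat surj_from_nat surj_id]) blast
  interpret peano_model mem ..
  have "sat v w EM" "sat v w (Neg DNR_jump)" using sat by blast+
  then show False using EM_imp_DNR_jump by simp
qed

end
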